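(* Let $L\ge 2$ and let $|\psi\rangle = U|0\rangle^{\otimes L}$, where $U$ is a matchgate circuit in right standard form (RSF) on $L$ qubits. Let $A$ be a matchgate and let $1\le q\le L-1$. Then the state $A_{q,q+1}|\psi\rangle$ can again be written as $\tilde U|0\rangle^{\otimes L}$ with $\tilde U$ a matchgate circuit in RSF (with a potentially different RSF label). Moreover, such a circuit $\tilde U$ may be obtained by applying the absorption algorithm to $U$ and $A_{q,q+1}$.
   Context: Matchgate: a two-qubit unitary which in the basis $|00\rangle,|01\rangle,|10\rangle,|11\rangle$ has the form $$G(A,B)=\begin{pmatrix} a_{11} & 0 & 0 & a_{12} \\ 0 & b_{11} & b_{12} & 0 \\ 0 & b_{21} & b_{22} & 0 \\ a_{21} & 0 & 0 & a_{22} \end{pmatrix}$$ with $A=(a_{ij})$, $B=(b_{ij})$ unitary $2\times2$ matrices and $\det A=\det B$. Matchgates are applied only to nearest-neighbor qubits of a line of qubits $1,\dots,L$; $U_{j,j+1}$ denotes the gate $U$ acting on qubits $j,j+1$ (tensored with the identity elsewhere). Products of gates act on states from right to left. Right standard form: let $0\le n_d\le L/2$ and let $((k_i,l_i))_{i=1}^{n_d}$ be pairs of integers with $k_1\ge 1$, $k_i\le k_{i+1}-2$, and $1\le l_i\le L-k_i$. A circuit is in the RSF labeled by $((k_i,l_i))_{i=1}^{n_d}$ if it is the product $D^{(1)}D^{(2)}\cdots D^{(n_d)}$ of "diagonals" $D^{(i)}=U^{(i,l_i)}_{k_i+l_i-1,k_i+l_i}\cdots U^{(i,2)}_{k_i+1,k_i+2}U^{(i,1)}_{k_i,k_i+1}$,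 where the $U^{(i,j)}$ are two-qubit gates (here: matchgates). The empty circuit ($n_d=0$) is allowed. Circuits that differ only by exchanging the order of gates acting on disjoint qubits are identified. Conventions for the algorithm. Gates of a circuit "locally form a sequence $XYZ$" if, after exchanging gates acting on disjoint qubits, they appear consecutively as $XYZ$ in the product; they "locally form a sequence $XY|000\rangle$" if in addition no other gate acts on the three involved qubits before them. Yang–Baxter move: replacing $U_{i-1,i}U'_{i,i+1}U''_{i-1,i}$ by matchgates $V_{i,i+1}V'_{i-1,i}V''_{i,i+1}$ with the same product, or conversely (this is always possible for matchgates). Left-right move: replacing $U_{i-1,i}U'_{i,i+1}|000\rangle$ by $V_{i,i+1}V'_{i-1,i}|000\rangle$ with $V,V'$ matchgates giving the same state, or conversely (this is always possible for matchgates). Absorption algorithm. Input: an RSF matchgate circuit and a matchgate $A$ applied after it on qubits $q,q+1$. The gate $A$ is tracked. At the start and after each step, if $A$ is adjacent (up to exchanging gates on disjoint qubits) to another gate acting on the same pair of qubits, the two are multiplied into a single gate and the algorithm terminates. Step 1: If $A$ is locally part of a sequence $A_{i-1,i}U_{i,i+1}U'_{i-1,i}$, replace it by a Yang–Baxter move with $V_{i,i+1}V'_{i-1,i}A'_{i,i+1}$, relabel $A\leftarrow A'$, and repeat Step 1. Otherwise go to Step 2. Step 2: If $A$ is locally part of a sequence $A_{i-1,i}U_{i,i+1}|000\rangle$, replace it by a left-right move with $V_{i,i+1}A'_{i-1,i}|000\rangle$ and relabel $A\leftarrow A'$. Go to Step 3. Step 3: If $A$ is locally part of a sequence $U_{i-1,i}A_{i,i+1}|000\rangle$,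 replace it by a left-right move with $A'_{i,i+1}V_{i-1,i}|000\rangle$ and relabel $A\leftarrow A'$. Go to Step 4. Step 4: If $A$ is locally part of a sequence $U_{i-1,i}U'_{i,i+1}A_{i-1,i}$, replace it by a Yang–Baxter move with $A'_{i,i+1}V_{i-1,i}V'_{i,i+1}$, relabel $A\leftarrow A'$, and repeat Step 4. Otherwise terminate. *)

theory Defs
  imports Complex_Main "Jordan_Normal_Form.Schur_Decomposition"
begin

section \<open>Matchgates\<close>

definition unitary_mat :: "complex mat \<Rightarrow> bool" where
  "unitary_mat A \<longleftrightarrow> square_mat A
     \<and> A * mat_adjoint A = 1\<^sub>m (dim_row A) \<and> mat_adjoint A * A = 1\<^sub>m (dim_row A)"

definition G_mat :: "complex mat \<Rightarrow> complex mat \<Rightarrow> complex mat" where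
  "G_mat A B = mat_of_rows_list 4
     [[A $$ (0,0),           0,           0, A $$ (0,1)],
      [          0, B $$ (0,0), B $$ (0,1),           0],
      [          0, B $$ (1,0), B $$ (1,1),           0],
      [A $$ (1,0),           0,           0, A $$ (1,1)]]"

definition matchgate :: "complex mat \<Rightarrow> bool" where
  "matchgate M \<longleftrightarrow> (\<exists>A \<in> carrier_mat 2 2. \<exists>B \<in> carrier_mat 2 2.
     unitary_mat A \<and> unitary_mat B \<and> det A = det B \<and> M = G_mat A B)"


section \<open>Circuits on a line of qubits\<close>

text \<open>
  States of \<open>L\<close> qubits are vectors of dimension \<open>2 ^ L\<close>. The qubits are numbered \<open>1, \<dots>, L\<close>, and
  the basis vector with index \<open>x\<close> is \<open>|x\<^sub>1 \<dots> x\<^sub>L\<rangle>\<close> where \<open>x\<^sub>1 \<dots> x\<^sub>L\<close> are the binary digits of \<open>x\<close>,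
  most significant digit first.
\<close>

definition kron :: "complex mat \<Rightarrow> complex mat \<Rightarrow> complex mat" where
  "kron A B = mat (dim_row A * dim_row B) (dim_col A * dim_col B)
     (\<lambda>(i,j). A $$ (i div dim_row B, j div dim_col B) * B $$ (i mod dim_row B, j mod dim_col B))"

text \<open>\<open>gate_at L j U\<close> is the gate \<open>U\<close> on qubits \<open>j, j + 1\<close>; it is meaningful for \<open>1 \<le> j < L\<close>.\<close>

definition gate_at :: "nat \<Rightarrow> nat \<Rightarrow> complex mat \<Rightarrow> complex mat" where
  "gate_at L j U = kron (kron (1\<^sub>m (2 ^ (j - 1))) U) (1\<^sub>m (2 ^ (L - (j + 1))))"

definition ket0 :: "nat \<Rightarrow> complex vec" where
  "ket0 L = unit_vec (2 ^ L) 0"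

text \<open>
  A circuit is the list of its gates in the order in which they are written as a product, so that
  the head of the list is applied last. The number paired with a gate is the first of the two
  neighbouring qubits it acts on.
\<close>

type_synonym circuit = "(nat \<times> complex mat) list"

definition circuit_mat :: "nat \<Rightarrow> circuit \<Rightarrow> complex mat" where
  "circuit_mat L C = foldr (\<lambda>(j, U) M. gate_at L j U * M) C (1\<^sub>m (2 ^ L))"

definition exchange :: "(nat \<times> 'g) list \<Rightarrow> (nat \<times> 'g) list \<Rightarrow> bool" where
  "exchange C C' \<longleftrightarrow> (\<exists>C1 C2 j g j' g'.
     {j, j + 1} \<inter> {j', j' + 1} = {} \<and>
     C = C1 @ [(j, g), (j', g')] @ C2 \<and> C' = C1 @ [(j', g'), (j, g)] @ C2)"

definition same_circuit :: "(nat \<times> 'g) list \<Rightarrow> (nat \<times> 'g) list \<Rightarrow> bool" (infix "\<approx>" 50) where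
  "C \<approx> C' \<longleftrightarrow> exchange\<^sup>*\<^sup>* C C'"


section \<open>Right standard form\<close>

definition rsf_label :: "nat \<Rightarrow> nat \<Rightarrow> (nat \<Rightarrow> nat) \<Rightarrow> (nat \<Rightarrow> nat) \<Rightarrow> bool" where
  "rsf_label L n k l \<longleftrightarrow> 2 * n \<le> L \<and> (1 \<le> n \<longrightarrow> 1 \<le> k 1)
     \<and> (\<forall>i \<in> {1..<n}. k i + 2 \<le> k (i + 1))
     \<and> (\<forall>i \<in> {1..n}. 1 \<le> l i \<and> k i + l i \<le> L)"

definition diagonal :: "nat \<Rightarrow> nat \<Rightarrow> (nat \<Rightarrow> complex mat) \<Rightarrow> circuit" where
  "diagonal k l U = map (\<lambda>j. (k + j - 1, U j)) (rev [1..<l + 1])"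

definition rsf_matchgate_circuit :: "nat \<Rightarrow> circuit \<Rightarrow> bool" where
  "rsf_matchgate_circuit L C \<longleftrightarrow> (\<exists>n k l U. rsf_label L n k l
     \<and> (\<forall>i \<in> {1..n}. \<forall>j \<in> {1..l i}. matchgate (U i j))
     \<and> C \<approx> concat (map (\<lambda>i. diagonal (k i) (l i) (U i)) [1..<n + 1]))"


section \<open>The absorption algorithm\<close>

text \<open>
  \<open>yang_baxter U U' U'' V V' V''\<close> relates \<open>U\<^sub>1\<^sub>2 U'\<^sub>2\<^sub>3 U''\<^sub>1\<^sub>2\<close> to \<open>V\<^sub>2\<^sub>3 V'\<^sub>1\<^sub>2 V''\<^sub>2\<^sub>3\<close>, and
  \<open>left_right U U' V V'\<close> relates \<open>U\<^sub>1\<^sub>2 U'\<^sub>2\<^sub>3 |000\<rangle>\<close> to \<open>V\<^sub>2\<^sub>3 V'\<^sub>1\<^sub>2 |000\<rangle>\<close>, as operators and states of the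
  three qubits involved.
\<close>

definition yang_baxter ::
  "complex mat \<Rightarrow> complex mat \<Rightarrow> complex mat \<Rightarrow> complex mat \<Rightarrow> complex mat \<Rightarrow> complex mat \<Rightarrow> bool" where
  "yang_baxter U U' U'' V V' V'' \<longleftrightarrow> matchgate V \<and> matchgate V' \<and> matchgate V'' \<and>
     circuit_mat 3 [(1, U), (2, U'), (1, U'')] = circuit_mat 3 [(2, V), (1, V'), (2, V'')]"

definition left_right :: "complex mat \<Rightarrow> complex mat \<Rightarrow> complex mat \<Rightarrow> complex mat \<Rightarrow> bool" where
  "left_right U U' V V' \<longleftrightarrow> matchgate V \<and> matchgate V' \<and>
     circuit_mat 3 [(1, U), (2, U')] *\<^sub>v ket0 3 = circuit_mat 3 [(2, V), (1, V')] *\<^sub>v ket0 3"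

datatype marked_gate = Tracked (unmark: "complex mat") | Plain (unmark: "complex mat")

type_synonym marked_circuit = "(nat \<times> marked_gate) list"

definition mergeable :: "marked_circuit \<Rightarrow> bool" where
  "mergeable C \<longleftrightarrow> (\<exists>C1 C2 j A U.
     C \<approx> C1 @ [(j, Tracked A), (j, Plain U)] @ C2 \<or>
     C \<approx> C1 @ [(j, Plain U), (j, Tracked A)] @ C2)"

text \<open>
  \<open>untouched j C\<close>: no gate of \<open>C\<close> acts on any of the qubits \<open>j, j + 1, j + 2\<close>. With
  \<open>C \<approx> C1 @ [X, Y] @ C2\<close> and \<open>untouched j C2\<close>, the gates \<open>X, Y\<close> on these three qubits act directly
  on \<open>|000\<rangle>\<close>.
\<close>

definition untouched :: "nat \<Rightarrow> (nat \<times> 'g) list \<Rightarrow> bool" where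
  "untouched j C \<longleftrightarrow> (\<forall>(i, g) \<in> set C. {i, i + 1} \<inter> {j, j + 1, j + 2} = {})"

text \<open>
  In \<open>seq1\<close>--\<open>seq4\<close>, the pattern of the respective step occurs with \<open>j\<close> in place of \<open>i - 1\<close>.
\<close>

definition seq1 where
  "seq1 C C1 j A U U' C2 \<longleftrightarrow> C \<approx> C1 @ [(j, Tracked A), (j + 1, Plain U), (j, Plain U')] @ C2"

definition seq2 where
  "seq2 C C1 j A U C2 \<longleftrightarrow> C \<approx> C1 @ [(j, Tracked A), (j + 1, Plain U)] @ C2 \<and> untouched j C2"

definition seq3 where
  "seq3 C C1 j U A C2 \<longleftrightarrow> C \<approx> C1 @ [(j, Plain U), (j + 1, Tracked A)] @ C2 \<and> untouched j C2"

definition seq4 where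
  "seq4 C C1 j U U' A C2 \<longleftrightarrow> C \<approx> C1 @ [(j, Plain U), (j + 1, Plain U'), (j, Tracked A)] @ C2"

datatype stage = Step1 | Step2 | Step3 | Step4 | Terminated

text \<open>
  One transition of the algorithm. It is a relation because neither the matchgates produced by a
  move nor the representative of the circuit is unique.
\<close>

inductive absorption_step :: "stage \<times> marked_circuit \<Rightarrow> stage \<times> marked_circuit \<Rightarrow> bool"
  (infix "\<leadsto>" 50) where
  merge_below: "s \<noteq> Terminated \<Longrightarrow> C \<approx> C1 @ [(j, Tracked A), (j, Plain U)] @ C2 \<Longrightarrow>
     (s, C) \<leadsto> (Terminated, C1 @ [(j, Tracked (A * U))] @ C2)"
| merge_above: "s \<noteq> Terminated \<Longrightarrow> C \<approx> C1 @ [(j, Plain U), (j, Tracked A)] @ C2 \<Longrightarrow>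
     (s, C) \<leadsto> (Terminated, C1 @ [(j, Tracked (U * A))] @ C2)"
| step1: "\<not> mergeable C \<Longrightarrow> seq1 C C1 j A U U' C2 \<Longrightarrow> yang_baxter A U U' V V' A' \<Longrightarrow>
     (Step1, C) \<leadsto> (Step1, C1 @ [(j + 1, Plain V), (j, Plain V'), (j + 1, Tracked A')] @ C2)"
| step1_end: "\<not> mergeable C \<Longrightarrow> \<nexists>C1 j A U U' C2. seq1 C C1 j A U U' C2 \<Longrightarrow>
     (Step1, C) \<leadsto> (Step2, C)"
| step2: "\<not> mergeable C \<Longrightarrow> seq2 C C1 j A U C2 \<Longrightarrow> left_right A U V A' \<Longrightarrow>
     (Step2, C) \<leadsto> (Step3, C1 @ [(j + 1, Plain V), (j, Tracked A')] @ C2)"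
| step2_skip: "\<not> mergeable C \<Longrightarrow> \<nexists>C1 j A U C2. seq2 C C1 j A U C2 \<Longrightarrow>
     (Step2, C) \<leadsto> (Step3, C)"
| step3: "\<not> mergeable C \<Longrightarrow> seq3 C C1 j U A C2 \<Longrightarrow> left_right U A A' V \<Longrightarrow>
     (Step3, C) \<leadsto> (Step4, C1 @ [(j + 1, Tracked A'), (j, Plain V)] @ C2)"
| step3_skip: "\<not> mergeable C \<Longrightarrow> \<nexists>C1 j U A C2. seq3 C C1 j U A C2 \<Longrightarrow>
     (Step3, C) \<leadsto> (Step4, C)"
| step4: "\<not> mergeable C \<Longrightarrow> seq4 C C1 j U U' A C2 \<Longrightarrow> yang_baxter U U' A A' V V' \<Longrightarrow>
     (Step4, C) \<leadsto> (Step4, C1 @ [(j + 1, Tracked A'), (j, Plain V), (j + 1, Plain V')] @ C2)"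
| step4_end: "\<not> mergeable C \<Longrightarrow> \<nexists>C1 j U U' A C2. seq4 C C1 j U U' A C2 \<Longrightarrow>
     (Step4, C) \<leadsto> (Terminated, C)"

definition absorption_start :: "nat \<Rightarrow> complex mat \<Rightarrow> circuit \<Rightarrow> stage \<times> marked_circuit" where
  "absorption_start q A C = (Step1, (q, Tracked A) # map (map_prod id Plain) C)"

definition absorption_output :: "nat \<Rightarrow> complex mat \<Rightarrow> circuit \<Rightarrow> circuit \<Rightarrow> bool" where
  "absorption_output q A C C' \<longleftrightarrow> (\<exists>D.
     absorption_step\<^sup>*\<^sup>* (absorption_start q A C) (Terminated, D) \<and> C' = map (map_prod id unmark) D)"

text \<open>All runs are finite, and a run can only come to a halt by terminating regularly.\<close>

definition absorption_terminates :: "nat \<Rightarrow> complex mat \<Rightarrow> circuit \<Rightarrow> bool" where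
  "absorption_terminates q A C \<longleftrightarrow>
     (\<nexists>f. f 0 = absorption_start q A C \<and> (\<forall>n. f n \<leadsto> f (Suc n))) \<and>
     (\<forall>s D. absorption_step\<^sup>*\<^sup>* (absorption_start q A C) (s, D) \<and> (\<nexists>c. (s, D) \<leadsto> c)
        \<longrightarrow> s = Terminated)"

end

theory Submission
  imports Defs
begin

text \<open>
  Every step of the algorithm preserves the prepared state, because the moves relate operators, or
  states, of three qubits which commute with all gates on other qubits. So three points remain: the
  moves exist, every run is finite, and its result is in right standard form.

  Existence. A three-qubit matchgate circuit is determined by its block \<open>M\<close> on the even states and a
  phase \<open>d\<close> with \<open>d\<^sup>2 = det M\<close>. A Yang--Baxter move is a cosine-sine decomposition of the unitary
  \<open>4 \<times> 4\<close> matrix \<open>M\<close>, with phases adjusted so that the three gates have the determinants \<open>1, d, 1\<close>.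
  A left-right move only concerns the first column of \<open>M\<close>.

  Combinatorics. Circuits up to exchange of disjoint gates form a trace monoid on the positions of
  the gates, where an element is determined by its projections onto pairs of adjacent positions. In
  Step 1 the tracked gate at \<open>q\<close> passes the diagonals from left to right, moving to \<open>q + 1\<close> whenever it
  crosses one. It stops on the top of a diagonal, merges with it, or ends below the base of all
  remaining diagonals, where it may extend the first of them downwards in Step 2. If its base is then
  too close to the base \<open>b\<close> of the previous diagonal, Step 3 applies and the tracked gate climbs
  between the two diagonals in Step 4, leaving behind two diagonals with bases \<open>b\<close> and \<open>b + 2\<close>.
\<close>

section \<open>Circuits up to exchange of disjoint gates\<close>

text \<open>The algorithm is nondeterministic: any representative of the circuit and any output of a
  move may be chosen. Two facts make all runs alike. Which moves apply, and where they lead, depends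
  only on the positions of the gates and on which gate is tracked, so runs can be followed on words
  of flagged positions with the matrices forgotten. And since exactly one letter is flagged, every
  projection containing it splits there in a unique way; this pins down each occurrence of a
  pattern, and the absence of a pattern can be read off from a single neighbour in a projection. The
  tracked gate never moves down, and each move of Steps 1 and 4 raises it by one, which bounds the
  runs. On the analytic side, the outer factors of the cosine-sine decomposition can be taken in
  SU(2). The determinants of the two middle blocks then multiply to \<open>d^2\<close>, so a single
  phase, compensated in an outer factor, makes both equal to \<open>d\<close>.\<close>

definition proj :: "nat \<Rightarrow> (nat \<times> 'g) list \<Rightarrow> (nat \<times> 'g) list" where
  "proj j = filter (\<lambda>x. fst x = j \<or> fst x = Suc j)"

lemma proj_simps [simp]:
  "proj j [] = []"
  "proj j (x # xs) = (if fst x = j \<or> fst x = Suc j then x # proj j xs else proj j xs)"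
  "proj j (xs @ ys) = proj j xs @ proj j ys"
  by (auto simp: proj_def)

lemma disjoint_pairs_iff:
  "{p, p + 1} \<inter> {p', p' + 1} = {} \<longleftrightarrow> p \<noteq> p' \<and> p \<noteq> Suc p' \<and> p' \<noteq> Suc (p::nat)"
  by auto

lemma exchangeI:
  "fst x \<noteq> fst y \<Longrightarrow> fst x \<noteq> Suc (fst y) \<Longrightarrow> fst y \<noteq> Suc (fst x) \<Longrightarrow>
   exchange (C1 @ x # y # C2) (C1 @ y # x # C2)"
  unfolding exchange_def disjoint_pairs_iff
  by (rule exI[of _ C1], rule exI[of _ C2], cases x; cases y) auto

lemma exchangeE:
  assumes "exchange C C'"
  obtains C1 C2 x y where "fst x \<noteq> fst y" "fst x \<noteq> Suc (fst y)" "fst y \<noteq> Suc (fst x)"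
    "C = C1 @ x # y # C2" "C' = C1 @ y # x # C2"
  using assms unfolding exchange_def disjoint_pairs_iff by fastforce

lemma exchange_sym: "exchange C C' \<Longrightarrow> exchange C' C"
  by (elim exchangeE) (metis exchangeI)

lemma same_circuit_refl [simp, intro!]: "C \<approx> C"
  by (simp add: same_circuit_def)

lemma same_circuit_sym: "C \<approx> C' \<Longrightarrow> C' \<approx> C"
  unfolding same_circuit_def
  by (metis exchange_sym symp_rtranclp sympD sympI)

lemma same_circuit_trans [trans]: "C \<approx> C' \<Longrightarrow> C' \<approx> C'' \<Longrightarrow> C \<approx> C''"
  unfolding same_circuit_def by (rule rtranclp_trans)

lemma exchange_append: "exchange C C' \<Longrightarrow> exchange (A @ C @ B) (A @ C' @ B)"
  by (elim exchangeE) (metis append.assoc append_Cons exchangeI)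

lemma same_circuit_append: "C \<approx> C' \<Longrightarrow> A @ C @ B \<approx> A @ C' @ B"
  unfolding same_circuit_def
proof (induction rule: rtranclp_induct)
  case (step y z)
  then show ?case by (meson exchange_append rtranclp.rtrancl_into_rtrancl)
qed simp

lemma same_circuit_Cons: "C \<approx> C' \<Longrightarrow> x # C \<approx> x # C'"
  using same_circuit_append[of C C' "[x]" "[]"] by simp

lemma same_circuit_mset: "C \<approx> C' \<Longrightarrow> mset C = mset C'"
  unfolding same_circuit_def
proof (induction rule: rtranclp_induct)
  case (step y z)
  then show ?case by (auto elim!: exchangeE)
qed simp

lemma same_circuit_set: "C \<approx> C' \<Longrightarrow> set C = set C'"
  by (metis same_circuit_mset set_mset_mset)

lemma same_circuit_proj: "C \<approx> C' \<Longrightarrow> proj j C = proj j C'"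
  unfolding same_circuit_def
proof (induction rule: rtranclp_induct)
  case (step y z)
  then show ?case by (auto elim!: exchangeE)
qed simp

lemma same_circuit_move_front:
  "(\<And>y. y \<in> set B \<Longrightarrow> fst x \<noteq> fst y \<and> fst x \<noteq> Suc (fst y) \<and> fst y \<noteq> Suc (fst x)) \<Longrightarrow>
   B @ x # E \<approx> x # B @ E"
proof (induction B)
  case (Cons y B)
  have "B @ x # E \<approx> x # B @ E"
    using Cons by simp
  then have "(y # B) @ x # E \<approx> y # x # B @ E"
    using same_circuit_Cons by fastforce
  also have "y # x # B @ E \<approx> x # y # B @ E"
    unfolding same_circuit_def using Cons.prems[of y] exchangeI[of y x "[]"] by auto
  finally show ?case by simp
qed simp

lemma same_circuit_swap:
  "(\<And>x y. x \<in> set X \<Longrightarrow> y \<in> set Y \<Longrightarrow> fst x \<noteq> fst y \<and> fst x \<noteq> Suc (fst y) \<and> fst y \<noteq> Suc (fst x)) \<Longrightarrow>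
   A @ X @ Y @ B \<approx> A @ Y @ X @ B"
proof (induction Y arbitrary: A)
  case (Cons y Y)
  have "X @ y # Y @ B \<approx> y # X @ Y @ B"
  proof (rule same_circuit_move_front)
    fix x assume "x \<in> set X"
    then show "fst y \<noteq> fst x \<and> fst y \<noteq> Suc (fst x) \<and> fst x \<noteq> Suc (fst y)"
      using Cons.prems[of x y] by simp
  qed
  from same_circuit_append[OF this, of A "[]"]
  have "A @ X @ (y # Y) @ B \<approx> (A @ [y]) @ X @ Y @ B" by simp
  also have "\<dots> \<approx> (A @ [y]) @ Y @ X @ B"
    by (rule Cons.IH) (rule Cons.prems, auto)
  finally show ?case by simp
qed simp

lemma first_position_split:
  "\<exists>x\<in>set C. fst x = p \<Longrightarrow> \<exists>B g E. C = B @ (p, g) # E \<and> (\<forall>y\<in>set B. fst y \<noteq> p)"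
  using split_list_first_prop[of C "\<lambda>x. fst x = p"] by force

text \<open>Two gates fail to commute exactly when some projection keeps both. The head of
  \<open>C\<close> leads every projection that contains it, so in \<open>C'\<close> only gates
  commuting with it can stand before the first gate at its position; it is moved to the front and
  cancelled.\<close>

lemma same_circuitI_proj:
  "(\<And>j. proj j C = proj j C') \<Longrightarrow> C \<approx> C'"
proof (induction C arbitrary: C')
  case Nil
  have "C' = []"
  proof (rule ccontr)
    assume "C' \<noteq> []"
    then obtain x X where "C' = x # X" by (cases C') auto
    with Nil[of "fst x"] show False by simp
  qed
  then show ?case by simp
next
  case (Cons x C)
  obtain p g where x: "x = (p, g)" by (cases x)
  have hd_p: "proj p C' = (p, g) # proj p C" using Cons.prems[of p] x by simp
  then have "(p, g) \<in> set (proj p C')" by simp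
  then have "(p, g) \<in> set C'" by (simp add: proj_def)
  then obtain B g' E where C': "C' = B @ (p, g') # E" and B: "\<forall>y\<in>set B. fst y \<noteq> p"
    using first_position_split[of C' p] by force
  \<comment> \<open>A gate of \<open>B\<close> surviving here would have to be the head itself, but
    \<open>B\<close> has no gate at position \<open>p\<close>. For gates at \<open>p - 1\<close> the
    projection onto \<open>p - 1, p\<close> gives the same contradiction in
    \<open>B3\<close>.\<close>
  have B1: "proj p B = []"
  proof (cases "proj p B")
    case (Cons y Y)
    then have "y = (p, g)" "y \<in> set (proj p B)" using hd_p C' by auto
    then show ?thesis using B by (auto simp: proj_def)
  qed
  then have g': "g' = g" using hd_p C' by simp
  have B2: "fst y \<noteq> Suc p" if "y \<in> set B" for y
    using B1 that unfolding proj_def by (auto simp: filter_empty_conv)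
  have B3: "Suc (fst y) \<noteq> p" if y: "y \<in> set B" for y
  proof
    assume p: "Suc (fst y) = p"
    have eq: "proj (fst y) C' = (p, g) # proj (fst y) C"
      using Cons.prems[of "fst y"] x p by simp
    have "y \<in> set (proj (fst y) B)" using y by (simp add: proj_def)
    then obtain z Z where zZ: "proj (fst y) B = z # Z" by (cases "proj (fst y) B") auto
    then have "z = (p, g)" using eq C' by simp
    moreover have "z \<in> set B" using zZ by (metis filter_is_subset list.set_intros(1) proj_def subsetD)
    ultimately show False using B by auto
  qed
  have front: "C' \<approx> x # B @ E"
    unfolding C' g' x by (rule same_circuit_move_front) (use B B2 B3 in force)
  have "proj j C = proj j (B @ E)" for j
    using Cons.prems[of j] same_circuit_proj[OF front, of j]
    by (auto split: if_splits)
  then have "C \<approx> B @ E" by (rule Cons.IH)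
  then have "x # C \<approx> x # B @ E" by (rule same_circuit_Cons)
  then show ?case
    by (rule same_circuit_trans) (rule same_circuit_sym[OF front])
qed

lemma same_circuit_map:
  assumes "C \<approx> C'" "\<And>x. fst (f x) = fst x"
  shows "map f C \<approx> map f C'"
proof (rule same_circuitI_proj)
  fix j
  have "proj j (map f D) = map f (proj j D)" for D
    by (induction D) (auto simp: assms(2))
  then show "proj j (map f C) = proj j (map f C')"
    using same_circuit_proj[OF assms(1)] by simp
qed

text \<open>Exchanges look only at positions, which \<open>f\<close> keeps, so a reordering of the
  image can be replayed on the preimage. This leads back from words to circuits.\<close>

lemma same_circuit_map_lift:
  assumes "map f C \<approx> W" "\<And>x. fst (f x) = fst x"
  shows "\<exists>C'. C \<approx> C' \<and> map f C' = W"
  using assms(1) unfolding same_circuit_def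
proof (induction rule: rtranclp_induct)
  case base
  then show ?case by auto
next
  case (step y z)
  then obtain C' where C': "exchange\<^sup>*\<^sup>* C C'" "map f C' = y" by auto
  from \<open>exchange y z\<close> obtain C1 C2 a b where ab: "fst a \<noteq> fst b" "fst a \<noteq> Suc (fst b)" "fst b \<noteq> Suc (fst a)"
    "y = C1 @ a # b # C2" "z = C1 @ b # a # C2"
    by (rule exchangeE)
  from C'(2) ab(4) obtain D1 a' b' D2 where D: "C' = D1 @ a' # b' # D2"
    "map f D1 = C1" "f a' = a" "f b' = b" "map f D2 = C2"
    by (auto simp: map_eq_append_conv map_eq_Cons_conv)
  have "exchange C' (D1 @ b' # a' # D2)"
    unfolding D(1) by (rule exchangeI) (use ab D assms(2) in metis)+
  moreover have "map f (D1 @ b' # a' # D2) = z" using D ab by simp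
  ultimately show ?case using C'(1) rtranclp.rtrancl_into_rtrancl[of exchange C C'] by blast
qed

text \<open>Letters satisfying \<open>P\<close> serve as markers: with equally many of them in
  front, \<open>m\<close> and \<open>m'\<close> are the same marker of the common word.\<close>

lemma append_eq_splitD:
  assumes "xs @ m # ys = xs' @ m' # ys'" "P m" "P m'"
    "length (filter P xs) = length (filter P xs')"
  shows "xs = xs' \<and> m = m' \<and> ys = ys'"
  using assms
proof (induction xs arbitrary: xs')
  case Nil
  then show ?case by (cases xs') auto
next
  case (Cons x xs)
  show ?case
  proof (cases xs')
    case Nil
    then show ?thesis using Cons.prems by auto
  next
    case (Cons x' xs'')
    then show ?thesis using Cons.prems Cons.IH[of xs''] by (auto split: if_splits)
  qed
qed

section \<open>Shapes of circuits with a tracked gate\<close>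

type_synonym shape = "(nat \<times> bool) list"

abbreviation tr :: "nat \<Rightarrow> nat \<times> bool" where "tr q \<equiv> (q, True)"
abbreviation pl :: "nat \<Rightarrow> nat \<times> bool" where "pl q \<equiv> (q, False)"

definition untracked :: "shape \<Rightarrow> bool" where
  "untracked W \<longleftrightarrow> (\<forall>x\<in>set W. \<not> snd x)"

lemma untracked_simps [simp]:
  "untracked []" "untracked (x # W) \<longleftrightarrow> \<not> snd x \<and> untracked W"
  "untracked (V @ W) \<longleftrightarrow> untracked V \<and> untracked W"
  by (auto simp: untracked_def)

lemma untracked_filter: "untracked W \<longleftrightarrow> filter snd W = []"
  by (auto simp: untracked_def filter_empty_conv)

lemma untracked_proj: "untracked W \<Longrightarrow> untracked (proj j W)"
  by (auto simp: untracked_def proj_def)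

text \<open>Comparing multisets shows that the right-hand word has a single flagged letter as well,
  and every projection that keeps it is cut there into the same two halves.\<close>

lemma tracked_unique:
  assumes "X @ tr q # Z \<approx> X' @ tr q' # Z'" "untracked X" "untracked Z"
  shows "q' = q" "untracked X'" "untracked Z'"
    "\<And>i. q = i \<or> q = Suc i \<Longrightarrow> proj i X' = proj i X"
    "\<And>i. q = i \<or> q = Suc i \<Longrightarrow> proj i Z' = proj i Z"
proof -
  have "mset (filter snd (X @ tr q # Z)) = mset (filter snd (X' @ tr q' # Z'))"
    using same_circuit_mset[OF assms(1)] by (metis mset_filter)
  then have eq: "{#tr q#} = mset (filter snd X') + {#tr q'#} + mset (filter snd Z')"
    using assms(2,3) unfolding untracked_filter by (simp add: untracked_filter del: mset_filter)
  then have "q' = q \<and> filter snd X' = [] \<and> filter snd Z' = []"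
    by (auto simp: single_is_union simp del: mset_filter)
  then show q: "q' = q" and u: "untracked X'" "untracked Z'"
    unfolding untracked_filter by auto
  fix i assume i: "q = i \<or> q = Suc i"
  have "proj i X @ tr q # proj i Z = proj i X' @ tr q # proj i Z'"
    using same_circuit_proj[OF assms(1), of i] i q by auto
  moreover have "filter snd (proj i V) = []" if "untracked V" for V :: shape
    using that untracked_filter untracked_proj by blast
  ultimately have "proj i X = proj i X' \<and> proj i Z = proj i Z'"
    using append_eq_splitD[of "proj i X" "tr q" "proj i Z" "proj i X'" "tr q" "proj i Z'" snd]
      assms(2,3) u by simp
  then show "proj i X' = proj i X" "proj i Z' = proj i Z" by auto
qed

text \<open>
  The tracked gate locates an occurrence of \<open>M\<close> on the positions \<open>j, j + 1\<close>, so the result of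
  replacing \<open>M\<close> does not depend on the representative of the circuit.
\<close>

lemma replace_factor:
  assumes eq: "W1 @ M @ W2 \<approx> V1 @ M @ V2"
    and x: "tr q \<in> set M" and V: "length (filter snd (V1 @ M @ V2)) = 1"
    and M: "\<And>y. y \<in> set M \<Longrightarrow> fst y = j \<or> fst y = Suc j"
    and M': "\<And>y. y \<in> set M' \<Longrightarrow> fst y \<in> fst ` set M"
  shows "W1 @ M' @ W2 \<approx> V1 @ M' @ V2"
proof (rule same_circuitI_proj)
  obtain M1 M2 where MM: "M = M1 @ tr q # M2" using x by (meson split_list)
  have unt: "untracked (V1 @ M1)" "untracked (M2 @ V2)"
    using V unfolding untracked_filter MM by auto
  have eq': "(V1 @ M1) @ tr q # (M2 @ V2) \<approx> (W1 @ M1) @ tr q # (M2 @ W2)"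
    using same_circuit_sym[OF eq] MM by simp
  have q: "q = j \<or> q = Suc j" using M x by force
  have j: "proj j W1 = proj j V1" "proj j W2 = proj j V2"
    using tracked_unique(4,5)[OF eq' unt q] by auto
  fix i
  show "proj i (W1 @ M' @ W2) = proj i (V1 @ M' @ V2)"
  proof (cases "proj i M")
    case Nil
    have "proj i M' = []"
      using Nil M' unfolding proj_def by (auto simp: filter_empty_conv) force+
    then show ?thesis using Nil same_circuit_proj[OF eq, of i] by simp
  next
    case (Cons y Y)
    \<comment> \<open>The first letter of \<open>M\<close> that survives in this projection is the
      marker. Its position is \<open>j\<close> or \<open>Suc j\<close>, so by the projections at
      \<open>j\<close> it occurs equally often in \<open>W1\<close> and \<open>V1\<close>.\<close>
    let ?P = "\<lambda>x. fst x = fst y"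
    have "y \<in> set (proj i M)" using Cons by simp
    then have y: "y \<in> set M" "fst y = i \<or> fst y = Suc i" by (auto simp: proj_def)
    have fy: "fst y = j \<or> fst y = Suc j" using M y by blast
    have fi: "filter ?P (proj i Z) = filter ?P Z" for Z :: shape
      unfolding proj_def filter_filter by (rule filter_cong) (use y in auto)
    have fj: "filter ?P (proj j Z) = filter ?P Z" for Z :: shape
      unfolding proj_def filter_filter by (rule filter_cong) (use fy in auto)
    have "proj i W1 = proj i V1 \<and> y = y \<and> Y @ proj i W2 = Y @ proj i V2"
    proof (rule append_eq_splitD[where P = ?P])
      show "proj i W1 @ y # Y @ proj i W2 = proj i V1 @ y # Y @ proj i V2"
        using same_circuit_proj[OF eq, of i] Cons by simp
      show "length (filter ?P (proj i W1)) = length (filter ?P (proj i V1))"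
        using j fi fj by metis
    qed auto
    then show ?thesis by simp
  qed
qed

section \<open>Diagonals and right standard form as words\<close>

definition dg :: "nat \<Rightarrow> nat \<Rightarrow> shape" where
  "dg b u = map pl (rev [b..<u])"

definition dgs :: "(nat \<times> nat) list \<Rightarrow> shape" where
  "dgs xs = concat (map (\<lambda>(b, u). dg b u) xs)"

lemma dgs_simps [simp]:
  "dgs [] = []" "dgs (x # xs) = dg (fst x) (snd x) @ dgs xs" "dgs (xs @ ys) = dgs xs @ dgs ys"
  by (auto simp: dgs_def split: prod.splits)

lemma dg_empty [simp]: "u \<le> b \<Longrightarrow> dg b u = []"
  by (simp add: dg_def)

lemma dg_split: "b \<le> c \<Longrightarrow> c \<le> u \<Longrightarrow> dg b u = dg c u @ dg b c"
  unfolding dg_def by (metis le_iff_add map_append rev_append upt_add_eq_append)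

lemma dg_Suc: "b \<le> u \<Longrightarrow> dg b (Suc u) = pl u # dg b u"
  by (simp add: dg_def)

lemma dg_snoc: "b < u \<Longrightarrow> dg b u = dg (Suc b) u @ [pl b]"
  by (simp add: dg_def upt_conv_Cons)

lemma set_dg [simp]: "x \<in> set (dg b u) \<longleftrightarrow> \<not> snd x \<and> b \<le> fst x \<and> fst x < u"
  by (cases x) (auto simp: dg_def)

lemma untracked_dg [simp]: "untracked (dg b u)"
  by (auto simp: untracked_def)

lemma untracked_dgs [simp]: "untracked (dgs xs)"
  by (induction xs) auto

lemma set_dgsD: "x \<in> set (dgs xs) \<Longrightarrow> \<exists>(b, u)\<in>set xs. b \<le> fst x \<and> fst x < u"
  by (induction xs) auto

lemma proj_dg: "proj j (dg b u) =
   (if b \<le> Suc j \<and> Suc j < u then [pl (Suc j)] else []) @ (if b \<le> j \<and> j < u then [pl j] else [])"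
proof (induction u)
  case (Suc u)
  show ?case
  proof (cases "b \<le> u")
    case True
    then show ?thesis using Suc by (auto simp: dg_Suc)
  qed auto
qed simp

lemma proj_dgs_above: "(\<And>b u. (b, u) \<in> set xs \<Longrightarrow> Suc j < b) \<Longrightarrow> proj j (dgs xs) = []"
proof (induction xs)
  case (Cons x xs)
  then show ?case by (cases x) (force simp: proj_dg)
qed simp

text \<open>A diagonal with base at most \<open>j\<close> that meets \<open>Suc j\<close> goes on to
  \<open>j\<close>, which is written later, so position \<open>j\<close> always closes the
  projection.\<close>

lemma proj_dgs_last:
  "(\<And>b u. (b, u) \<in> set xs \<Longrightarrow> b \<le> j) \<Longrightarrow> proj j (dgs xs) = [] \<or> fst (last (proj j (dgs xs))) = j"
proof (induction xs rule: rev_induct)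
  case (snoc x xs)
  obtain b u where "x = (b, u)" by (cases x)
  moreover have "b \<le> j" using snoc.prems calculation by auto
  moreover have "proj j (dgs xs) = [] \<or> fst (last (proj j (dgs xs))) = j" using snoc by auto
  ultimately show ?case by (auto simp: proj_dg)
qed simp

definition gapped :: "(nat \<times> nat) list \<Rightarrow> bool" where
  "gapped xs \<longleftrightarrow> sorted_wrt (\<lambda>x y. fst x + 2 \<le> fst y) xs"

text \<open>A pair \<open>(b, u)\<close> stands for the label \<open>k = b\<close>,
  \<open>l = u - b\<close>: the top gate has position \<open>u - 1\<close> and reaches qubit
  \<open>u\<close>, whence \<open>u \<le> L\<close>.\<close>

definition rsf :: "nat \<Rightarrow> (nat \<times> nat) list \<Rightarrow> bool" where
  "rsf L xs \<longleftrightarrow> gapped xs \<and> (\<forall>(b, u)\<in>set xs. 1 \<le> b \<and> b < u \<and> u \<le> L)"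

definition untrack :: "shape \<Rightarrow> shape" where
  "untrack = map (\<lambda>(p, _). pl p)"

lemma untrack_simps [simp]:
  "untrack [] = []" "untrack (x # W) = pl (fst x) # untrack W" "untrack (V @ W) = untrack V @ untrack W"
  by (auto simp: untrack_def split: prod.splits)

lemma untrack_untracked: "untracked W \<Longrightarrow> untrack W = W"
  by (induction W) auto

lemma untrack_dg [simp]: "untrack (dg b u) = dg b u" "untrack (dgs xs) = dgs xs"
  by (auto intro: untrack_untracked)

definition rsf_shape :: "nat \<Rightarrow> shape \<Rightarrow> bool" where
  "rsf_shape L W \<longleftrightarrow> (\<exists>xs. rsf L xs \<and> untrack W \<approx> dgs xs)"

text \<open>Empty intervals contribute nothing to the word and are filtered out, so
  \<open>b < u\<close> is obtained without being assumed.\<close>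

lemma rsf_shapeI:
  assumes "gapped xs" "\<And>b u. (b, u) \<in> set xs \<Longrightarrow> 1 \<le> b \<and> u \<le> L"
    "W \<approx> V" "untrack V \<approx> dgs xs"
  shows "rsf_shape L W"
proof -
  let ?ys = "filter (\<lambda>(b, u). b < u) xs"
  have "dgs ?ys = dgs xs" by (induction xs) auto
  moreover have "rsf L ?ys"
    using assms(1,2) by (auto simp: rsf_def gapped_def sorted_wrt_filter)
  moreover have "untrack W \<approx> dgs xs"
    using same_circuit_trans[OF same_circuit_map[OF assms(3), of "\<lambda>(p, _). pl p"]] assms(4)
    unfolding untrack_def by (auto simp: split_beta)
  ultimately show ?thesis unfolding rsf_shape_def by metis
qed

section \<open>Steps of the algorithm on words\<close>

definition occurs :: "shape \<Rightarrow> shape \<Rightarrow> bool" where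
  "occurs M W \<longleftrightarrow> (\<exists>W1 W2. W \<approx> W1 @ M @ W2)"

definition occurs_first :: "nat \<Rightarrow> shape \<Rightarrow> shape \<Rightarrow> bool" where
  "occurs_first j M W \<longleftrightarrow> (\<exists>W1 W2. W \<approx> W1 @ M @ W2 \<and> untouched j W2)"

definition merges :: "shape \<Rightarrow> bool" where
  "merges W \<longleftrightarrow> (\<exists>j. occurs [tr j, pl j] W \<or> occurs [pl j, tr j] W)"

text \<open>The transition relation with the matrices erased. Whether suitable matchgates exist is a
  separate question, so these rules test position patterns only.\<close>

inductive shape_step :: "stage \<times> shape \<Rightarrow> stage \<times> shape \<Rightarrow> bool" where
  merge: "s \<noteq> Terminated \<Longrightarrow> M = [tr j, pl j] \<or> M = [pl j, tr j] \<Longrightarrow> W \<approx> W1 @ M @ W2 \<Longrightarrow>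
     shape_step (s, W) (Terminated, W1 @ [tr j] @ W2)"
| step1: "\<not> merges W \<Longrightarrow> W \<approx> W1 @ [tr j, pl (j + 1), pl j] @ W2 \<Longrightarrow>
     shape_step (Step1, W) (Step1, W1 @ [pl (j + 1), pl j, tr (j + 1)] @ W2)"
| step1_end: "\<not> merges W \<Longrightarrow> \<nexists>j. occurs [tr j, pl (j + 1), pl j] W \<Longrightarrow>
     shape_step (Step1, W) (Step2, W)"
| step2: "\<not> merges W \<Longrightarrow> W \<approx> W1 @ [tr j, pl (j + 1)] @ W2 \<Longrightarrow> untouched j W2 \<Longrightarrow>
     shape_step (Step2, W) (Step3, W1 @ [pl (j + 1), tr j] @ W2)"
| step2_skip: "\<not> merges W \<Longrightarrow> \<nexists>j. occurs_first j [tr j, pl (j + 1)] W \<Longrightarrow>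
     shape_step (Step2, W) (Step3, W)"
| step3: "\<not> merges W \<Longrightarrow> W \<approx> W1 @ [pl j, tr (j + 1)] @ W2 \<Longrightarrow> untouched j W2 \<Longrightarrow>
     shape_step (Step3, W) (Step4, W1 @ [tr (j + 1), pl j] @ W2)"
| step3_skip: "\<not> merges W \<Longrightarrow> \<nexists>j. occurs_first j [pl j, tr (j + 1)] W \<Longrightarrow>
     shape_step (Step3, W) (Step4, W)"
| step4: "\<not> merges W \<Longrightarrow> W \<approx> W1 @ [pl j, pl (j + 1), tr j] @ W2 \<Longrightarrow>
     shape_step (Step4, W) (Step4, W1 @ [tr (j + 1), pl j, pl (j + 1)] @ W2)"
| step4_end: "\<not> merges W \<Longrightarrow> \<nexists>j. occurs [pl j, pl (j + 1), tr j] W \<Longrightarrow>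
     shape_step (Step4, W) (Terminated, W)"

subsection \<open>Locating patterns around the tracked gate\<close>

text \<open>A partner at the same position would be the next letter in both projections containing
  it, so a different neighbour in one of them suffices. Writing the tracked position as
  \<open>Suc j\<close> makes the position below it available.\<close>

lemma no_merge_below:
  assumes "W \<approx> X @ tr (Suc j) # Z" "untracked X" "untracked Z"
    and "(proj j Z = [] \<or> fst (hd (proj j Z)) \<noteq> Suc j)
      \<or> (proj (Suc j) Z = [] \<or> fst (hd (proj (Suc j) Z)) \<noteq> Suc j)"
  shows "\<not> occurs [tr p, pl p] W"
proof
  assume "occurs [tr p, pl p] W"
  then obtain W1 W2 where "W \<approx> W1 @ [tr p, pl p] @ W2" by (auto simp: occurs_def)
  then have "X @ tr (Suc j) # Z \<approx> W1 @ tr p # (pl p # W2)"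
    using same_circuit_trans[OF same_circuit_sym[OF assms(1)]] by simp
  note u = tracked_unique[OF this assms(2,3)]
  have "proj j (pl p # W2) = proj j Z" "proj (Suc j) (pl p # W2) = proj (Suc j) Z"
    using u by blast+
  then show False using assms(4) u(1) by (auto dest: sym)
qed

lemma no_merge_above:
  assumes "W \<approx> X @ tr (Suc j) # Z" "untracked X" "untracked Z"
    and "(proj j X = [] \<or> fst (last (proj j X)) \<noteq> Suc j)
      \<or> (proj (Suc j) X = [] \<or> fst (last (proj (Suc j) X)) \<noteq> Suc j)"
  shows "\<not> occurs [pl p, tr p] W"
proof
  assume "occurs [pl p, tr p] W"
  then obtain W1 W2 where "W \<approx> W1 @ [pl p, tr p] @ W2" by (auto simp: occurs_def)
  then have "X @ tr (Suc j) # Z \<approx> (W1 @ [pl p]) @ tr p # W2"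
    using same_circuit_trans[OF same_circuit_sym[OF assms(1)]] by simp
  note u = tracked_unique[OF this assms(2,3)]
  have "proj j (W1 @ [pl p]) = proj j X" "proj (Suc j) (W1 @ [pl p]) = proj (Suc j) X"
    using u by blast+
  then show False using assms(4) u(1) by (auto dest: sym)
qed

text \<open>The projection onto \<open>p - 1, p\<close> deletes the letter at \<open>p + 1\<close>,
  so the pattern would make an untracked letter at \<open>p\<close> the immediate predecessor of the
  tracked one.\<close>

lemma no_seq4:
  assumes "W \<approx> X @ tr (Suc j) # Z" "untracked X" "untracked Z"
    and "proj j X = [] \<or> fst (last (proj j X)) \<noteq> Suc j"
  shows "\<not> occurs [pl p, pl (p + 1), tr p] W"
proof
  assume "occurs [pl p, pl (p + 1), tr p] W"
  then obtain W1 W2 where "W \<approx> W1 @ [pl p, pl (p + 1), tr p] @ W2" by (auto simp: occurs_def)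
  then have "X @ tr (Suc j) # Z \<approx> (W1 @ [pl p, pl (p + 1)]) @ tr p # W2"
    using same_circuit_trans[OF same_circuit_sym[OF assms(1)]] by simp
  note u = tracked_unique[OF this assms(2,3)]
  have "proj j (W1 @ [pl p, pl (p + 1)]) = proj j X"
    using u by blast
  then show False using assms(4) u(1) by (auto dest: sym)
qed

lemma no_seq1:
  assumes "W \<approx> X @ tr (Suc j) # Z" "untracked X" "untracked Z"
    and "proj j Z = [] \<or> fst (hd (proj j Z)) \<noteq> Suc j"
  shows "\<not> occurs [tr p, pl (p + 1), pl p] W"
proof
  assume "occurs [tr p, pl (p + 1), pl p] W"
  then obtain W1 W2 where "W \<approx> W1 @ [tr p, pl (p + 1), pl p] @ W2" by (auto simp: occurs_def)
  then have "X @ tr (Suc j) # Z \<approx> W1 @ tr p # (pl (p + 1) # pl p # W2)"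
    using same_circuit_trans[OF same_circuit_sym[OF assms(1)]] by simp
  note u = tracked_unique[OF this assms(2,3)]
  have "proj j (pl (p + 1) # pl p # W2) = proj j Z"
    using u by blast
  then show False using assms(4) u(1) by (auto dest: sym)
qed

lemma untouched_proj:
  assumes "untouched j W" "i = j \<or> i = Suc j \<or> Suc i = j \<or> i = Suc (Suc j)"
  shows "i = Suc (Suc j) \<or> proj i W = []" "\<And>x. x \<in> set W \<Longrightarrow> fst x \<noteq> i"
proof -
  show *: "fst x \<noteq> i" if "x \<in> set W" for x
    using that assms by (cases x) (auto simp: untouched_def)
  show "i = Suc (Suc j) \<or> proj i W = []"
    using assms by (auto simp: untouched_def proj_def filter_empty_conv)
qed

text \<open>For a tracked gate at \<open>q = Suc j\<close>, the pattern on the zero state leaves no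
  gate at \<open>q - 1\<close> or \<open>q\<close> to its right, but it does place one at
  \<open>q + 1\<close> there.\<close>

lemma no_seq2:
  assumes "W \<approx> X @ tr (Suc j) # Z" "untracked X" "untracked Z"
    and "proj j Z \<noteq> [] \<or> proj (Suc j) Z = []"
  shows "\<not> occurs_first p [tr p, pl (p + 1)] W"
proof
  assume "occurs_first p [tr p, pl (p + 1)] W"
  then obtain W1 W2 where W: "W \<approx> W1 @ [tr p, pl (p + 1)] @ W2" "untouched p W2"
    by (auto simp: occurs_first_def)
  then have "X @ tr (Suc j) # Z \<approx> W1 @ tr p # (pl (p + 1) # W2)"
    using same_circuit_trans[OF same_circuit_sym[OF assms(1)]] by simp
  note u = tracked_unique[OF this assms(2,3)]
  have *: "proj j (pl (p + 1) # W2) = proj j Z" "proj (Suc j) (pl (p + 1) # W2) = proj (Suc j) Z"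
    using u by blast+
  then show False using assms(4) u(1) untouched_proj(1)[OF W(2), of j] by (auto dest: sym)
qed

text \<open>The last alternative concerns a gate at \<open>j - 1\<close> to the right of the gates
  at \<open>j\<close>: it touches the first of the three qubits, so the pair does not act directly
  on the zero state.\<close>

lemma no_seq3:
  assumes "W \<approx> X @ tr (Suc j) # Z" "untracked X" "untracked Z"
    and "proj j Z \<noteq> [] \<or> j \<notin> fst ` set X \<or> (\<exists>i. j = Suc i \<and> fst (last (proj i X)) = i \<and> proj i Z = [])"
  shows "\<not> occurs_first p [pl p, tr (p + 1)] W"
proof
  assume "occurs_first p [pl p, tr (p + 1)] W"
  then obtain W1 W2 where W: "W \<approx> W1 @ [pl p, tr (p + 1)] @ W2" "untouched p W2"
    by (auto simp: occurs_first_def)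
  then have eq: "X @ tr (Suc j) # Z \<approx> (W1 @ [pl p]) @ tr (p + 1) # W2"
    using same_circuit_trans[OF same_circuit_sym[OF assms(1)]] by simp
  note u = tracked_unique[OF this assms(2,3)]
  have p: "p = j" using u(1) by simp
  have *: "proj j (W1 @ [pl p]) = proj j X" "proj j W2 = proj j Z"
    using u by blast+
  have "pl j \<in> set (proj j X)" using *(1)[symmetric] p by simp
  then have "pl j \<in> set X" by (simp add: proj_def)
  then have 1: "j \<in> fst ` set X" by force
  have 2: "proj j Z = []" using *(2) untouched_proj(1)[OF W(2), of j] p by simp
  show False
  proof (cases j)
    case 0
    then show ?thesis using assms(4) 1 2 by auto
  next
    case (Suc i)
    have "proj i W2 = []" using untouched_proj(1)[OF W(2), of i] p Suc by simp
    moreover have "proj i (X @ tr (Suc j) # Z) = proj i ((W1 @ [pl p]) @ tr (p + 1) # W2)"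
      by (rule same_circuit_proj[OF eq])
    ultimately have "proj i X @ proj i Z = proj i W1 @ [pl j]" using p Suc by simp
    then show ?thesis using assms(4) 1 2 Suc by (metis append_Nil2 fst_conv last_snoc n_not_Suc_n nat.inject)
  qed
qed

section \<open>Invariants of the absorption algorithm\<close>

lemma rsf_append: "rsf L (xs @ ys) \<longleftrightarrow> rsf L xs \<and> rsf L ys \<and>
    (\<forall>(b, u)\<in>set xs. \<forall>(c, v)\<in>set ys. b + 2 \<le> c)"
  by (auto simp: rsf_def gapped_def sorted_wrt_append case_prod_beta)

lemma rsf_Cons: "rsf L ((b, u) # ys) \<longleftrightarrow> 1 \<le> b \<and> b < u \<and> u \<le> L \<and> rsf L ys \<and>
    (\<forall>(c, v)\<in>set ys. b + 2 \<le> c)"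
  by (auto simp: rsf_def gapped_def)

lemma rsf_Nil [simp]: "rsf L []"
  by (auto simp: rsf_def gapped_def)

lemma gapped_append: "gapped (xs @ ys) \<longleftrightarrow> gapped xs \<and> gapped ys \<and>
    (\<forall>(b, u)\<in>set xs. \<forall>(c, v)\<in>set ys. b + 2 \<le> c)"
  by (auto simp: gapped_def sorted_wrt_append case_prod_beta)

lemma gapped_Cons: "gapped ((b, u) # ys) \<longleftrightarrow> gapped ys \<and> (\<forall>(c, v)\<in>set ys. b + 2 \<le> c)"
  by (auto simp: gapped_def)

lemma rsf_gapped: "rsf L xs \<Longrightarrow> gapped xs"
  by (simp add: rsf_def)

lemma rsfD: "rsf L xs \<Longrightarrow> (b, u) \<in> set xs \<Longrightarrow> 1 \<le> b \<and> b < u \<and> u \<le> L"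
  by (auto simp: rsf_def)

text \<open>The second condition excludes a single gate at \<open>q - 1\<close>, on which the
  tracked gate would have come to rest. In Step 3 it guarantees that a previous diagonal with base
  \<open>q - 1\<close> also has a gate at \<open>q\<close>.\<close>

definition below :: "nat \<Rightarrow> (nat \<times> nat) list \<Rightarrow> bool" where
  "below q xs \<longleftrightarrow> (\<forall>(b, u)\<in>set xs. b < q \<and> (Suc b = q \<longrightarrow> q < u))"

text \<open>\<open>xs\<close> are the diagonals passed so far, \<open>ys\<close> those still
  ahead.\<close>

definition descending :: "nat \<Rightarrow> shape \<Rightarrow> bool" where
  "descending L W \<longleftrightarrow> (\<exists>xs q ys. W \<approx> dgs xs @ tr q # dgs ys \<and>
     rsf L (xs @ ys) \<and> 1 \<le> q \<and> q < L \<and> below q xs)"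

definition free :: "nat \<Rightarrow> shape \<Rightarrow> bool" where
  "free L W \<longleftrightarrow> (\<exists>xs q ys. W \<approx> dgs xs @ tr q # dgs ys \<and>
     rsf L (xs @ ys) \<and> 1 \<le> q \<and> q < L \<and> below q xs \<and> (\<forall>(b, u)\<in>set ys. q < b))"

text \<open>The conditions speak of a projection because this is what the pattern lemmas test: among
  the gates at \<open>j\<close> and \<open>Suc j\<close>, the next one on the right, and the next
  one on the left if there is any, lies one position below the tracked gate.\<close>

definition on_top :: "nat \<Rightarrow> shape \<Rightarrow> bool" where
  "on_top L W \<longleftrightarrow> rsf_shape L W \<and> (\<exists>X j Z. W \<approx> X @ tr (Suc j) # Z \<and> untracked X \<and> untracked Z \<and>
     (proj j X = [] \<or> fst (last (proj j X)) = j) \<and> proj j Z \<noteq> [] \<and> fst (hd (proj j Z)) = j)"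

text \<open>Besides a gate on top of a diagonal this covers one that has become the base or an inner
  gate of a diagonal.\<close>

definition settled :: "nat \<Rightarrow> shape \<Rightarrow> bool" where
  "settled L W \<longleftrightarrow> rsf_shape L W \<and> (\<exists>X j Z. W \<approx> X @ tr (Suc j) # Z \<and> untracked X \<and> untracked Z \<and>
     (proj j X = [] \<or> fst (last (proj j X)) = j) \<and> (proj j Z = [] \<or> fst (hd (proj j Z)) = j))"

text \<open>The bound \<open>q + 3\<close> remembers that the diagonal had base \<open>q + 1\<close>
  before Step 2 extended it to \<open>q\<close>; for \<open>u = Suc q\<close> the tracked gate
  stands alone.\<close>

definition at_base :: "nat \<Rightarrow> shape \<Rightarrow> bool" where
  "at_base L W \<longleftrightarrow> (\<exists>xs q u ys. W \<approx> dgs xs @ dg (Suc q) u @ tr q # dgs ys \<and>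
     rsf L xs \<and> rsf L ys \<and> 1 \<le> q \<and> q < u \<and> u \<le> L \<and> below q xs \<and>
     (\<forall>(b, v)\<in>set ys. q + 2 \<le> b \<and> (Suc q < u \<longrightarrow> q + 3 \<le> b)))"

text \<open>
  Here the tracked gate climbs between two diagonals of heights \<open>u, u'\<close>, whose bases \<open>b, b + 1\<close>
  became too close and are pulled apart to \<open>b, b + 2\<close> below it. If the upper diagonal is trivial,
  the next diagonal may start as low as \<open>b + 3\<close>.
\<close>

definition ascending :: "nat \<Rightarrow> shape \<Rightarrow> bool" where
  "ascending L W \<longleftrightarrow> (\<exists>xs b p u u' ys.
     W \<approx> dgs xs @ dg p u @ dg (Suc p) u' @ tr p # dg b p @ dg (b + 2) (Suc p) @ dgs ys \<and>
     rsf L xs \<and> rsf L ys \<and> 1 \<le> b \<and> b < p \<and> p < u \<and> p < u' \<and> u \<le> L \<and> u' \<le> L \<and>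
     (\<forall>(c, v)\<in>set xs. c + 2 \<le> b) \<and>
     (\<forall>(c, v)\<in>set ys. b + 3 \<le> c \<and> (b + 3 = c \<longrightarrow> p = Suc b \<and> u' = Suc p)))"

text \<open>In Steps 2 to 4 one alternative describes a gate that still has to be placed, the other
  a gate at rest, on which no remaining step acts.\<close>

fun invariant :: "nat \<Rightarrow> stage \<times> shape \<Rightarrow> bool" where
  "invariant L (Step1, W) = descending L W"
| "invariant L (Step2, W) = (free L W \<or> on_top L W)"
| "invariant L (Step3, W) = (at_base L W \<or> on_top L W)"
| "invariant L (Step4, W) = (ascending L W \<or> settled L W)"
| "invariant L (Terminated, W) = rsf_shape L W"

lemma on_top_settled: "on_top L W \<Longrightarrow> settled L W"
  unfolding on_top_def settled_def by blast

lemma not_merges: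
  assumes "W \<approx> X @ tr (Suc j) # Z" "untracked X" "untracked Z"
    "(proj j X = [] \<or> fst (last (proj j X)) \<noteq> Suc j)
      \<or> (proj (Suc j) X = [] \<or> fst (last (proj (Suc j) X)) \<noteq> Suc j)"
    "(proj j Z = [] \<or> fst (hd (proj j Z)) \<noteq> Suc j)
      \<or> (proj (Suc j) Z = [] \<or> fst (hd (proj (Suc j) Z)) \<noteq> Suc j)"
  shows "\<not> merges W"
  unfolding merges_def using no_merge_below[OF assms(1-3,5)] no_merge_above[OF assms(1-4)] by blast

lemma settled_not_merges: "settled L W \<Longrightarrow> \<not> merges W"
proof -
  assume "settled L W"
  then obtain X j Z where *: "W \<approx> X @ tr (Suc j) # Z" "untracked X" "untracked Z"
     "proj j X = [] \<or> fst (last (proj j X)) = j" "proj j Z = [] \<or> fst (hd (proj j Z)) = j"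
    unfolding settled_def by blast
  show ?thesis by (rule not_merges[OF *(1-3)]) (use *(4,5) in auto)
qed

lemma settled_no_seq4: "settled L W \<Longrightarrow> \<not> occurs [pl p, pl (p + 1), tr p] W"
proof -
  assume "settled L W"
  then obtain X j Z where *: "W \<approx> X @ tr (Suc j) # Z" "untracked X" "untracked Z"
     "proj j X = [] \<or> fst (last (proj j X)) = j" unfolding settled_def by blast
  show ?thesis by (rule no_seq4[OF *(1-3)]) (use *(4) in auto)
qed

lemma on_top_no_seqs:
  assumes "on_top L W"
  shows "\<not> occurs [tr p, pl (p + 1), pl p] W" "\<not> occurs_first p [tr p, pl (p + 1)] W"
    "\<not> occurs_first p [pl p, tr (p + 1)] W"
proof -
  obtain X j Z where *: "W \<approx> X @ tr (Suc j) # Z" "untracked X" "untracked Z"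
     "proj j Z \<noteq> []" "fst (hd (proj j Z)) = j" using assms unfolding on_top_def by blast
  show "\<not> occurs [tr p, pl (p + 1), pl p] W" by (rule no_seq1[OF *(1-3)]) (use * in auto)
  show "\<not> occurs_first p [tr p, pl (p + 1)] W" by (rule no_seq2[OF *(1-3)]) (use * in auto)
  show "\<not> occurs_first p [pl p, tr (p + 1)] W" by (rule no_seq3[OF *(1-3)]) (use * in auto)
qed

text \<open>A step may find its pattern in any representative. Both occurrences contain the unique
  tracked letter, \<open>d\<close> places above the parameter of the pattern, so the parameters
  agree and so do the results. The offset is 1 in Step 3 and 0 otherwise.\<close>

lemma replace_pattern:
  assumes "W \<approx> W1 @ M @ W2" "W \<approx> V1 @ N @ V2" "untracked V1" "untracked V2"
    "M = f p" "N = f q" "\<And>p. filter snd (f p) = [tr (p + d)]"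
    "\<And>y. y \<in> set N \<Longrightarrow> fst y = j \<or> fst y = Suc j"
    "\<And>y. y \<in> set (g q) \<Longrightarrow> fst y \<in> fst ` set N"
  shows "p = q" "W1 @ g p @ W2 \<approx> V1 @ g q @ V2"
proof -
  have split: "\<exists>A B. f p = A @ tr (p + d) # B \<and> untracked A \<and> untracked B" for p
  proof -
    from assms(7)[of p, unfolded filter_eq_Cons_iff] obtain us vs
      where "f p = us @ tr (p + d) # vs" "\<forall>u\<in>set us. \<not> snd u" "[] = filter snd vs" by blast
    then show ?thesis using untracked_def untracked_filter by metis
  qed
  obtain A B where AB: "f p = A @ tr (p + d) # B" using split by blast
  obtain A' B' where AB': "f q = A' @ tr (q + d) # B'" "untracked A'" "untracked B'"
    using split by blast
  have eq: "V1 @ N @ V2 \<approx> W1 @ M @ W2"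
    using same_circuit_trans[OF same_circuit_sym[OF assms(2)] assms(1)] .
  then have eq': "(V1 @ A') @ tr (q + d) # (B' @ V2) \<approx> (W1 @ A) @ tr (p + d) # (B @ W2)"
    unfolding assms(5,6) AB AB' by simp
  show p: "p = q" using tracked_unique(1)[OF eq'] assms(3,4) AB' by simp
  show "W1 @ g p @ W2 \<approx> V1 @ g q @ V2"
    unfolding p
  proof (rule replace_factor[where M = N and q = "q + d" and j = j])
    show "W1 @ N @ W2 \<approx> V1 @ N @ V2"
      using same_circuit_sym[OF eq] p assms(5,6) by simp
    show "length (filter snd (V1 @ N @ V2)) = 1"
      using assms(3,4,6,7) unfolding untracked_filter by simp
    show "tr (q + d) \<in> set N" using AB' assms(6) by simp
  qed (use assms in auto)
qed

lemma tr_past_dg: "u < q \<or> q + 1 < b \<Longrightarrow> V @ tr q # dg b u @ Y \<approx> V @ dg b u @ tr q # Y"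
  using same_circuit_swap[of "[tr q]" "dg b u" V Y] by force

lemma pl_past_dg: "u < q \<or> q + 1 < b \<Longrightarrow> V @ pl q # dg b u @ Y \<approx> V @ dg b u @ pl q # Y"
  using same_circuit_swap[of "[pl q]" "dg b u" V Y] by force

section \<open>Step 1: passing the diagonals\<close>

lemma on_top_intro:
  assumes W: "W \<approx> dgs xs @ tr q # dg k q @ dgs ys" and r: "rsf L (xs @ (k, q) # ys)"
    and "1 \<le> q" "q < L" "below q xs"
  shows "on_top L W"
proof -
  obtain j where j: "q = Suc j" using assms by (cases q) auto
  have k: "k < q" using r by (auto simp: rsf_append rsf_Cons)
  have 1: "proj j (dgs xs) = [] \<or> fst (last (proj j (dgs xs))) = j"
    by (rule proj_dgs_last) (use assms(5) j in \<open>auto simp: below_def\<close>)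
  have 2: "rsf_shape L W"
    by (rule rsf_shapeI[of "xs @ (k, Suc q) # ys", OF _ _ W])
      (use r \<open>q < L\<close> k in \<open>auto simp: rsf_append rsf_Cons gapped_append gapped_Cons rsf_gapped dg_Suc dest: rsfD\<close>)
  show ?thesis
    unfolding on_top_def
    by (intro conjI 2 exI[of _ "dgs xs"] exI[of _ j] exI[of _ "dg k q @ dgs ys"])
      (use W 1 j k in \<open>auto simp: proj_dg\<close>)
qed

text \<open>Induction over the diagonals ahead. The first one, on positions \<open>k\<close> to
  \<open>u - 1\<close>, is compared with \<open>q\<close>; it is passed silently only if it ends
  below \<open>q - 1\<close>, and then the next one is examined.\<close>

lemma descending_cases_aux:
  assumes "W \<approx> dgs xs @ tr q # dgs ys" "rsf L (xs @ ys)" "1 \<le> q" "q < L" "below q xs"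
  shows "free L W \<or> on_top L W
    \<or> (\<exists>xs q ys k. W \<approx> dgs xs @ [tr q, pl q] @ (dg k q @ dgs ys) \<and>
         rsf L (xs @ (k, Suc q) # ys) \<and> 1 \<le> q \<and> q < L \<and> below q xs \<and> k \<le> q)
    \<or> (\<exists>xs q k u ys. W \<approx> (dgs xs @ dg (q + 2) u) @ [tr q, pl (q + 1), pl q] @ (dg k q @ dgs ys) \<and>
         rsf L (xs @ (k, u) # ys) \<and> 1 \<le> q \<and> below q xs \<and> k \<le> q \<and> Suc q < u)"
  using assms
proof (induction ys arbitrary: xs)
  case Nil
  then have "free L W" unfolding free_def by (intro exI[of _ xs] exI[of _ q] exI[of _ "[]"]) auto
  then show ?case ..
next
  case (Cons y ys)
  obtain k u where y: "y = (k, u)" by (cases y)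
  have ku: "1 \<le> k" "k < u" "u \<le> L" using Cons.prems y by (auto simp: rsf_append rsf_Cons)
  \<comment> \<open>In this order: the tracked gate is below the base, crosses the diagonal, meets
    its top gate, rests on its top gate, or commutes past all of it.\<close>
  consider "q < k" | "k \<le> q" "Suc q < u" | "k \<le> q" "u = Suc q" | "u = q" | "u < q"
    using ku by linarith
  then show ?case
  proof cases
    case 1
    then have "\<forall>(b, u)\<in>set (y # ys). q < b"
      using Cons.prems(2) y by (fastforce simp: rsf_append rsf_Cons)
    then have "free L W"
      unfolding free_def using Cons.prems by blast
    then show ?thesis ..
  next
    case 2
    have "W \<approx> dgs xs @ tr q # dg (q + 2) u @ pl (q + 1) # pl q # dg k q @ dgs ys"
      using Cons.prems(1) y 2 ku dg_split[of k "q + 2" u] dg_Suc[of k q] dg_Suc[of k "Suc q"] by simp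
    also have "\<dots> \<approx> dgs xs @ dg (q + 2) u @ tr q # pl (q + 1) # pl q # dg k q @ dgs ys"
      by (rule tr_past_dg) simp
    finally show ?thesis using 2 Cons.prems y by force
  next
    case 3
    then have "W \<approx> dgs xs @ [tr q, pl q] @ (dg k q @ dgs ys)"
      using Cons.prems(1) y dg_Suc[of k q] by simp
    then show ?thesis using 3 Cons.prems y by blast
  next
    case 4
    then show ?thesis using on_top_intro[of W xs q k ys L] Cons.prems y by simp
  next
    case 5
    have "W \<approx> dgs xs @ tr q # dg k u @ dgs ys" using Cons.prems(1) y by simp
    also have "\<dots> \<approx> dgs xs @ dg k u @ tr q # dgs ys"
      by (rule tr_past_dg) (use 5 in simp)
    finally have "W \<approx> dgs (xs @ [y]) @ tr q # dgs ys" using y by simp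
    moreover have "below q (xs @ [y])" using Cons.prems(5) y 5 ku by (auto simp: below_def)
    ultimately show ?thesis using Cons.IH[of "xs @ [y]"] Cons.prems by simp
  qed
qed

lemma descending_cases [consumes 1, case_names free on_top merge inner]:
  assumes "descending L W"
  obtains "free L W" | "on_top L W"
  | xs q ys k where "W \<approx> dgs xs @ [tr q, pl q] @ (dg k q @ dgs ys)"
      "rsf L (xs @ (k, Suc q) # ys)" "1 \<le> q" "q < L" "below q xs" "k \<le> q"
  | xs q k u ys where "W \<approx> (dgs xs @ dg (q + 2) u) @ [tr q, pl (q + 1), pl q] @ (dg k q @ dgs ys)"
      "rsf L (xs @ (k, u) # ys)" "1 \<le> q" "below q xs" "k \<le> q" "Suc q < u"
  using assms descending_cases_aux unfolding descending_def by metis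

lemma free_no_seq1_merges:
  assumes "free L W"
  shows "\<not> merges W" "\<not> occurs [tr p, pl (p + 1), pl p] W"
proof -
  obtain xs q ys where *: "W \<approx> dgs xs @ tr q # dgs ys" "1 \<le> q" "below q xs" "\<forall>(b, u)\<in>set ys. q < b"
    using assms unfolding free_def by auto
  obtain j where j: "q = Suc j" using *(2) by (cases q) auto
  have 1: "proj j (dgs xs) = [] \<or> fst (last (proj j (dgs xs))) = j"
    by (rule proj_dgs_last) (use *(3) j in \<open>auto simp: below_def\<close>)
  have 2: "proj j (dgs ys) = []"
    by (rule proj_dgs_above) (use *(4) j in auto)
  show "\<not> merges W" by (rule not_merges[OF *(1)[unfolded j]]) (use 1 2 in auto)
  show "\<not> occurs [tr p, pl (p + 1), pl p] W" by (rule no_seq1[OF *(1)[unfolded j]]) (use 2 in auto)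
qed

text \<open>On the right a gate at \<open>q + 1\<close> intervenes; on the left the nearest gate
  among positions \<open>q - 1\<close> and \<open>q\<close> is at \<open>q - 1\<close>, if there is
  one.\<close>

lemma inner_not_merges:
  assumes W: "W \<approx> (dgs xs @ dg (q + 2) u) @ [tr q, pl (q + 1), pl q] @ (dg k q @ dgs ys)"
    and "1 \<le> q" "below q xs"
  shows "\<not> merges W"
proof -
  obtain j where j: "q = Suc j" using assms by (cases q) auto
  have 1: "proj j (dgs xs) = [] \<or> fst (last (proj j (dgs xs))) = j"
    by (rule proj_dgs_last) (use assms(3) j in \<open>auto simp: below_def\<close>)
  have W': "W \<approx> (dgs xs @ dg (q + 2) u) @ tr (Suc j) # (pl (q + 1) # pl q # dg k q @ dgs ys)"
    using W j by simp
  show ?thesis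
    by (rule not_merges[OF W']) (use 1 j in \<open>auto simp: proj_dg\<close>)
qed

lemma descending_step1:
  assumes "descending L W" "\<not> merges W" "W \<approx> W1 @ [tr p, pl (p + 1), pl p] @ W2"
  shows "descending L (W1 @ [pl (p + 1), pl p, tr (p + 1)] @ W2)"
proof -
  have occ: "occurs [tr p, pl (p + 1), pl p] W" using assms(3) unfolding occurs_def by blast
  from assms(1) show ?thesis
  proof (cases rule: descending_cases)
    case free
    then show ?thesis using free_no_seq1_merges occ by blast
  next
    case on_top
    then show ?thesis using on_top_no_seqs occ by blast
  next
    case (merge xs q ys k)
    then show ?thesis using assms(2) unfolding merges_def occurs_def by blast
  next
    case (inner xs q k u ys)
    have "W1 @ [pl (p + 1), pl p, tr (p + 1)] @ W2
        \<approx> (dgs xs @ dg (q + 2) u) @ [pl (q + 1), pl q, tr (q + 1)] @ (dg k q @ dgs ys)"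
      by (rule replace_pattern(2)[OF assms(3) inner(1), where d = 0 and j = q
            and f = "\<lambda>p. [tr p, pl (p + 1), pl p]"]) auto
    \<comment> \<open>Now at \<open>q + 1\<close>, the tracked gate commutes with the rest of the
      diagonal, whose positions are at most \<open>q - 1\<close>, and emerges behind a diagonal of
      unchanged extent.\<close>
    also have "\<dots> \<approx> (dgs xs @ dg (q + 2) u) @ pl (q + 1) # pl q # dg k q @ tr (q + 1) # dgs ys"
      using tr_past_dg[of q "q + 1" k "dgs xs @ dg (q + 2) u @ [pl (q + 1), pl q]" "dgs ys"] by simp
    also have "\<dots> = dgs (xs @ [(k, u)]) @ tr (q + 1) # dgs ys"
      using inner(5,6) dg_split[of k "q + 2" u] dg_Suc[of k q] dg_Suc[of k "Suc q"] by simp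
    finally have "W1 @ [pl (p + 1), pl p, tr (p + 1)] @ W2 \<approx> \<dots>" .
    moreover have "below (q + 1) (xs @ [(k, u)])"
      using inner by (auto simp: below_def)
    moreover have "q + 1 < L" using inner by (auto simp: rsf_append rsf_Cons)
    moreover have "rsf L ((xs @ [(k, u)]) @ ys)" using inner(2) by simp
    ultimately show ?thesis unfolding descending_def
      by (intro exI[of _ "xs @ [(k, u)]"] exI[of _ "q + 1"] exI[of _ ys]) simp
  qed
qed

lemma descending_end:
  assumes "descending L W" "\<not> merges W" "\<nexists>j. occurs [tr j, pl (j + 1), pl j] W"
  shows "free L W \<or> on_top L W"
  using assms(1)
proof (cases rule: descending_cases)
  case (merge xs q ys k)
  then show ?thesis using assms(2) unfolding merges_def occurs_def by blast
next
  case (inner xs q k u ys)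
  then show ?thesis using assms(3) unfolding occurs_def by blast
qed auto

lemma descending_merge:
  assumes "descending L W" "M = [tr p, pl p] \<or> M = [pl p, tr p]" "W \<approx> W1 @ M @ W2"
  shows "rsf_shape L (W1 @ [tr p] @ W2)"
proof -
  have m: "merges W" using assms(2,3) unfolding merges_def occurs_def by blast
  from assms(1) show ?thesis
  proof (cases rule: descending_cases)
    case free
    then show ?thesis using free_no_seq1_merges m by blast
  next
    case on_top
    then show ?thesis using on_top_settled settled_not_merges m by blast
  next
    case (inner xs q k u ys)
    then show ?thesis using inner_not_merges m by blast
  next
    case (merge xs q ys k)
    obtain j where j: "q = Suc j" using merge by (cases q) auto
    have 1: "proj j (dgs xs) = [] \<or> fst (last (proj j (dgs xs))) = j"
      by (rule proj_dgs_last) (use merge j in \<open>auto simp: below_def\<close>)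
    have W': "W \<approx> dgs xs @ tr (Suc j) # (pl q # dg k q @ dgs ys)" using merge j by simp
    \<comment> \<open>The partner must lie on the right, since the diagonals passed leave at most a
      gate at \<open>q - 1\<close> as left neighbour. Merging into the top gate then keeps the shape
      of the diagonal.\<close>
    have "\<not> occurs [pl p, tr p] W"
      by (rule no_merge_above[OF W']) (use 1 in auto)
    then have M: "W \<approx> W1 @ [tr p, pl p] @ W2" using assms(2,3) by (auto simp: occurs_def)
    have "W1 @ [tr p] @ W2 \<approx> dgs xs @ [tr q] @ (dg k q @ dgs ys)"
      by (rule replace_pattern(2)[OF M merge(1), where d = 0 and j = q
            and f = "\<lambda>p. [tr p, pl p]"]) auto
    then show ?thesis
      by (rule rsf_shapeI[of "xs @ (k, Suc q) # ys", rotated 2])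
        (use merge(2,6) in \<open>auto simp: rsf_append rsf_Cons gapped_append gapped_Cons rsf_gapped dg_Suc dest: rsfD\<close>)
  qed
qed

section \<open>Step 2: extending a diagonal downwards\<close>

lemma free_cases [consumes 1, case_names away base]:
  assumes "free L W"
  obtains xs q ys where "W \<approx> dgs xs @ tr q # dgs ys" "rsf L (xs @ ys)" "1 \<le> q" "q < L" "below q xs"
      "\<forall>(b, u)\<in>set ys. q + 2 \<le> b"
  | xs q u ys where "W \<approx> (dgs xs @ dg (q + 2) u) @ [tr q, pl (q + 1)] @ dgs ys"
      "rsf L xs" "rsf L ys" "1 \<le> q" "q + 2 \<le> u" "u \<le> L" "below q xs" "\<forall>(b, u)\<in>set ys. q + 3 \<le> b"
proof -
  obtain xs q ys where *: "W \<approx> dgs xs @ tr q # dgs ys" "rsf L (xs @ ys)" "1 \<le> q" "q < L"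
    "below q xs" "\<forall>(b, u)\<in>set ys. q < b"
    using assms unfolding free_def by auto
  show thesis
  proof (cases "\<forall>(b, u)\<in>set ys. q + 2 \<le> b")
    case True
    then show thesis using that(1) * by blast
  next
    case False
    then obtain y zs where ys: "ys = y # zs" by (cases ys) auto
    obtain b u where y: "y = (b, u)" by (cases y)
    have bu: "b < u" "u \<le> L" "rsf L zs" "rsf L xs" "\<forall>(c, u)\<in>set zs. b + 2 \<le> c"
      using *(2) ys y by (auto simp: rsf_append rsf_Cons)
    \<comment> \<open>Bases increase by at least two, so only the first remaining diagonal can come
      closer to \<open>q\<close> than the gap condition allows.\<close>
    have b: "b = q + 1"
    proof (rule ccontr)
      assume "b \<noteq> q + 1"
      then have "q + 2 \<le> b" using *(6) ys y by auto
      then have "\<forall>(b, u)\<in>set ys. q + 2 \<le> b" using bu(5) ys y by auto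
      then show False using False by blast
    qed
    have "W \<approx> dgs xs @ tr q # dg (q + 2) u @ pl (q + 1) # dgs zs"
      using *(1) ys y b bu dg_snoc[of b u] by simp
    also have "\<dots> \<approx> dgs xs @ dg (q + 2) u @ tr q # pl (q + 1) # dgs zs"
      by (rule tr_past_dg) simp
    finally show thesis using that(2)[of xs q u zs] * bu b by force
  qed
qed

lemma untouched_dgs:
  assumes "\<forall>(b, u)\<in>set ys. q + 3 \<le> b"
  shows "untouched q (dgs ys)"
  unfolding untouched_def
proof clarify
  fix i g assume "(i, g) \<in> set (dgs ys)"
  from set_dgsD[OF this] assms show "{i, i + 1} \<inter> {q, q + 1, q + 2} = {}" by force
qed

text \<open>In the case \<open>away\<close> the pattern is absent, as nothing at \<open>q\<close> or
  \<open>q + 1\<close> stands to the right of the tracked gate. In the case \<open>base\<close> the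
  move puts the tracked gate under the diagonal as its new base.\<close>

lemma free_step2:
  assumes "free L W" "W \<approx> W1 @ [tr p, pl (p + 1)] @ W2" "untouched p W2"
  shows "at_base L (W1 @ [pl (p + 1), tr p] @ W2)"
  using assms(1)
proof (cases rule: free_cases)
  case (away xs q ys)
  obtain j where j: "q = Suc j" using away by (cases q) auto
  have 2: "proj (Suc j) (dgs ys) = []"
    by (rule proj_dgs_above) (use away j in auto)
  have "\<not> occurs_first p [tr p, pl (p + 1)] W"
    by (rule no_seq2[OF away(1)[unfolded j]]) (use 2 in auto)
  then show ?thesis using assms unfolding occurs_first_def by blast
next
  case (base xs q u ys)
  have "W1 @ [pl (p + 1), tr p] @ W2 \<approx> (dgs xs @ dg (q + 2) u) @ [pl (q + 1), tr q] @ dgs ys"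
    by (rule replace_pattern(2)[OF assms(2) base(1), where d = 0 and j = q
          and f = "\<lambda>p. [tr p, pl (p + 1)]"]) auto
  also have "\<dots> = dgs xs @ dg (Suc q) u @ tr q # dgs ys"
    using base dg_snoc[of "Suc q" u] by simp
  finally show ?thesis unfolding at_base_def
    by (intro exI[of _ xs] exI[of _ q] exI[of _ u] exI[of _ ys]) (use base in fastforce)
qed

lemma free_skip2:
  assumes "free L W" "\<nexists>j. occurs_first j [tr j, pl (j + 1)] W"
  shows "at_base L W"
  using assms(1)
proof (cases rule: free_cases)
  case (away xs q ys)
  show ?thesis unfolding at_base_def
    by (intro exI[of _ xs] exI[of _ q] exI[of _ "Suc q"] exI[of _ ys])
      (use away in \<open>auto simp: rsf_append\<close>)
next
  case (base xs q u ys)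
  then show ?thesis using assms(2) untouched_dgs[of ys q] unfolding occurs_first_def by blast
qed

section \<open>Step 3: bases at distance one\<close>

lemma at_base_cases [consumes 1, case_names close settled]:
  assumes "at_base L W"
  obtains xs b v u ys where
    "W \<approx> (dgs xs @ dg (Suc b) v @ dg (b + 2) u) @ [pl b, tr (b + 1)] @ dgs ys"
      "rsf L xs" "rsf L ys" "1 \<le> b" "Suc b < v" "v \<le> L" "Suc b < u" "u \<le> L"
      "\<forall>(c, v)\<in>set xs. c + 2 \<le> b"
      "\<forall>(c, v)\<in>set ys. b + 3 \<le> c \<and> (b + 2 < u \<longrightarrow> b + 4 \<le> c)"
  | "settled L W" "\<And>p. \<not> occurs_first p [pl p, tr (p + 1)] W"
proof -
  obtain xs q u ys where *: "W \<approx> dgs xs @ dg (Suc q) u @ tr q # dgs ys"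
     "rsf L xs" "rsf L ys" "1 \<le> q" "q < u" "u \<le> L" "below q xs"
     "\<forall>(b, v)\<in>set ys. q + 2 \<le> b \<and> (Suc q < u \<longrightarrow> q + 3 \<le> b)"
    using assms unfolding at_base_def by blast
  obtain j where j: "q = Suc j" using * by (cases q) auto
  show thesis
  \<comment> \<open>Bases of \<open>xs\<close> are less than \<open>q\<close>, so
    \<open>j = q - 1\<close> is the only one that violates the gap to a diagonal with base
    \<open>q\<close>.\<close>
  proof (cases "\<exists>v. (j, v) \<in> set xs")
    case True
    then obtain v where v: "(j, v) \<in> set xs" by blast
    obtain xs' x where xs: "xs = xs' @ [x]" using v by (cases xs rule: rev_cases) auto
    obtain b w where x: "x = (b, w)" by (cases x)
    \<comment> \<open>Bases increase and none exceeds \<open>q - 1\<close>, so the offending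
      diagonal is the last one passed.\<close>
    have "b = j"
    proof (rule ccontr)
      assume "b \<noteq> j"
      then have "j + 2 \<le> b" using v xs x *(2) by (auto simp: rsf_append)
      then show False using *(7) xs x j by (auto simp: below_def)
    qed
    then have b: "q = Suc b" "b < w" "w \<le> L" "1 \<le> b" "Suc b < w" "rsf L xs'"
      "\<forall>(c, v)\<in>set xs'. c + 2 \<le> b"
      using *(2,7) xs x j by (auto simp: rsf_append rsf_Cons below_def)
    have "W \<approx> (dgs xs' @ dg (Suc b) w) @ pl b # dg (b + 2) u @ tr (b + 1) # dgs ys"
      using *(1) xs x b dg_snoc[of b w] by simp
    also have "\<dots> \<approx> (dgs xs' @ dg (Suc b) w) @ dg (b + 2) u @ pl b # tr (b + 1) # dgs ys"
      by (rule pl_past_dg) simp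
    finally show thesis using that(1)[of xs' b w u ys] b * by fastforce
  next
    case False
    have xs: "b < j" if "(b, v) \<in> set xs" for b v
      using False *(7) that j unfolding below_def by (metis (no_types, lifting) case_prodD less_SucE)
    let ?X = "dgs xs @ dg (Suc q) u"
    have W: "W \<approx> ?X @ tr (Suc j) # dgs ys" using *(1) j by simp
    have 1: "proj j (dgs xs) = [] \<or> fst (last (proj j (dgs xs))) = j"
      by (rule proj_dgs_last) (use xs in fastforce)
    have 2: "proj j (dgs ys) = []"
      by (rule proj_dgs_above) (use *(8) j in fastforce)
    have 3: "rsf_shape L W"
    proof (rule rsf_shapeI[OF _ _ W, of "xs @ (q, u) # ys"])
      show "gapped (xs @ (q, u) # ys)"
        using * xs j by (fastforce simp: gapped_append gapped_Cons rsf_gapped)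
      show "untrack (?X @ tr (Suc j) # dgs ys) \<approx> dgs (xs @ (q, u) # ys)"
        using * j dg_snoc[of q u] by simp
    qed (use * j in \<open>auto dest: rsfD\<close>)
    have s: "settled L W" unfolding settled_def
      by (intro conjI 3 exI[of _ ?X] exI[of _ j] exI[of _ "dgs ys"] W)
        (use 1 2 j in \<open>auto simp: proj_dg\<close>)
    \<comment> \<open>A gate at \<open>q - 1\<close> belongs to a diagonal with smaller base, hence
      is followed by a gate at \<open>q - 2\<close> that touches one of its qubits.\<close>
    have "j \<notin> fst ` set ?X \<or> (\<exists>i. j = Suc i \<and> fst (last (proj i ?X)) = i \<and> proj i (dgs ys) = [])"
    proof (cases "j \<in> fst ` set ?X")
      case True
      then have jx: "j \<in> fst ` set (dgs xs)" using j by auto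
      then obtain x where x: "x \<in> set (dgs xs)" "fst x = j" by auto
      then obtain i where i: "j = Suc i" using set_dgsD[OF x(1)] xs by (cases j) auto
      have "x \<in> set (proj i (dgs xs))" using x i by (simp add: proj_def)
      then have "proj i (dgs xs) \<noteq> []" by auto
      moreover have "proj i (dgs xs) = [] \<or> fst (last (proj i (dgs xs))) = i"
        by (rule proj_dgs_last) (use xs i in fastforce)
      moreover have "proj i (dgs ys) = []"
        by (rule proj_dgs_above) (use *(8) j i in fastforce)
      ultimately show ?thesis using i j by (auto simp: proj_dg)
    qed simp
    then have "\<not> occurs_first p [pl p, tr (p + 1)] W" for p
      by (intro no_seq3[OF W]) auto
    then show thesis using that(2) s by blast
  qed
qed

lemma at_base_not_merges:
  assumes "at_base L W"
  shows "\<not> merges W"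
proof -
  obtain xs q u ys where *: "W \<approx> dgs xs @ dg (Suc q) u @ tr q # dgs ys"
     "1 \<le> q" "below q xs" "\<forall>(b, v)\<in>set ys. q + 2 \<le> b \<and> (Suc q < u \<longrightarrow> q + 3 \<le> b)"
    using assms unfolding at_base_def by blast
  obtain j where j: "q = Suc j" using * by (cases q) auto
  have W: "W \<approx> (dgs xs @ dg (Suc q) u) @ tr (Suc j) # dgs ys" using *(1) j by simp
  have 1: "proj j (dgs xs) = [] \<or> fst (last (proj j (dgs xs))) = j"
    by (rule proj_dgs_last) (use *(3) j in \<open>auto simp: below_def\<close>)
  have 2: "proj j (dgs ys) = []"
    by (rule proj_dgs_above) (use *(4) j in fastforce)
  show ?thesis by (rule not_merges[OF W]) (use 1 2 j in \<open>auto simp: proj_dg\<close>)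
qed

text \<open>The climb starts at \<open>p = Suc b\<close>, where \<open>dg (b + 2) (Suc p)\<close> is
  still empty. A next base at \<open>b + 3\<close> forces \<open>u = b + 2\<close>: otherwise the
  extended diagonal originally began at \<open>b + 2\<close> and its successor at
  \<open>b + 4\<close> or above.\<close>

lemma at_base_step3:
  assumes "at_base L W" "W \<approx> W1 @ [pl p, tr (p + 1)] @ W2" "untouched p W2"
  shows "ascending L (W1 @ [tr (p + 1), pl p] @ W2)"
  using assms(1)
proof (cases rule: at_base_cases)
  case (close xs b v u ys)
  have "W1 @ [tr (p + 1), pl p] @ W2 \<approx> (dgs xs @ dg (Suc b) v @ dg (b + 2) u) @ [tr (b + 1), pl b] @ dgs ys"
    by (rule replace_pattern(2)[OF assms(2) close(1), where d = 1 and j = b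
          and f = "\<lambda>p. [pl p, tr (p + 1)]"]) auto
  moreover have "\<forall>(c, v)\<in>set ys. b + 3 \<le> c \<and> (b + 3 = c \<longrightarrow> Suc b = Suc b \<and> u = Suc (Suc b))"
    using close(7,10) by fastforce
  ultimately show ?thesis
    unfolding ascending_def
    by (intro exI[of _ xs] exI[of _ b] exI[of _ "Suc b"] exI[of _ v] exI[of _ u] exI[of _ ys])
      (use close(2-9) dg_Suc[of b b] in simp)
next
  case settled
  then show ?thesis using assms unfolding occurs_first_def by blast
qed

lemma at_base_skip3:
  assumes "at_base L W" "\<nexists>j. occurs_first j [pl j, tr (j + 1)] W"
  shows "settled L W"
  using assms(1)
proof (cases rule: at_base_cases)
  case (close xs b v u ys)
  then have "untouched b (dgs ys)" by (intro untouched_dgs) auto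
  then show ?thesis using assms(2) close(1) unfolding occurs_first_def by blast
qed

section \<open>Step 4: the climb between two diagonals\<close>

lemma ascending_cases [consumes 1, case_names merge climb]:
  assumes "ascending L W"
  obtains xs b p u ys where
     "W \<approx> (dgs xs @ dg (Suc p) u) @ [pl p, tr p] @ (dg b p @ dg (b + 2) (Suc p) @ dgs ys)"
     "rsf L xs" "rsf L ys" "1 \<le> b" "b < p" "p < u" "u \<le> L"
     "\<forall>(c, v)\<in>set xs. c + 2 \<le> b" "\<forall>(c, v)\<in>set ys. b + 3 \<le> c \<and> (b + 3 = c \<longrightarrow> p = Suc b)"
   | xs b p u u' ys where
     "W \<approx> (dgs xs @ dg (Suc p) u @ dg (p + 2) u') @ [pl p, pl (p + 1), tr p] @
        (dg b p @ dg (b + 2) (Suc p) @ dgs ys)"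
     "rsf L xs" "rsf L ys" "1 \<le> b" "b < p" "p < u" "Suc p < u'" "u \<le> L" "u' \<le> L"
     "\<forall>(c, v)\<in>set xs. c + 2 \<le> b" "\<forall>(c, v)\<in>set ys. b + 4 \<le> c"
proof -
  obtain xs b p u u' ys where *:
     "W \<approx> dgs xs @ dg p u @ dg (Suc p) u' @ tr p # dg b p @ dg (b + 2) (Suc p) @ dgs ys"
     "rsf L xs" "rsf L ys" "1 \<le> b" "b < p" "p < u" "p < u'" "u \<le> L" "u' \<le> L"
     "\<forall>(c, v)\<in>set xs. c + 2 \<le> b"
     "\<forall>(c, v)\<in>set ys. b + 3 \<le> c \<and> (b + 3 = c \<longrightarrow> p = Suc b \<and> u' = Suc p)"
    using assms unfolding ascending_def by auto
  show thesis
  \<comment> \<open>If \<open>dg (Suc p) u'\<close> is empty, the last gate of \<open>dg p u\<close>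
    is the left neighbour at the same position and can be merged. Otherwise its last gate, at
    \<open>p + 1\<close>, stands between the two and completes the pattern of Step 4.\<close>
  proof (cases "u' = Suc p")
    case True
    then show thesis using that(1)[of xs p u b ys] * dg_snoc[of p u] by fastforce
  next
    case False
    have "W \<approx> (dgs xs @ dg (Suc p) u) @ pl p # dg (p + 2) u' @ pl (p + 1) # tr p # dg b p @ dg (b + 2) (Suc p) @ dgs ys"
      using * False dg_snoc[of p u] dg_snoc[of "Suc p" u'] by simp
    also have "\<dots> \<approx> (dgs xs @ dg (Suc p) u) @ dg (p + 2) u' @ pl p # pl (p + 1) # tr p # dg b p @ dg (b + 2) (Suc p) @ dgs ys"
      by (rule pl_past_dg) simp
    finally have "W \<approx> (dgs xs @ dg (Suc p) u @ dg (p + 2) u') @ [pl p, pl (p + 1), tr p] @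
        (dg b p @ dg (b + 2) (Suc p) @ dgs ys)" by simp
    moreover have "\<forall>(c, v)\<in>set ys. b + 4 \<le> c" using * False by fastforce
    ultimately show thesis using that(2)[of xs p u u' b ys] * False by linarith
  qed
qed

text \<open>The merged gate joins \<open>dg (Suc p) u\<close> and \<open>dg b p\<close> into one
  diagonal \<open>(b, u)\<close>, and \<open>(b + 2, Suc p)\<close> remains as the second
  one.\<close>

lemma ascending_merge:
  assumes "ascending L W" "M = [tr r, pl r] \<or> M = [pl r, tr r]" "W \<approx> W1 @ M @ W2"
  shows "rsf_shape L (W1 @ [tr r] @ W2)"
  using assms(1)
proof (cases rule: ascending_cases)
  case (merge xs b p u ys)
  obtain j where j: "p = Suc j" using merge by (cases p) auto
  have W': "W \<approx> (dgs xs @ dg (Suc p) u @ [pl p]) @ tr (Suc j) # (dg b p @ dg (b + 2) (Suc p) @ dgs ys)"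
    using merge j by simp
  have "\<not> occurs [tr r, pl r] W"
    by (rule no_merge_below[OF W']) (use merge j in \<open>auto simp: proj_dg\<close>)
  then have M: "W \<approx> W1 @ [pl r, tr r] @ W2" using assms(2,3) by (auto simp: occurs_def)
  have R: "W1 @ [tr r] @ W2 \<approx> (dgs xs @ dg (Suc p) u) @ [tr p] @ (dg b p @ dg (b + 2) (Suc p) @ dgs ys)"
    by (rule replace_pattern(2)[OF M merge(1), where d = 0 and j = p
          and f = "\<lambda>p. [pl p, tr p]"]) auto
  have d: "dg b u = dg (Suc p) u @ pl p # dg b p"
    using merge dg_split[of b "Suc p" u] dg_Suc[of b p] by simp
  show ?thesis
  \<comment> \<open>For \<open>p = Suc b\<close> the second interval is empty and has to be left out
    of the list, since the next base may be \<open>b + 3\<close>.\<close>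
  proof (cases "p = Suc b")
    case True
    then show ?thesis
      by (intro rsf_shapeI[of "xs @ (b, u) # ys", OF _ _ R])
        (use merge d in \<open>fastforce simp: gapped_append gapped_Cons rsf_gapped dest: rsfD\<close>)+
  next
    case False
    then have ys: "\<forall>(c, v)\<in>set ys. b + 4 \<le> c" using merge by fastforce
    show ?thesis
      by (intro rsf_shapeI[of "xs @ (b, u) # (b + 2, Suc p) # ys", OF _ _ R])
        (use merge ys d in \<open>fastforce simp: gapped_append gapped_Cons rsf_gapped dest: rsfD\<close>)+
  qed
next
  case (climb xs b p u u' ys)
  obtain j where j: "p = Suc j" using climb by (cases p) auto
  have W': "W \<approx> (dgs xs @ dg (Suc p) u @ dg (p + 2) u' @ [pl p, pl (p + 1)]) @ tr (Suc j) # (dg b p @ dg (b + 2) (Suc p) @ dgs ys)"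
    using climb j by simp
  have "\<not> merges W"
    by (rule not_merges[OF W']) (use climb j in \<open>auto simp: proj_dg\<close>)
  then show ?thesis using assms(2,3) unfolding merges_def occurs_def by blast
qed

text \<open>The move reproduces the configuration with \<open>p + 1\<close> for \<open>p\<close>: of
  the two gates left behind, the one at \<open>p\<close> prolongs \<open>dg b p\<close>, and the one
  at \<open>p + 1\<close> commutes past it and prolongs \<open>dg (b + 2) (Suc p)\<close>.\<close>

lemma ascending_step4:
  assumes "ascending L W" "\<not> merges W" "W \<approx> W1 @ [pl r, pl (r + 1), tr r] @ W2"
  shows "ascending L (W1 @ [tr (r + 1), pl r, pl (r + 1)] @ W2) \<or>
    settled L (W1 @ [tr (r + 1), pl r, pl (r + 1)] @ W2)"
  using assms(1)
proof (cases rule: ascending_cases)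
  case (merge xs b p u ys)
  then show ?thesis using assms(2) unfolding merges_def occurs_def by blast
next
  case (climb xs b p u u' ys)
  let ?Z = "dg b (Suc p) @ dg (b + 2) (Suc (Suc p)) @ dgs ys"
  let ?X = "dgs xs @ dg (Suc p) u @ dg (Suc (Suc p)) u'"
  have "W1 @ [tr (r + 1), pl r, pl (r + 1)] @ W2 \<approx> (dgs xs @ dg (Suc p) u @ dg (p + 2) u') @
      [tr (p + 1), pl p, pl (p + 1)] @ (dg b p @ dg (b + 2) (Suc p) @ dgs ys)"
    by (rule replace_pattern(2)[OF assms(3) climb(1), where d = 0 and j = p
          and f = "\<lambda>p. [pl p, pl (p + 1), tr p]"]) auto
  also have "\<dots> = (?X @ [tr (p + 1), pl p]) @ pl (p + 1) # dg b p @ dg (b + 2) (Suc p) @ dgs ys"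
    by simp
  also have "\<dots> \<approx> (?X @ [tr (p + 1), pl p]) @ dg b p @ pl (p + 1) # dg (b + 2) (Suc p) @ dgs ys"
    by (rule pl_past_dg) simp
  also have "\<dots> = ?X @ tr (Suc p) # ?Z"
    using climb dg_Suc[of b p] dg_Suc[of "b + 2" "Suc p"] by simp
  finally have R: "W1 @ [tr (r + 1), pl r, pl (r + 1)] @ W2 \<approx> ?X @ tr (Suc p) # ?Z" .
  show ?thesis
  \<comment> \<open>If the left diagonal is used up, the tracked gate fills the place between
    \<open>dg (Suc (Suc p)) u'\<close> and \<open>dg b (Suc p)\<close>, so the diagonal with base
    \<open>b\<close> ends up with the height \<open>u'\<close>.\<close>
  proof (cases "Suc p < u")
    case True
    have "\<forall>(c, v)\<in>set ys. b + 3 \<le> c \<and> (b + 3 = c \<longrightarrow> Suc p = Suc b \<and> u' = Suc (Suc p))"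
      using climb(11) by fastforce
    then have "ascending L (W1 @ [tr (r + 1), pl r, pl (r + 1)] @ W2)"
      unfolding ascending_def
      by (intro exI[of _ xs] exI[of _ b] exI[of _ "Suc p"] exI[of _ u] exI[of _ u'] exI[of _ ys])
        (use climb(2-10) R True in simp)
    then show ?thesis ..
  next
    case False
    have d: "dg b u' = dg (Suc (Suc p)) u' @ pl (Suc p) # dg b (Suc p)"
      using climb dg_split[of b "Suc (Suc p)" u'] dg_Suc[of b "Suc p"] by simp
    have 1: "rsf_shape L (W1 @ [tr (r + 1), pl r, pl (r + 1)] @ W2)"
      by (intro rsf_shapeI[of "xs @ (b, u') # (b + 2, Suc (Suc p)) # ys", OF _ _ R])
        (use climb d False in \<open>fastforce simp: gapped_append gapped_Cons rsf_gapped dest: rsfD\<close>)+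
    have 2: "proj p (dgs xs) = [] \<or> fst (last (proj p (dgs xs))) = p"
      by (rule proj_dgs_last) (use climb in fastforce)
    have "settled L (W1 @ [tr (r + 1), pl r, pl (r + 1)] @ W2)"
      unfolding settled_def
      by (intro conjI 1 exI[of _ ?X] exI[of _ p] exI[of _ ?Z] R)
        (use climb 2 False in \<open>auto simp: proj_dg\<close>)
    then show ?thesis ..
  qed
qed

lemma ascending_end:
  assumes "ascending L W" "\<not> merges W" "\<nexists>j. occurs [pl j, pl (j + 1), tr j] W"
  shows False
  using assms(1)
proof (cases rule: ascending_cases)
  case (merge xs b p u ys)
  then show ?thesis using assms(2) unfolding merges_def occurs_def by blast
next
  case (climb xs b p u u' ys)
  then show ?thesis using assms(3) unfolding occurs_def by blast
qed

lemma on_top_not_merges: "on_top L W \<Longrightarrow> \<not> merges W"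
  using on_top_settled settled_not_merges by blast

section \<open>Invariance and termination on words\<close>

lemma invariant_step:
  assumes "shape_step (s, W) (s', W')" "invariant L (s, W)"
  shows "invariant L (s', W')"
  using assms(1)
proof cases
  case (merge M j W1 W2)
  have "merges W" using merge(4,5) unfolding merges_def occurs_def by blast
  have "rsf_shape L (W1 @ [tr j] @ W2)"
  proof (cases s)
    case Step1
    then show ?thesis using descending_merge[OF _ merge(4,5)] assms(2) by simp
  next
    case Step4
    then show ?thesis
      using ascending_merge[OF _ merge(4,5)] assms(2) settled_not_merges \<open>merges W\<close> by auto
  next
    case Step2
    then show ?thesis
      using assms(2) \<open>merges W\<close> free_no_seq1_merges(1)[of L W] on_top_not_merges[of L W] by auto
  next
    case Step3
    then show ?thesis
      using assms(2) \<open>merges W\<close> at_base_not_merges[of L W] on_top_not_merges[of L W] by auto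
  next
    case Terminated
    then show ?thesis using merge(3) by simp
  qed
  then show ?thesis using merge by simp
next
  case step1
  then show ?thesis using assms(2) descending_step1 by auto
next
  case step1_end
  then show ?thesis using assms(2) descending_end by auto
next
  case (step2 W1 j W2)
  then have "occurs_first j [tr j, pl (j + 1)] W" unfolding occurs_first_def by blast
  then show ?thesis using step2 assms(2) free_step2 on_top_no_seqs(2) by auto
next
  case step2_skip
  then show ?thesis using assms(2) free_skip2 by auto
next
  case (step3 W1 j W2)
  then have "occurs_first j [pl j, tr (j + 1)] W" unfolding occurs_first_def by blast
  then show ?thesis using step3 assms(2) at_base_step3 on_top_no_seqs(3) by auto
next
  case step3_skip
  then show ?thesis using assms(2) at_base_skip3 on_top_settled by auto
next
  case (step4 W1 j W2)
  then have "occurs [pl j, pl (j + 1), tr j] W" unfolding occurs_def by blast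
  then have "ascending L W" using assms(2) step4(1) settled_no_seq4 by auto
  from ascending_step4[OF this step4(4,5)] show ?thesis using step4(2,3) by simp
next
  case step4_end
  then show ?thesis using assms(2) ascending_end by (auto simp: settled_def)
qed

text \<open>A sum over all letters does not depend on their order; with one flagged letter it is the
  position of that letter.\<close>

definition tracked_pos :: "shape \<Rightarrow> nat" where
  "tracked_pos W = sum_list (map (\<lambda>(p, t). if t then p else 0) W)"

lemma tracked_pos_simps [simp]:
  "tracked_pos [] = 0" "tracked_pos (x # W) = (if snd x then fst x else 0) + tracked_pos W"
  "tracked_pos (V @ W) = tracked_pos V + tracked_pos W"
  by (auto simp: tracked_pos_def split: prod.splits)

lemma tracked_pos_untracked: "untracked W \<Longrightarrow> tracked_pos W = 0"
  by (induction W) auto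

lemma tracked_pos_same: "V \<approx> W \<Longrightarrow> tracked_pos V = tracked_pos W"
  unfolding tracked_pos_def sum_mset_sum_list[symmetric] mset_map
  by (drule same_circuit_mset) simp

text \<open>A lexicographic measure: each stage weighs \<open>L + 1\<close>, more than
  \<open>L - tracked_pos W\<close> can contribute, and the moves within Steps 1 and 4 raise the
  tracked position.\<close>

fun run_measure :: "nat \<Rightarrow> stage \<times> shape \<Rightarrow> nat" where
  "run_measure L (s, W) =
     (case s of Step1 \<Rightarrow> 4 | Step2 \<Rightarrow> 3 | Step3 \<Rightarrow> 2 | Step4 \<Rightarrow> 1 | Terminated \<Rightarrow> 0) * (L + 1)
     + (L - tracked_pos W)"

lemma run_measure_decreases:
  assumes "shape_step (s, W) (s', W')" "invariant L (s, W)"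
  shows "run_measure L (s', W') < run_measure L (s, W)"
  using assms(1)
proof cases
  case (merge M j W1 W2)
  then show ?thesis by (cases s) auto
next
  case (step1 W1 j W2)
  \<comment> \<open>Without this bound the truncated difference \<open>L - tracked_pos W\<close>
    might already be 0 and could not decrease.\<close>
  have "tracked_pos W < L"
  proof -
    obtain xs q ys where "W \<approx> dgs xs @ tr q # dgs ys" "q < L"
      using assms(2) step1(1) by (auto simp: descending_def)
    then show ?thesis using tracked_pos_same[of W] by (simp add: tracked_pos_untracked)
  qed
  moreover have "tracked_pos W' = Suc (tracked_pos W)"
    using step1 tracked_pos_same[of W] by simp
  ultimately show ?thesis using step1 by simp
next
  case (step4 W1 j W2)
  have "occurs [pl j, pl (j + 1), tr j] W" using step4 unfolding occurs_def by blast
  then have asc: "ascending L W" using assms(2) step4(1) settled_no_seq4 by auto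
  have "tracked_pos W < L"
  proof -
    from asc obtain xs b p u u' ys where
      "W \<approx> dgs xs @ dg p u @ dg (Suc p) u' @ tr p # dg b p @ dg (b + 2) (Suc p) @ dgs ys"
      "p < u" "u \<le> L" unfolding ascending_def by blast
    then show ?thesis using tracked_pos_same[of W] by (simp add: tracked_pos_untracked)
  qed
  moreover have "tracked_pos W' = Suc (tracked_pos W)"
    using step4 tracked_pos_same[of W] by simp
  ultimately show ?thesis using step4 by simp
qed auto

section \<open>Kronecker products\<close>

lemma dim_kron [simp]:
  "dim_row (kron A B) = dim_row A * dim_row B" "dim_col (kron A B) = dim_col A * dim_col B"
  by (simp_all add: kron_def)

lemma index_kron [simp]:
  "i < dim_row A * dim_row B \<Longrightarrow> j < dim_col A * dim_col B \<Longrightarrow>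
   kron A B $$ (i, j) =
     A $$ (i div dim_row B, j div dim_col B) * B $$ (i mod dim_row B, j mod dim_col B)"
  by (simp add: kron_def)

lemma kron_carrier [intro]:
  "A \<in> carrier_mat m n \<Longrightarrow> B \<in> carrier_mat m' n' \<Longrightarrow> kron A B \<in> carrier_mat (m * m') (n * n')"
  by (intro carrier_matI) auto

lemma kron_assoc: "kron (kron A B) C = kron A (kron B C)"
proof (rule eq_matI)
  fix i j
  assume "i < dim_row (kron A (kron B C))" "j < dim_col (kron A (kron B C))"
  then have ij: "i < dim_row A * (dim_row B * dim_row C)" "j < dim_col A * (dim_col B * dim_col C)"
    by simp_all
  have pos: "0 < dim_row B" "0 < dim_row C" "0 < dim_col B" "0 < dim_col C"
    using ij by (auto intro!: Nat.gr0I)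
  have less: "i div dim_row C < dim_row A * dim_row B" "j div dim_col C < dim_col A * dim_col B"
    using ij by (simp_all add: less_mult_imp_div_less mult.assoc)
  have mods: "i mod (dim_row B * dim_row C) < dim_row B * dim_row C"
    "j mod (dim_col B * dim_col C) < dim_col B * dim_col C"
    using pos by simp_all
  have d: "n div (b * c) = n div c div b" "n mod (b * c) div c = n div c mod b"
    "n mod (b * c) mod c = n mod c" if "0 < c" for n b c :: nat
  proof -
    show "n div (b * c) = n div c div b" by (simp add: div_mult2_eq mult.commute[of b])
    have "n mod (c * b) = c * (n div c mod b) + n mod c" by (rule mod_mult2_eq)
    then show "n mod (b * c) div c = n div c mod b" "n mod (b * c) mod c = n mod c"
      using that by (simp_all add: mult.commute[of b])
  qed
  show "kron (kron A B) C $$ (i, j) = kron A (kron B C) $$ (i, j)"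
    using ij less mods pos by (simp add: d mult.assoc)
qed (simp_all add: mult.assoc)

lemma sum_lessThan_product:
  fixes f :: "nat \<Rightarrow> nat \<Rightarrow> 'a::comm_monoid_add"
  shows "(\<Sum>k<m * n. f (k div n) (k mod n)) = (\<Sum>a<m. \<Sum>b<n. f a b)"
proof (cases "n = 0")
  case False
  have "(\<Sum>a<m. \<Sum>b<n. f a b) = (\<Sum>a<m. \<Sum>k\<in>{a * n..<a * n + n}. f (k div n) (k mod n))"
  proof (rule sum.cong[OF refl])
    fix a
    have "(\<Sum>k\<in>{a * n..<a * n + n}. f (k div n) (k mod n))
        = (\<Sum>b\<in>{0..<n}. f ((b + a * n) div n) ((b + a * n) mod n))"
      using sum.shift_bounds_nat_ivl[of "\<lambda>k. f (k div n) (k mod n)" 0 "a * n" n]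
      by (simp add: add.commute)
    also have "\<dots> = (\<Sum>b<n. f a b)"
      unfolding atLeast0LessThan by (rule sum.cong) auto
    finally show "(\<Sum>b<n. f a b) = (\<Sum>k\<in>{a * n..<a * n + n}. f (k div n) (k mod n))" by simp
  qed
  also have "\<dots> = (\<Sum>k<m * n. f (k div n) (k mod n))"
    by (rule sum.nat_group)
  finally show ?thesis by simp
qed simp

lemma index_mult_mat_sum:
  "i < dim_row A \<Longrightarrow> j < dim_col B \<Longrightarrow> dim_col A = dim_row B \<Longrightarrow>
   (A * B) $$ (i, j) = (\<Sum>k<dim_row B. A $$ (i, k) * B $$ (k, j))"
  by (simp add: scalar_prod_def atLeast0LessThan)

text \<open>The mixed-product rule: the summation index is split into quotient and remainder, which
  turns the sum into a product of two sums.\<close>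

lemma kron_mult:
  assumes "dim_col A = dim_row C" "dim_col B = dim_row D"
  shows "kron A B * kron C D = kron (A * C) (B * D)"
proof (rule eq_matI)
  fix i j
  assume "i < dim_row (kron (A * C) (B * D))" "j < dim_col (kron (A * C) (B * D))"
  then have ij: "i < dim_row A * dim_row B" "j < dim_col C * dim_col D" by simp_all
  have pos: "0 < dim_row B" "0 < dim_col D" using ij by (auto intro!: Nat.gr0I)
  have less: "i div dim_row B < dim_row A" "j div dim_col D < dim_col C"
    "i mod dim_row B < dim_row B" "j mod dim_col D < dim_col D"
    using ij pos by (simp_all add: less_mult_imp_div_less)
  have "(kron A B * kron C D) $$ (i, j) =
    (\<Sum>k<dim_row C * dim_row D.
      (A $$ (i div dim_row B, k div dim_row D) * B $$ (i mod dim_row B, k mod dim_row D)) *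
      (C $$ (k div dim_row D, j div dim_col D) * D $$ (k mod dim_row D, j mod dim_col D)))"
    using ij assms by (simp add: index_mult_mat_sum del: index_mult_mat)
  also have "\<dots> = (\<Sum>a<dim_row C. \<Sum>b<dim_row D.
      (A $$ (i div dim_row B, a) * B $$ (i mod dim_row B, b)) *
      (C $$ (a, j div dim_col D) * D $$ (b, j mod dim_col D)))"
    by (rule sum_lessThan_product)
  also have "\<dots> = (A * C) $$ (i div dim_row B, j div dim_col D) * (B * D) $$ (i mod dim_row B, j mod dim_col D)"
    using less assms
    by (simp add: index_mult_mat_sum sum_product ac_simps del: index_mult_mat)
  finally show "(kron A B * kron C D) $$ (i, j) = kron (A * C) (B * D) $$ (i, j)"
    using ij by simp
qed (simp_all)

lemma kron_one: "kron (1\<^sub>m m) (1\<^sub>m n) = 1\<^sub>m (m * n)"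
proof (rule eq_matI)
  fix i j assume "i < dim_row (1\<^sub>m (m * n) :: complex mat)" "j < dim_col (1\<^sub>m (m * n) :: complex mat)"
  then have ij: "i < m * n" "j < m * n" by simp_all
  then have "0 < n" by (auto intro!: Nat.gr0I)
  moreover have "i = j \<longleftrightarrow> i div n = j div n \<and> i mod n = j mod n" by (metis div_mult_mod_eq)
  ultimately show "kron (1\<^sub>m m) (1\<^sub>m n) $$ (i, j) = 1\<^sub>m (m * n) $$ (i, j)"
    using ij by (simp add: less_mult_imp_div_less)
qed simp_all

lemma kron_one_one [simp]: "kron (1\<^sub>m 1) A = A" "kron A (1\<^sub>m 1) = A"
  by (rule eq_matI; simp)+

section \<open>Operators on a window of neighbouring qubits\<close>

definition embed :: "nat \<Rightarrow> complex mat \<Rightarrow> nat \<Rightarrow> complex mat" where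
  "embed a M b = kron (kron (1\<^sub>m (2 ^ a)) M) (1\<^sub>m (2 ^ b))"

lemma embed_carrier [intro]:
  "M \<in> carrier_mat (2 ^ m) (2 ^ m) \<Longrightarrow> a + m + b = L \<Longrightarrow> embed a M b \<in> carrier_mat (2 ^ L) (2 ^ L)"
  unfolding embed_def by (intro carrier_matI) (auto simp: power_add)

lemma embed_mult:
  "M \<in> carrier_mat n n \<Longrightarrow> N \<in> carrier_mat n n \<Longrightarrow> embed a M b * embed a N b = embed a (M * N) b"
  unfolding embed_def by (subst kron_mult; auto simp: kron_mult)

lemma one_power_add: "(1\<^sub>m (2 ^ (a + b)) :: complex mat) = kron (1\<^sub>m (2 ^ a)) (1\<^sub>m (2 ^ b))"
  by (simp add: kron_one power_add)

lemma embed_embed: "embed a (embed c M d) b = embed (a + c) M (d + b)"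
  unfolding embed_def one_power_add by (simp add: kron_assoc)

text \<open>With \<open>c\<close> qubits between the windows, both products equal the Kronecker
  product of an operator on the left qubits and one on the right qubits.\<close>

lemma embed_commute:
  assumes "M \<in> carrier_mat (2 ^ m) (2 ^ m)" "N \<in> carrier_mat (2 ^ n) (2 ^ n)"
  shows "embed a M (c + n + b) * embed (a + m + c) N b = embed (a + m + c) N b * embed a M (c + n + b)"
proof -
  let ?X = "kron (kron (1\<^sub>m (2 ^ a)) M) (1\<^sub>m (2 ^ c))" and ?Y = "kron N (1\<^sub>m (2 ^ b))"
  have 1: "embed a M (c + n + b) = kron ?X (1\<^sub>m (2 ^ (n + b)))"
    unfolding embed_def by (simp add: kron_assoc kron_one power_add mult.assoc)
  have 2: "embed (a + m + c) N b = kron (1\<^sub>m (2 ^ (a + m + c))) ?Y"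
    unfolding embed_def by (simp add: kron_assoc)
  have X: "?X \<in> carrier_mat (2 ^ (a + m + c)) (2 ^ (a + m + c))"
    and Y: "?Y \<in> carrier_mat (2 ^ (n + b)) (2 ^ (n + b))"
    using assms by (auto simp: power_add)
  have "kron ?X (1\<^sub>m (2 ^ (n + b))) * kron (1\<^sub>m (2 ^ (a + m + c))) ?Y = kron ?X ?Y"
    using X Y by (subst kron_mult) (simp_all only: carrier_matD index_one_mat left_mult_one_mat right_mult_one_mat)
  moreover have "kron (1\<^sub>m (2 ^ (a + m + c))) ?Y * kron ?X (1\<^sub>m (2 ^ (n + b))) = kron ?X ?Y"
    using X Y by (subst kron_mult) (simp_all only: carrier_matD index_one_mat left_mult_one_mat right_mult_one_mat)
  ultimately show ?thesis unfolding 1 2 by simp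
qed

text \<open>Only column 0 counts, and column 0 of the embedded operator uses only column 0 of
  \<open>M\<close>, because every block of binary digits of the index 0 vanishes.\<close>

lemma embed_ket0:
  assumes M: "M \<in> carrier_mat (2 ^ m) (2 ^ m)" "N \<in> carrier_mat (2 ^ m) (2 ^ m)"
    and eq: "M *\<^sub>v ket0 m = N *\<^sub>v ket0 m"
  shows "embed a M b *\<^sub>v ket0 (a + m + b) = embed a N b *\<^sub>v ket0 (a + m + b)"
proof -
  have col: "(P *\<^sub>v ket0 k) $ i = P $$ (i, 0)"
    if "P \<in> carrier_mat (2 ^ k) (2 ^ k)" "i < 2 ^ k" for P k i
    using that unfolding ket0_def by (auto simp: scalar_prod_right_unit)
  have "M $$ (i, 0) = N $$ (i, 0)" if "i < 2 ^ m" for i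
    using col[OF M(1) that] col[OF M(2) that] eq by simp
  moreover have "x div 2 ^ b mod 2 ^ m < (2 ^ m :: nat)" for x :: nat by simp
  moreover have "x div 2 ^ b < 2 ^ a * 2 ^ m" if "x < 2 ^ (a + m + b)" for x :: nat
    using that by (simp add: less_mult_imp_div_less power_add)
  ultimately have "embed a M b $$ (x, 0) = embed a N b $$ (x, 0)" if "x < 2 ^ (a + m + b)" for x
    using M that unfolding embed_def by (simp add: power_add)
  then show ?thesis
    using col[OF embed_carrier[OF M(1) refl, of a b]] col[OF embed_carrier[OF M(2) refl, of a b]]
      embed_carrier[OF M(1) refl, of a b] embed_carrier[OF M(2) refl, of a b]
    by (intro eq_vecI) auto
qed

section \<open>Circuits as operators\<close>

lemma gate_at_embed: "gate_at L j U = embed (j - 1) U (L - (j + 1))"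
  by (simp add: gate_at_def embed_def)

lemma gate_at_carrier:
  assumes "U \<in> carrier_mat 4 4" "1 \<le> j" "j < L"
  shows "gate_at L j U \<in> carrier_mat (2 ^ L) (2 ^ L)"
  using embed_carrier[of U 2 "j - 1" "L - (j + 1)" L] assms by (simp add: gate_at_embed)

lemma gate_at_mult:
  "U \<in> carrier_mat 4 4 \<Longrightarrow> V \<in> carrier_mat 4 4 \<Longrightarrow> gate_at L j U * gate_at L j V = gate_at L j (U * V)"
  by (simp add: gate_at_embed embed_mult)

lemma gate_at_commute:
  assumes "U \<in> carrier_mat 4 4" "V \<in> carrier_mat 4 4" "1 \<le> i" "i + 1 < j" "j < L"
  shows "gate_at L i U * gate_at L j V = gate_at L j V * gate_at L i U"
proof -
  have e: "i - 1 + 2 + (j - i - 2) = j - 1" "j - i - 2 + 2 + (L - (j + 1)) = L - (i + 1)"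
    using assms by auto
  show ?thesis
    using embed_commute[of U 2 V 2 "i - 1" "j - i - 2" "L - (j + 1)"] assms(1,2)
    unfolding e gate_at_embed by simp
qed

text \<open>Gates at \<open>j\<close> and \<open>j + 1\<close> become operators on one window of
  three qubits, the setting in which the moves are defined.\<close>

lemma gate_at_three:
  assumes "1 \<le> j" "j + 1 < L"
  shows "gate_at L j U = embed (j - 1) (gate_at 3 1 U) (L - (j + 2))"
    "gate_at L (j + 1) U = embed (j - 1) (gate_at 3 2 U) (L - (j + 2))"
proof -
  have e: "Suc (L - (j + 2)) = L - (j + 1)" "j - 1 + 1 = j" using assms by auto
  show "gate_at L j U = embed (j - 1) (gate_at 3 1 U) (L - (j + 2))"
    unfolding gate_at_embed embed_embed using e by simp
  show "gate_at L (j + 1) U = embed (j - 1) (gate_at 3 2 U) (L - (j + 2))"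
    unfolding gate_at_embed embed_embed using e by simp
qed

definition valid :: "nat \<Rightarrow> circuit \<Rightarrow> bool" where
  "valid L C \<longleftrightarrow> (\<forall>(j, U)\<in>set C. 1 \<le> j \<and> j < L \<and> U \<in> carrier_mat 4 4)"

lemma valid_simps [simp]:
  "valid L []" "valid L ((j, U) # C) \<longleftrightarrow> 1 \<le> j \<and> j < L \<and> U \<in> carrier_mat 4 4 \<and> valid L C"
  "valid L (C @ D) \<longleftrightarrow> valid L C \<and> valid L D"
  by (auto simp: valid_def)

lemma circuit_mat_simps [simp]:
  "circuit_mat L [] = 1\<^sub>m (2 ^ L)" "circuit_mat L ((j, U) # C) = gate_at L j U * circuit_mat L C"
  by (simp_all add: circuit_mat_def)

lemma circuit_mat_carrier [intro]: "valid L C \<Longrightarrow> circuit_mat L C \<in> carrier_mat (2 ^ L) (2 ^ L)"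
proof (induction C)
  case (Cons x C)
  then show ?case
    using gate_at_carrier[of "snd x" "fst x" L] by (cases x) auto
qed simp

lemma circuit_mat_append:
  "valid L C \<Longrightarrow> valid L D \<Longrightarrow> circuit_mat L (C @ D) = circuit_mat L C * circuit_mat L D"
proof (induction C)
  case Nil
  then show ?case using circuit_mat_carrier[of L D] by simp
next
  case (Cons x C)
  obtain j U where x: "x = (j, U)" by (cases x)
  show ?case
    using Cons x gate_at_carrier[of U j L] circuit_mat_carrier[of L C] circuit_mat_carrier[of L D]
    by (auto simp: assoc_mult_mat[of _ "2 ^ L" "2 ^ L" _ "2 ^ L" _ "2 ^ L"])
qed

lemma circuit_mat_embed3:
  assumes "1 \<le> j" "j + 1 < L" "valid 3 C"
  shows "circuit_mat L (map (\<lambda>(i, U). (i + (j - 1), U)) C)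
    = embed (j - 1) (circuit_mat 3 C) (L - (j + 2))"
  using assms(3)
proof (induction C)
  case Nil
  have "j - 1 + (3 + (L - (j + 2))) = L" using assms(1,2) by simp
  then have "(2::nat) ^ L = 2 ^ (j - 1) * (2 ^ 3 * 2 ^ (L - (j + 2)))"
    by (metis power_add)
  then show ?case unfolding embed_def by (simp only: kron_one mult.assoc circuit_mat_simps list.map)
next
  case (Cons x C)
  obtain i U where x: "x = (i, U)" by (cases x)
  then have i: "i = 1 \<or> i = 2" and U: "U \<in> carrier_mat 4 4" and C: "valid 3 C"
    using Cons.prems by auto
  have "gate_at L (i + (j - 1)) U = embed (j - 1) (gate_at 3 i U) (L - (j + 2))"
    using i gate_at_three[OF assms(1,2), of U] assms(1) by auto
  moreover have "gate_at 3 i U \<in> carrier_mat (2 ^ 3) (2 ^ 3)"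
    using gate_at_carrier[OF U, of i 3] i by auto
  ultimately show ?case
    using Cons.IH[OF C] x embed_mult circuit_mat_carrier[OF C] by simp
qed

lemma exchange_circuit_mat:
  assumes "exchange C C'" "valid L C"
  shows "valid L C'" "circuit_mat L C = circuit_mat L C'"
proof -
  obtain C1 C2 j g j' g' where d: "{j, j + 1} \<inter> {j', j' + 1} = {}"
    and C: "C = C1 @ [(j, g), (j', g')] @ C2" "C' = C1 @ [(j', g'), (j, g)] @ C2"
    using assms(1) unfolding exchange_def by blast
  show v: "valid L C'" using assms(2) C by auto
  have "j + 1 < j' \<or> j' + 1 < j" using d by auto
  then have "gate_at L j g * gate_at L j' g' = gate_at L j' g' * gate_at L j g"
    using gate_at_commute[of g g' j j' L] gate_at_commute[of g' g j' j L] assms(2) C by auto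
  moreover have "gate_at L j g \<in> carrier_mat (2 ^ L) (2 ^ L)" "gate_at L j' g' \<in> carrier_mat (2 ^ L) (2 ^ L)"
    "circuit_mat L C2 \<in> carrier_mat (2 ^ L) (2 ^ L)"
    using assms(2) C by (auto intro!: gate_at_carrier)
  ultimately have "circuit_mat L ([(j, g), (j', g')] @ C2) = circuit_mat L ([(j', g'), (j, g)] @ C2)"
    using assoc_mult_mat[of _ "2 ^ L" "2 ^ L" _ "2 ^ L" "circuit_mat L C2" "2 ^ L"]
    by (metis append_Cons append_Nil circuit_mat_simps(2))
  then show "circuit_mat L C = circuit_mat L C'"
    using assms(2) v unfolding C by (subst (1 2) circuit_mat_append) auto
qed

lemma same_circuit_mat:
  assumes "C \<approx> C'" "valid L C"
  shows "valid L C' \<and> circuit_mat L C = circuit_mat L C'"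
  using assms unfolding same_circuit_def
proof (induction rule: rtranclp_induct)
  case (step y z)
  then show ?case using exchange_circuit_mat[of y z L] by auto
qed simp

lemma circuit_mat_replace:
  assumes "valid L C1" "valid L M" "valid L M'" "valid L C2" "circuit_mat L M = circuit_mat L M'"
  shows "circuit_mat L (C1 @ M @ C2) = circuit_mat L (C1 @ M' @ C2)"
  using assms by (simp add: circuit_mat_append)

lemma embed_untouched_commute:
  assumes "untouched j C" "valid L C" "1 \<le> j" "j + 1 < L" "M \<in> carrier_mat (2 ^ 3) (2 ^ 3)"
  shows "embed (j - 1) M (L - (j + 2)) * circuit_mat L C = circuit_mat L C * embed (j - 1) M (L - (j + 2))"
  using assms(1,2)
proof (induction C)
  case Nil
  have "embed (j - 1) M (L - (j + 2)) \<in> carrier_mat (2 ^ L) (2 ^ L)"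
    by (rule embed_carrier[OF assms(5)]) (use assms(3,4) in simp)
  then show ?case by simp
next
  case (Cons x C)
  obtain i U where x: "x = (i, U)" by (cases x)
  have C: "untouched j C" "valid L C" using Cons.prems x by (auto simp: untouched_def)
  have i: "1 \<le> i" "i < L" "U \<in> carrier_mat 4 4" "i + 1 < j \<or> j + 2 < i"
    using Cons.prems x by (auto simp: untouched_def)
  let ?E = "embed (j - 1) M (L - (j + 2))"
  have E: "?E \<in> carrier_mat (2 ^ L) (2 ^ L)"
    by (rule embed_carrier[OF assms(5)]) (use assms(3,4) in simp)
  have G: "gate_at L i U \<in> carrier_mat (2 ^ L) (2 ^ L)" using i by (auto intro: gate_at_carrier)
  have "?E * gate_at L i U = gate_at L i U * ?E"
  proof (cases "i + 1 < j")
    case True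
    have e: "i - 1 + 2 + (j - i - 2) = j - 1" "j - i - 2 + 3 + (L - (j + 2)) = L - (i + 1)"
      using True i assms(4) by auto
    show ?thesis
      using embed_commute[of U 2 M 3 "i - 1" "j - i - 2" "L - (j + 2)"] i assms(5)
      unfolding e gate_at_embed by simp
  next
    case False
    then have e: "j - 1 + 3 + (i - j - 3) = i - 1" "i - j - 3 + 2 + (L - (i + 1)) = L - (j + 2)"
      using i assms(3) by auto
    show ?thesis
      using embed_commute[of M 3 U 2 "j - 1" "i - j - 3" "L - (i + 1)"] i assms(5)
      unfolding e gate_at_embed by simp
  qed
  then show ?case
    using Cons.IH[OF C] x assoc_mult_mat[OF E G circuit_mat_carrier[OF C(2)]]
      assoc_mult_mat[OF G E circuit_mat_carrier[OF C(2)]]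
      assoc_mult_mat[OF G circuit_mat_carrier[OF C(2)] E] by simp
qed

text \<open>A left-right identity holds only on the zero state, so the window is first commuted past
  \<open>C\<close>, no gate of which touches it.\<close>

lemma embed_circuit_ket0:
  assumes "untouched j C" "valid L C" "1 \<le> j" "j + 1 < L"
    and M: "M \<in> carrier_mat (2 ^ 3) (2 ^ 3)" "N \<in> carrier_mat (2 ^ 3) (2 ^ 3)"
    and eq: "M *\<^sub>v ket0 3 = N *\<^sub>v ket0 3"
  shows "(embed (j - 1) M (L - (j + 2)) * circuit_mat L C) *\<^sub>v ket0 L
       = (embed (j - 1) N (L - (j + 2)) * circuit_mat L C) *\<^sub>v ket0 L"
proof -
  let ?E = "\<lambda>M. embed (j - 1) M (L - (j + 2))"
  have L: "j - 1 + 3 + (L - (j + 2)) = L" using assms(3,4) by auto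
  have E: "?E P \<in> carrier_mat (2 ^ L) (2 ^ L)" if "P \<in> carrier_mat (2 ^ 3) (2 ^ 3)" for P
    by (rule embed_carrier[OF that L])
  have k: "ket0 L \<in> carrier_vec (2 ^ L)" by (simp add: ket0_def)
  have "?E M *\<^sub>v ket0 L = ?E N *\<^sub>v ket0 L"
    using embed_ket0[OF M eq, of "j - 1" "L - (j + 2)"] unfolding L .
  then show ?thesis
    unfolding embed_untouched_commute[OF assms(1-4) M(1)] embed_untouched_commute[OF assms(1-4) M(2)]
    using E[OF M(1)] E[OF M(2)] circuit_mat_carrier[OF assms(2)] k
    by (simp add: assoc_mult_mat_vec[of _ "2 ^ L" "2 ^ L" _ "2 ^ L"])
qed

section \<open>Matchgates on three qubits\<close>

lemma less_4_cases: "i < 4 \<longleftrightarrow> i = 0 \<or> i = 1 \<or> i = 2 \<or> i = (3::nat)"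
  by auto

lemma less_8_cases: "i < 8 \<longleftrightarrow> i = 0 \<or> i = 1 \<or> i = 2 \<or> i = 3 \<or> i = 4 \<or> i = 5 \<or> i = 6 \<or> i = (7::nat)"
  by auto

lemma sum_lessThan_2: "sum f {..<2::nat} = f 0 + f 1"
  by (simp add: eval_nat_numeral)

lemma sum_lessThan_4: "sum f {..<4::nat} = f 0 + f 1 + f 2 + f 3"
  by (simp add: eval_nat_numeral)

lemma sum_lessThan_8: "sum f {..<8::nat} = f 0 + f 1 + f 2 + f 3 + f 4 + f 5 + f 6 + f 7"
  by (simp add: eval_nat_numeral)

section \<open>Determinants and unitarity in terms of entries\<close>

definition mat2 :: "complex \<Rightarrow> complex \<Rightarrow> complex \<Rightarrow> complex \<Rightarrow> complex mat" where
  "mat2 a b c d = mat 2 2 (\<lambda>(i, j). if i = 0 then (if j = 0 then a else b) else (if j = 0 then c else d))"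

lemma mat2_carrier [simp]: "mat2 a b c d \<in> carrier_mat 2 2"
  by (simp add: mat2_def)

lemma mat2_index [simp]:
  "mat2 a b c d $$ (0, 0) = a" "mat2 a b c d $$ (0, Suc 0) = b"
  "mat2 a b c d $$ (Suc 0, 0) = c" "mat2 a b c d $$ (Suc 0, Suc 0) = d"
  by (simp_all add: mat2_def)

text \<open>Laplace expansion along column 0, with the minors again written as \<open>mat\<close>,
  so that rewriting computes determinants of small explicit size.\<close>

lemma det_mat_Suc:
  fixes f :: "nat \<times> nat \<Rightarrow> complex"
  shows "det (mat (Suc n) (Suc n) f) =
    (\<Sum>i<Suc n. f (i, 0) * ((-1) ^ i * det (mat n n (\<lambda>(a, b). f (if a < i then a else Suc a, Suc b)))))"
proof -
  have "mat_delete (mat (Suc n) (Suc n) f) i 0 = mat n n (\<lambda>(a, b). f (if a < i then a else Suc a, Suc b))"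
    if "i < Suc n" for i
    unfolding mat_delete_def using that by (intro eq_matI) auto
  then show ?thesis
    by (subst laplace_expansion_column[of _ "Suc n" 0]) (auto simp: cofactor_def intro!: sum.cong)
qed

lemma det_2:
  assumes "(A :: complex mat) \<in> carrier_mat 2 2"
  shows "det A = A $$ (0, 0) * A $$ (1, 1) - A $$ (0, 1) * A $$ (1, 0)"
proof -
  have "A = mat (Suc (Suc 0)) (Suc (Suc 0)) (\<lambda>ij. A $$ ij)" using assms by (intro eq_matI) auto
  then have "det A = det (mat (Suc (Suc 0)) (Suc (Suc 0)) (\<lambda>ij. A $$ ij))" by simp
  then show ?thesis unfolding det_mat_Suc by simp
qed

lemma det_mat2 [simp]: "det (mat2 a b c d) = a * d - b * c"
  by (subst det_2) (auto simp: mat2_def)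

lemma adjoint_index:
  "i < dim_col A \<Longrightarrow> j < dim_row A \<Longrightarrow> mat_adjoint A $$ (i, j) = cnj (A $$ (j, i))"
  unfolding mat_adjoint_def by (simp add: mat_of_rows_def)

lemma adjoint_dims [simp]: "dim_row (mat_adjoint A) = dim_col A" "dim_col (mat_adjoint A) = dim_row A"
  unfolding mat_adjoint_def by simp_all

lemma unitary_mat_iff:
  assumes "A \<in> carrier_mat n n"
  shows "unitary_mat A \<longleftrightarrow>
    (\<forall>i<n. \<forall>j<n. (\<Sum>k<n. cnj (A $$ (k, i)) * A $$ (k, j)) = (if i = j then 1 else 0))"
    (is "_ \<longleftrightarrow> ?R")
proof -
  have adj: "mat_adjoint A \<in> carrier_mat n n" using assms by (intro carrier_matI) auto
  have entry: "(mat_adjoint A * A) $$ (i, j) = (\<Sum>k<n. cnj (A $$ (k, i)) * A $$ (k, j))"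
    if "i < n" "j < n" for i j
    using that assms adj by (simp add: index_mult_mat_sum adjoint_index del: index_mult_mat)
  have "mat_adjoint A * A = 1\<^sub>m n \<longleftrightarrow> ?R"
  proof
    assume eq: "mat_adjoint A * A = 1\<^sub>m n"
    show ?R
    proof (intro allI impI)
      fix i j assume ij: "i < n" "j < n"
      show "(\<Sum>k<n. cnj (A $$ (k, i)) * A $$ (k, j)) = (if i = j then 1 else 0)"
        unfolding entry[OF ij, symmetric] eq using ij by simp
    qed
  next
    assume R: ?R
    show "mat_adjoint A * A = 1\<^sub>m n"
    proof (rule eq_matI)
      fix i j assume "i < dim_row (1\<^sub>m n :: complex mat)" "j < dim_col (1\<^sub>m n :: complex mat)"
      then have ij: "i < n" "j < n" by simp_all
      show "(mat_adjoint A * A) $$ (i, j) = 1\<^sub>m n $$ (i, j)"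
        unfolding entry[OF ij] using R ij by simp
    qed (use assms in auto)
  qed
  moreover have "mat_adjoint A * A = 1\<^sub>m n \<Longrightarrow> A * mat_adjoint A = 1\<^sub>m n"
    using mat_mult_left_right_inverse[OF adj assms] by simp
  ultimately show ?thesis
    unfolding unitary_mat_def square_mat.simps carrier_matD[OF assms] by blast
qed

lemma unitary_rows:
  assumes "A \<in> carrier_mat n n" "unitary_mat A" "i < n" "j < n"
  shows "(\<Sum>k<n. A $$ (i, k) * cnj (A $$ (j, k))) = (if i = j then 1 else 0)"
proof -
  have "A * mat_adjoint A = 1\<^sub>m n" using assms unfolding unitary_mat_def by simp
  then have "(A * mat_adjoint A) $$ (i, j) = 1\<^sub>m n $$ (i, j)" by simp
  then show ?thesis using assms
    by (simp add: index_mult_mat_sum adjoint_index del: index_mult_mat)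
qed

lemma unitary_mult:
  assumes "A \<in> carrier_mat n n" "B \<in> carrier_mat n n" "unitary_mat A" "unitary_mat B"
  shows "unitary_mat (A * B)"
  unfolding unitary_mat_iff[OF mult_carrier_mat[OF assms(1,2)]]
proof (intro allI impI)
  fix i j assume ij: "i < n" "j < n"
  have A: "(\<Sum>k<n. cnj (A $$ (k, l)) * A $$ (k, m)) = (if l = m then 1 else 0)" if "l < n" "m < n" for l m
    using assms(3) that unfolding unitary_mat_iff[OF assms(1)] by blast
  have B: "(\<Sum>k<n. cnj (B $$ (k, i)) * B $$ (k, j)) = (if i = j then 1 else 0)"
    using assms(4) ij unfolding unitary_mat_iff[OF assms(2)] by blast
  have "(\<Sum>k<n. cnj ((A * B) $$ (k, i)) * (A * B) $$ (k, j)) =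
     (\<Sum>k<n. (\<Sum>l<n. cnj (A $$ (k, l)) * cnj (B $$ (l, i))) * (\<Sum>m<n. A $$ (k, m) * B $$ (m, j)))"
    using assms(1,2) ij by (intro sum.cong) (auto simp: index_mult_mat_sum simp del: index_mult_mat)
  also have "\<dots> = (\<Sum>k<n. \<Sum>l<n. \<Sum>m<n. cnj (B $$ (l, i)) * B $$ (m, j) * (cnj (A $$ (k, l)) * A $$ (k, m)))"
    unfolding sum_product by (intro sum.cong refl) simp
  also have "\<dots> = (\<Sum>l<n. \<Sum>k<n. \<Sum>m<n. cnj (B $$ (l, i)) * B $$ (m, j) * (cnj (A $$ (k, l)) * A $$ (k, m)))"
    by (rule sum.swap)
  also have "\<dots> = (\<Sum>l<n. \<Sum>m<n. \<Sum>k<n. cnj (B $$ (l, i)) * B $$ (m, j) * (cnj (A $$ (k, l)) * A $$ (k, m)))"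
    by (intro sum.cong refl sum.swap)
  also have "\<dots> = (\<Sum>l<n. \<Sum>m<n. cnj (B $$ (l, i)) * B $$ (m, j) * (if l = m then 1 else 0))"
    by (intro sum.cong refl) (simp add: A flip: sum_distrib_left)
  also have "\<dots> = (\<Sum>l<n. cnj (B $$ (l, i)) * B $$ (l, j))"
    by (intro sum.cong refl) (simp add: if_distrib[of "\<lambda>z. _ * z"] cong: if_cong)
  finally show "(\<Sum>k<n. cnj ((A * B) $$ (k, i)) * (A * B) $$ (k, j)) = (if i = j then 1 else 0)"
    using B by simp
qed

text \<open>The inverse of a unitary matrix is both its adjoint and its adjugate divided by the
  determinant; the entries are compared.\<close>

lemma unitary2_relations:
  assumes "A \<in> carrier_mat 2 2" "unitary_mat A"
  shows "det A * cnj (A $$ (0, 0)) = A $$ (1, 1)" "det A * cnj (A $$ (1, 1)) = A $$ (0, 0)"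
    "det A * cnj (A $$ (0, 1)) = - A $$ (1, 0)" "det A * cnj (A $$ (1, 0)) = - A $$ (0, 1)"
    "det A * cnj (det A) = 1"
proof -
  have d: "det A = A $$ (0, 0) * A $$ (1, 1) - A $$ (0, 1) * A $$ (1, 0)"
    using det_2[OF assms(1)] .
  have r: "A $$ (0, 0) * cnj (A $$ (0, 0)) + A $$ (0, 1) * cnj (A $$ (0, 1)) = 1"
    "A $$ (1, 0) * cnj (A $$ (1, 0)) + A $$ (1, 1) * cnj (A $$ (1, 1)) = 1"
    "A $$ (0, 0) * cnj (A $$ (1, 0)) + A $$ (0, 1) * cnj (A $$ (1, 1)) = 0"
    "A $$ (1, 0) * cnj (A $$ (0, 0)) + A $$ (1, 1) * cnj (A $$ (0, 1)) = 0"
    using unitary_rows[OF assms, of 0 0] unitary_rows[OF assms, of 1 1]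
      unitary_rows[OF assms, of 0 1] unitary_rows[OF assms, of 1 0] by (simp_all add: sum_lessThan_2)
  define a b c e where abce: "a = A $$ (0, 0)" "b = A $$ (0, 1)" "c = A $$ (1, 0)" "e = A $$ (1, 1)"
  note r' = r[folded abce]
  have "(a * e - b * c) * cnj a = e * (a * cnj a + b * cnj b) - b * (c * cnj a + e * cnj b)"
    "(a * e - b * c) * cnj e = a * (c * cnj c + e * cnj e) - c * (a * cnj c + b * cnj e)"
    "(a * e - b * c) * cnj b = a * (c * cnj a + e * cnj b) - c * (a * cnj a + b * cnj b)"
    "(a * e - b * c) * cnj c = e * (a * cnj c + b * cnj e) - b * (c * cnj c + e * cnj e)"
    by (simp_all add: algebra_simps)
  then have *: "det A * cnj a = e" "det A * cnj e = a" "det A * cnj b = - c" "det A * cnj c = - b"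
    unfolding r' d[folded abce] by simp_all
  then show "det A * cnj (A $$ (0, 0)) = A $$ (1, 1)" "det A * cnj (A $$ (1, 1)) = A $$ (0, 0)"
    "det A * cnj (A $$ (0, 1)) = - A $$ (1, 0)" "det A * cnj (A $$ (1, 0)) = - A $$ (0, 1)"
    unfolding abce .
  have "cnj (det A) = cnj a * cnj e - cnj b * cnj c"
    unfolding d[folded abce] by simp
  then have "det A * cnj (det A) = det A * cnj a * cnj e - det A * cnj b * cnj c"
    by (simp only: right_diff_distrib mult.assoc)
  then show "det A * cnj (det A) = 1"
    unfolding * using r'(2) by (simp add: algebra_simps)
qed

text \<open>In the order \<open>|000>, |011>, |101>, |110>\<close> of the even states, a gate on
  qubits 2 and 3 keeps the first qubit and acts by \<open>A\<close> on the first pair and by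
  \<open>B\<close> on the second. A gate on qubits 1 and 2 acts in this order by
  \<open>G_mat A B\<close> itself.\<close>

definition Q_mat :: "complex mat \<Rightarrow> complex mat \<Rightarrow> complex mat" where
  "Q_mat A B = mat_of_rows_list 4
     [[A $$ (0,0), A $$ (0,1),           0,           0],
      [A $$ (1,0), A $$ (1,1),           0,           0],
      [          0,           0, B $$ (0,0), B $$ (0,1)],
      [          0,           0, B $$ (1,0), B $$ (1,1)]]"

lemma GQ_carrier [simp]: "G_mat A B \<in> carrier_mat 4 4" "Q_mat A B \<in> carrier_mat 4 4"
  by (auto intro!: carrier_matI simp: G_mat_def Q_mat_def mat_of_rows_list_def)

lemma G_mat_index:
  "i < 4 \<Longrightarrow> j < 4 \<Longrightarrow> G_mat A B $$ (i, j) =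
    (if i \<in> {0, 3} \<and> j \<in> {0, 3} then A $$ (i div 3, j div 3)
     else if i \<in> {1, 2} \<and> j \<in> {1, 2} then B $$ (i - 1, j - 1) else 0)"
  unfolding less_4_cases by (elim disjE; simp add: G_mat_def mat_of_rows_list_def)

lemma Q_mat_index:
  "i < 4 \<Longrightarrow> j < 4 \<Longrightarrow> Q_mat A B $$ (i, j) =
    (if i \<le> 1 \<and> j \<le> 1 then A $$ (i, j)
     else if 2 \<le> i \<and> 2 \<le> j then B $$ (i - 2, j - 2) else 0)"
  unfolding less_4_cases by (elim disjE; simp add: Q_mat_def mat_of_rows_list_def)

text \<open>
  A matchgate on three qubits preserves the parity. On the even states
  \<open>|000\<rangle>, |011\<rangle>, |101\<rangle>, |110\<rangle>\<close> it acts as a \<open>4 \<times> 4\<close> matrix \<open>M\<close>, and the unitarity of its two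
  blocks, with common determinant \<open>d\<close>, expresses the action on the complementary odd states by
  the conjugate of \<open>M\<close>. The basis states of index \<open>x\<close> and \<open>7 - x\<close> are complementary.
\<close>

definition even_state :: "nat \<Rightarrow> bool" where
  "even_state x \<longleftrightarrow> x \<in> {0, 3, 5, 6}"

text \<open>Dropping the last binary digit, \<open>x div 2\<close> numbers the even states 0, 3, 5,
  6 from 0 to 3. The sign is that of the cofactors in \<open>unitary2_relations\<close>.\<close>

definition parity_mat :: "complex \<Rightarrow> complex mat \<Rightarrow> complex mat" where
  "parity_mat d M = mat 8 8 (\<lambda>(x, y).
     if even_state x \<and> even_state y then M $$ (x div 2, y div 2)
     else if \<not> even_state x \<and> \<not> even_state y then
       d * (-1) ^ ((7 - x) div 2 + (7 - y) div 2) * cnj (M $$ ((7 - x) div 2, (7 - y) div 2))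
     else 0)"

lemma parity_mat_dims [simp]: "dim_row (parity_mat d M) = 8" "dim_col (parity_mat d M) = 8"
  by (simp_all add: parity_mat_def)

text \<open>Conjugation is multiplicative, and the sign of each intermediate state occurs twice and
  cancels.\<close>

lemma parity_mat_mult:
  assumes "M \<in> carrier_mat 4 4" "N \<in> carrier_mat 4 4"
  shows "parity_mat d M * parity_mat d' N = parity_mat (d * d') (M * N)"
proof (rule eq_matI)
  fix x y
  assume "x < dim_row (parity_mat (d * d') (M * N))" "y < dim_col (parity_mat (d * d') (M * N))"
  then have xy: "x < 8" "y < 8" by simp_all
  have MN: "(M * N) $$ (i, j) = (\<Sum>k<4. M $$ (i, k) * N $$ (k, j))" if "i < 4" "j < 4" for i j
    using assms that by (simp add: index_mult_mat_sum del: index_mult_mat)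
  have even_numerals: "even_state 0" "\<not> even_state 1" "\<not> even_state (Suc 0)" "\<not> even_state 2"
    "even_state 3" "\<not> even_state 4" "even_state 5" "even_state 6" "\<not> even_state 7"
    by (simp_all add: even_state_def)
  have "(parity_mat d M * parity_mat d' N) $$ (x, y)
     = (\<Sum>k<8. parity_mat d M $$ (x, k) * parity_mat d' N $$ (k, y))"
    using xy by (simp add: index_mult_mat_sum del: index_mult_mat)
  also have "\<dots> = parity_mat (d * d') (M * N) $$ (x, y)"
  proof (cases "even_state x"; cases "even_state y")
    assume "even_state x" "even_state y"
    then show ?thesis using xy unfolding sum_lessThan_8
      by (simp add: parity_mat_def even_numerals MN sum_lessThan_4)
  next
    assume "even_state x" "\<not> even_state y"
    then show ?thesis using xy unfolding sum_lessThan_8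
      by (simp add: parity_mat_def even_numerals)
  next
    assume "\<not> even_state x" "even_state y"
    then show ?thesis using xy unfolding sum_lessThan_8
      by (simp add: parity_mat_def even_numerals)
  next
    assume "\<not> even_state x" "\<not> even_state y"
    moreover have "(7 - x) div 2 < 4" "(7 - y) div 2 < 4" by simp_all
    ultimately show ?thesis using xy unfolding sum_lessThan_8
      by (simp add: parity_mat_def even_numerals MN sum_lessThan_4 power_add)
         (simp add: algebra_simps)
  qed
  finally show "(parity_mat d M * parity_mat d' N) $$ (x, y) = parity_mat (d * d') (M * N) $$ (x, y)" .
qed simp_all

lemma gate_at_3:
  shows "gate_at 3 1 U = kron U (1\<^sub>m 2)" "gate_at 3 2 U = kron (1\<^sub>m 2) U"
proof -
  show "gate_at 3 1 U = kron U (1\<^sub>m 2)"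
    using kron_one_one(1) by (simp add: gate_at_def)
  show "gate_at 3 2 U = kron (1\<^sub>m 2) U"
    using kron_one_one(2) by (simp add: gate_at_def)
qed

text \<open>Equality of the two determinants is what lets one scalar govern both blocks on the odd
  states.\<close>

lemma gate_1_parity:
  assumes "A \<in> carrier_mat 2 2" "B \<in> carrier_mat 2 2" "unitary_mat A" "unitary_mat B" "det A = det B"
  shows "gate_at 3 1 (G_mat A B) = parity_mat (det A) (G_mat A B)"
proof (rule eq_matI)
  fix x y
  assume "x < dim_row (parity_mat (det A) (G_mat A B))" "y < dim_col (parity_mat (det A) (G_mat A B))"
  then have "x < 8" "y < 8" by simp_all
  then show "gate_at 3 1 (G_mat A B) $$ (x, y) = parity_mat (det A) (G_mat A B) $$ (x, y)"
    unfolding gate_at_3 less_8_cases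
    using unitary2_relations[OF assms(1,3)] unitary2_relations[OF assms(2,4)] assms(5)
    by (elim disjE; simp add: parity_mat_def even_state_def G_mat_index carrier_matD[OF GQ_carrier(1)])
qed (simp_all only: gate_at_3 dim_kron carrier_matD[OF GQ_carrier(1)] parity_mat_dims, simp_all)

lemma gate_2_parity:
  assumes "A \<in> carrier_mat 2 2" "B \<in> carrier_mat 2 2" "unitary_mat A" "unitary_mat B" "det A = det B"
  shows "gate_at 3 2 (G_mat A B) = parity_mat (det A) (Q_mat A B)"
proof (rule eq_matI)
  fix x y
  assume "x < dim_row (parity_mat (det A) (Q_mat A B))" "y < dim_col (parity_mat (det A) (Q_mat A B))"
  then have "x < 8" "y < 8" by simp_all
  then show "gate_at 3 2 (G_mat A B) $$ (x, y) = parity_mat (det A) (Q_mat A B) $$ (x, y)"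
    unfolding gate_at_3 less_8_cases
    using unitary2_relations[OF assms(1,3)] unitary2_relations[OF assms(2,4)] assms(5)
    by (elim disjE; simp add: parity_mat_def even_state_def G_mat_index Q_mat_index carrier_matD[OF GQ_carrier(1)])
qed (simp_all only: gate_at_3 dim_kron carrier_matD[OF GQ_carrier(1)] parity_mat_dims, simp_all)

section \<open>Decomposition of unitary matrices of dimension four\<close>

lemma G_mat_eqI:
  assumes "M \<in> carrier_mat 4 4"
    "M $$ (0,1) = 0" "M $$ (0,2) = 0" "M $$ (1,0) = 0" "M $$ (2,0) = 0"
    "M $$ (3,1) = 0" "M $$ (3,2) = 0" "M $$ (1,3) = 0" "M $$ (2,3) = 0"
  shows "M = G_mat (mat2 (M $$ (0,0)) (M $$ (0,3)) (M $$ (3,0)) (M $$ (3,3)))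
    (mat2 (M $$ (1,1)) (M $$ (1,2)) (M $$ (2,1)) (M $$ (2,2)))" (is "M = ?G")
proof (rule eq_matI)
  fix i j assume "i < dim_row ?G" "j < dim_col ?G"
  then have "i < 4" "j < 4" using carrier_matD[OF GQ_carrier(1)] by metis+
  then show "M $$ (i, j) = ?G $$ (i, j)"
    unfolding less_4_cases using assms(2-) by (elim disjE; simp add: G_mat_index)
qed (use assms carrier_matD[OF GQ_carrier(1)] in auto)

lemma Q_mult_left:
  assumes "M \<in> carrier_mat 4 4" "j < 4"
  shows "(Q_mat A B * M) $$ (0, j) = A $$ (0,0) * M $$ (0,j) + A $$ (0,1) * M $$ (1,j)"
    "(Q_mat A B * M) $$ (1, j) = A $$ (1,0) * M $$ (0,j) + A $$ (1,1) * M $$ (1,j)"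
    "(Q_mat A B * M) $$ (2, j) = B $$ (0,0) * M $$ (2,j) + B $$ (0,1) * M $$ (3,j)"
    "(Q_mat A B * M) $$ (3, j) = B $$ (1,0) * M $$ (2,j) + B $$ (1,1) * M $$ (3,j)"
  using assms carrier_matD[OF GQ_carrier(2), of A B]
  by (simp_all add: index_mult_mat_sum sum_lessThan_4 Q_mat_index del: index_mult_mat)

lemma Q_mult_right:
  assumes "M \<in> carrier_mat 4 4" "i < 4"
  shows "(M * Q_mat A B) $$ (i, 0) = M $$ (i,0) * A $$ (0,0) + M $$ (i,1) * A $$ (1,0)"
    "(M * Q_mat A B) $$ (i, 1) = M $$ (i,0) * A $$ (0,1) + M $$ (i,1) * A $$ (1,1)"
    "(M * Q_mat A B) $$ (i, 2) = M $$ (i,2) * B $$ (0,0) + M $$ (i,3) * B $$ (1,0)"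
    "(M * Q_mat A B) $$ (i, 3) = M $$ (i,2) * B $$ (0,1) + M $$ (i,3) * B $$ (1,1)"
  using assms carrier_matD[OF GQ_carrier(2), of A B]
  by (simp_all add: index_mult_mat_sum sum_lessThan_4 Q_mat_index del: index_mult_mat)

lemma mult2_index:
  assumes "(A :: complex mat) \<in> carrier_mat 2 2" "C \<in> carrier_mat 2 2" "i < 2" "j < 2"
  shows "(A * C) $$ (i, j) = A $$ (i,0) * C $$ (0,j) + A $$ (i,1) * C $$ (1,j)"
  using assms by (simp add: index_mult_mat_sum sum_lessThan_2 del: index_mult_mat)

lemma Q_mult:
  assumes "A \<in> carrier_mat 2 2" "B \<in> carrier_mat 2 2" "C \<in> carrier_mat 2 2" "D \<in> carrier_mat 2 2"
  shows "Q_mat A B * Q_mat C D = Q_mat (A * C) (B * D)"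
proof (rule eq_matI)
  fix i j assume "i < dim_row (Q_mat (A * C) (B * D))" "j < dim_col (Q_mat (A * C) (B * D))"
  then have ij: "i < 4" "j < 4" using carrier_matD[OF GQ_carrier(2)] by metis+
  then show "(Q_mat A B * Q_mat C D) $$ (i, j) = Q_mat (A * C) (B * D) $$ (i, j)"
    unfolding less_4_cases
    by (elim disjE; simp add: Q_mult_left[simplified] Q_mat_index mult2_index[OF assms(1,3)] mult2_index[OF assms(2,4)]
        del: index_mult_mat)
qed (use carrier_matD[OF GQ_carrier(2)] in auto)

lemma G_mult:
  assumes "A \<in> carrier_mat 2 2" "B \<in> carrier_mat 2 2" "C \<in> carrier_mat 2 2" "D \<in> carrier_mat 2 2"
  shows "G_mat A B * G_mat C D = G_mat (A * C) (B * D)"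
proof (rule eq_matI)
  fix i j assume "i < dim_row (G_mat (A * C) (B * D))" "j < dim_col (G_mat (A * C) (B * D))"
  then have ij: "i < 4" "j < 4" using carrier_matD[OF GQ_carrier(1)] by metis+
  have "(G_mat A B * G_mat C D) $$ (i, j) = (\<Sum>k<4. G_mat A B $$ (i, k) * G_mat C D $$ (k, j))"
    using ij carrier_matD[OF GQ_carrier(1)] by (simp add: index_mult_mat_sum del: index_mult_mat)
  also have "\<dots> = G_mat (A * C) (B * D) $$ (i, j)"
    using ij unfolding less_4_cases sum_lessThan_4
    by (elim disjE; simp add: G_mat_index mult2_index[OF assms(1,3)] mult2_index[OF assms(2,4)] del: index_mult_mat)
  finally show "(G_mat A B * G_mat C D) $$ (i, j) = G_mat (A * C) (B * D) $$ (i, j)" .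
qed (use carrier_matD[OF GQ_carrier(1)] in auto)

lemma unitary2_iff:
  assumes "A \<in> carrier_mat 2 2"
  shows "unitary_mat A \<longleftrightarrow>
     cnj (A $$ (0,0)) * A $$ (0,0) + cnj (A $$ (1,0)) * A $$ (1,0) = 1 \<and>
     cnj (A $$ (0,1)) * A $$ (0,1) + cnj (A $$ (1,1)) * A $$ (1,1) = 1 \<and>
     cnj (A $$ (0,0)) * A $$ (0,1) + cnj (A $$ (1,0)) * A $$ (1,1) = 0 \<and>
     cnj (A $$ (0,1)) * A $$ (0,0) + cnj (A $$ (1,1)) * A $$ (1,0) = 0"
  unfolding unitary_mat_iff[OF assms] sum_lessThan_2 by (auto simp: less_2_cases_iff)

lemma unitary_G_iff:
  assumes "A \<in> carrier_mat 2 2" "B \<in> carrier_mat 2 2"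
  shows "unitary_mat (G_mat A B) \<longleftrightarrow> unitary_mat A \<and> unitary_mat B"
  unfolding unitary_mat_iff[OF GQ_carrier(1)] unitary2_iff[OF assms(1)] unitary2_iff[OF assms(2)]
    less_4_cases sum_lessThan_4
  by (simp add: all_conj_distrib imp_disjL imp_conjR G_mat_index) blast

lemma unitary_Q:
  assumes "A \<in> carrier_mat 2 2" "B \<in> carrier_mat 2 2" "unitary_mat A" "unitary_mat B"
  shows "unitary_mat (Q_mat A B)"
  using assms(3,4)
  unfolding unitary_mat_iff[OF GQ_carrier(2)] unitary2_iff[OF assms(1)] unitary2_iff[OF assms(2)]
    less_4_cases sum_lessThan_4
  by (simp add: all_conj_distrib imp_disjL imp_conjR Q_mat_index)

lemma det_G:
  assumes "A \<in> carrier_mat 2 2" "B \<in> carrier_mat 2 2"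
  shows "det (G_mat A B) = det A * det B"
proof -
  have "G_mat A B = mat 4 4 (\<lambda>ij. G_mat A B $$ ij)"
    using carrier_matD[OF GQ_carrier(1)] by (intro eq_matI) auto
  then have "det (G_mat A B) = det (mat (Suc (Suc (Suc (Suc 0)))) (Suc (Suc (Suc (Suc 0)))) (\<lambda>ij. G_mat A B $$ ij))"
    by (simp add: eval_nat_numeral)
  also have "\<dots> = det A * det B"
    unfolding det_mat_Suc det_2[OF assms(1)] det_2[OF assms(2)]
    by (simp add: G_mat_index) (simp add: algebra_simps)
  finally show ?thesis .
qed

lemma det_Q:
  assumes "A \<in> carrier_mat 2 2" "B \<in> carrier_mat 2 2"
  shows "det (Q_mat A B) = det A * det B"
proof -
  have "Q_mat A B = mat 4 4 (\<lambda>ij. Q_mat A B $$ ij)"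
    using carrier_matD[OF GQ_carrier(2)] by (intro eq_matI) auto
  then have "det (Q_mat A B) = det (mat (Suc (Suc (Suc (Suc 0)))) (Suc (Suc (Suc (Suc 0)))) (\<lambda>ij. Q_mat A B $$ ij))"
    by (simp add: eval_nat_numeral)
  also have "\<dots> = det A * det B"
    unfolding det_mat_Suc det_2[OF assms(1)] det_2[OF assms(2)]
    by (simp add: Q_mat_index) (simp add: algebra_simps)
  finally show ?thesis .
qed

section \<open>Rotations in SU(2)\<close>

definition unit2 :: "complex \<Rightarrow> complex \<Rightarrow> bool" where
  "unit2 a b \<longleftrightarrow> a * cnj a + b * cnj b = 1"

definition su :: "complex \<Rightarrow> complex \<Rightarrow> complex mat" where
  "su a b = mat2 a b (- cnj b) (cnj a)"

definition SU2 :: "complex mat \<Rightarrow> bool" where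
  "SU2 X \<longleftrightarrow> X \<in> carrier_mat 2 2 \<and> unitary_mat X \<and> det X = 1"

lemma SU2_su: "unit2 a b \<Longrightarrow> SU2 (su a b)"
  unfolding SU2_def su_def by (simp add: unitary2_iff unit2_def algebra_simps)

lemma SU2_mult: "SU2 X \<Longrightarrow> SU2 Y \<Longrightarrow> SU2 (X * Y)"
  unfolding SU2_def using unitary_mult[of X 2 Y] det_mult[of X 2 Y] by auto

lemma unit2_inverse: "unit2 a b \<Longrightarrow> unit2 (cnj a) (- b)"
  by (simp add: unit2_def mult.commute)

lemma mat2_mult:
  "mat2 a b c d * mat2 e f g h = mat2 (a * e + b * g) (a * f + b * h) (c * e + d * g) (c * f + d * h)"
proof (rule eq_matI)
  fix i j
  assume "i < dim_row (mat2 (a * e + b * g) (a * f + b * h) (c * e + d * g) (c * f + d * h))"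
    "j < dim_col (mat2 (a * e + b * g) (a * f + b * h) (c * e + d * g) (c * f + d * h))"
  then have ij: "i < 2" "j < 2" by (simp_all add: mat2_def)
  then show "(mat2 a b c d * mat2 e f g h) $$ (i, j)
      = mat2 (a * e + b * g) (a * f + b * h) (c * e + d * g) (c * f + d * h) $$ (i, j)"
    unfolding mult2_index[OF mat2_carrier mat2_carrier ij] by (auto simp: less_2_cases_iff)
qed (simp_all add: mat2_def)

lemma mat2_one: "mat2 1 0 0 1 = 1\<^sub>m 2"
  by (rule eq_matI) (auto simp: mat2_def less_2_cases_iff)

lemma su_inverse:
  assumes "unit2 a b"
  shows "su a b * su (cnj a) (- b) = 1\<^sub>m 2" "su (cnj a) (- b) * su a b = 1\<^sub>m 2"
  using assms unfolding su_def mat2_mult mat2_one[symmetric] unit2_def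
  by (simp_all add: algebra_simps)

lemma unit2_normalize:
  assumes "p \<noteq> 0 \<or> q \<noteq> 0"
  obtains r :: real where "r > 0" "unit2 (p / of_real r) (q / of_real r)" "p * cnj p + q * cnj q = of_real (r\<^sup>2)"
proof -
  define n where "n = (cmod p)\<^sup>2 + (cmod q)\<^sup>2"
  have n: "n > 0" using assms unfolding n_def by (metis add_pos_nonneg add_nonneg_pos zero_le_power2 zero_less_norm_iff zero_less_power)
  have e: "p * cnj p + q * cnj q = of_real n"
    unfolding n_def by (simp only: of_real_add complex_norm_square)
  have r: "sqrt n > 0" "(sqrt n)\<^sup>2 = n" using n by simp_all
  have "of_real (sqrt n) * of_real (sqrt n) = (of_real n :: complex)"
    using n by (simp flip: of_real_mult)
  then have "unit2 (p / of_real (sqrt n)) (q / of_real (sqrt n))"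
    unfolding unit2_def using n e by (simp flip: add_divide_distrib)
  then show thesis using that[of "sqrt n"] r e by simp
qed

text \<open>The condition says that \<open>(p, q)\<close> and \<open>(r, s)\<close> are parallel, so
  a row that annihilates a nonzero one of them annihilates both.\<close>

lemma unit2_annihilates:
  assumes "p * s = r * q"
  obtains a b where "unit2 a b" "a * p + b * q = 0" "a * r + b * s = 0"
proof (cases "p = 0 \<and> q = 0")
  case False
  then obtain c where "unit2 (q / of_real c) (- p / of_real c)"
    using unit2_normalize[of q "- p"] by auto
  moreover have "q / of_real c * p + - p / of_real c * q = 0" "q / of_real c * r + - p / of_real c * s = 0"
    using assms by (simp_all add: field_simps)
  ultimately show thesis using that by blast
next
  case pq: True
  show thesis
  proof (cases "r = 0 \<and> s = 0")
    case True
    then show thesis using that[of 1 0] pq by (simp add: unit2_def)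
  next
    case False
    then obtain c where "unit2 (s / of_real c) (- r / of_real c)"
      using unit2_normalize[of s "- r"] by auto
    then show thesis using that pq by (simp add: field_simps)
  qed
qed

text \<open>For orthogonal columns, the normalized conjugate of the first annihilates the second,
  and the remaining row of \<open>su a b\<close> annihilates the first. So \<open>su a b\<close>
  brings the two columns to diagonal form.\<close>

lemma unit2_diagonalizes:
  assumes "cnj p * r + cnj q * s = 0"
  obtains a b where "unit2 a b" "- cnj b * p + cnj a * q = 0" "a * r + b * s = 0"
proof (cases "p = 0 \<and> q = 0")
  case True
  then show thesis using unit2_annihilates[of r s r s] that by auto
next
  case False
  then obtain c where c: "unit2 (cnj p / of_real c) (cnj q / of_real c)"
    using unit2_normalize[of "cnj p" "cnj q"] by auto
  have "cnj p / of_real c * r + cnj q / of_real c * s = (cnj p * r + cnj q * s) / of_real c"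
    by (simp add: add_divide_distrib)
  then show thesis using that[OF c] assms by simp
qed

text \<open>
  The parameter \<open>b / cnj a\<close> of the rotation is a root of a quadratic polynomial, whose coefficients
  are inner products of the two columns.
\<close>

lemma unit2_orthogonalizes:
  obtains a b where "unit2 a b"
    "cnj (p * a - q * cnj b) * (p * b + q * cnj a) + cnj (r * a - s * cnj b) * (r * b + s * cnj a) = 0"
proof -
  define h where "h = cnj p * p + cnj r * r - (cnj q * q + cnj s * s)"
  define c where "c = cnj p * q + cnj r * s"
  obtain z where z: "c + z * h - z\<^sup>2 * cnj c = 0"
  proof (cases "c = 0")
    case True
    then show thesis using that[of 0] by simp
  next
    case False
    let ?w = "csqrt (h\<^sup>2 + 4 * c * cnj c)"
    have w: "?w\<^sup>2 = h\<^sup>2 + 4 * c * cnj c" by simp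
    have "c + (h + ?w) / (2 * cnj c) * h - ((h + ?w) / (2 * cnj c))\<^sup>2 * cnj c
        = (4 * c * cnj c + 2 * (h + ?w) * h - (h + ?w)\<^sup>2) / (4 * cnj c)"
      using False by (simp add: field_simps power2_eq_square)
    also have "4 * c * cnj c + 2 * (h + ?w) * h - (h + ?w)\<^sup>2 = 0"
      using w by (simp add: power2_sum algebra_simps power2_eq_square)
    finally have "c + (h + ?w) / (2 * cnj c) * h - ((h + ?w) / (2 * cnj c))\<^sup>2 * cnj c = 0"
      by (simp only: div_0)
    then show thesis by (rule that)
  qed
  obtain t where t: "t > 0" "unit2 (1 / of_real t) (z / of_real t)"
    using unit2_normalize[of 1 z] by auto
  \<comment> \<open>Normalizing \<open>(1, z)\<close> makes \<open>a\<close> real, so a factor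
    \<open>a^2\<close> can be taken out of the orthogonality condition and the quadratic polynomial
    remains.\<close>
  define a where "a = (1 / of_real t :: complex)"
  have a: "cnj a = a" "unit2 a (z * a)" using t by (simp_all add: a_def)
  have "cnj (p * a - q * cnj (z * a)) * (p * (z * a) + q * cnj a)
      + cnj (r * a - s * cnj (z * a)) * (r * (z * a) + s * cnj a) = a\<^sup>2 * (c + z * h - z\<^sup>2 * cnj c)"
    by (simp add: a(1) h_def c_def power2_eq_square algebra_simps)
  then show thesis using that[OF a(2)] z by simp
qed

lemma cnj_square_sum_zero:
  assumes "x * cnj x + y * cnj y = 0"
  shows "x = 0" "y = 0"
proof -
  have "complex_of_real ((cmod x)\<^sup>2 + (cmod y)\<^sup>2) = 0"
    using assms by (simp only: of_real_add complex_norm_square)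
  then have "(cmod x)\<^sup>2 + (cmod y)\<^sup>2 = 0" unfolding of_real_eq_0_iff .
  then show "x = 0" "y = 0" by (simp_all add: sum_power2_eq_zero_iff)
qed

lemma unitary4D:
  assumes "M \<in> carrier_mat 4 4" "unitary_mat M" "i < 4" "j < 4"
  shows "cnj (M $$ (0,i)) * M $$ (0,j) + cnj (M $$ (1,i)) * M $$ (1,j)
      + cnj (M $$ (2,i)) * M $$ (2,j) + cnj (M $$ (3,i)) * M $$ (3,j) = (if i = j then 1 else 0)"
    "M $$ (i,0) * cnj (M $$ (j,0)) + M $$ (i,1) * cnj (M $$ (j,1))
      + M $$ (i,2) * cnj (M $$ (j,2)) + M $$ (i,3) * cnj (M $$ (j,3)) = (if i = j then 1 else 0)"
  using assms(2) unitary_rows[OF assms] assms(3,4)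
  unfolding unitary_mat_iff[OF assms(1)] sum_lessThan_4 by auto

text \<open>
  The usual middle factor pairs the indices \<open>0, 2\<close> and \<open>1, 3\<close> of the blocks \<open>{0, 1}, {2, 3}\<close>; here it
  pairs \<open>0, 3\<close> and \<open>1, 2\<close>.
\<close>

lemma cosine_sine_decomposition:
  assumes M: "M \<in> carrier_mat 4 4" "unitary_mat M"
  obtains X1 X2 Y1 Y2 A B where "SU2 X1" "SU2 X2" "SU2 Y1" "SU2 Y2"
    "A \<in> carrier_mat 2 2" "B \<in> carrier_mat 2 2" "unitary_mat A" "unitary_mat B"
    "M = Q_mat X1 X2 * G_mat A B * Q_mat Y1 Y2"
proof -
  have suc: "su a b \<in> carrier_mat 2 2" for a b by (simp add: su_def)
  have suU: "unit2 a b \<Longrightarrow> unitary_mat (su a b)" for a b using SU2_su SU2_def by blast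
  have one: "unit2 1 0" by (simp add: unit2_def)
  \<comment> \<open>A rotation of columns 0 and 1 makes their upper halves orthogonal. Their lower
    halves are then orthogonal too, since the full columns are.\<close>
  obtain a b where y1: "unit2 a b"
    "cnj (M $$ (0,0) * a - M $$ (0,1) * cnj b) * (M $$ (0,0) * b + M $$ (0,1) * cnj a) +
     cnj (M $$ (1,0) * a - M $$ (1,1) * cnj b) * (M $$ (1,0) * b + M $$ (1,1) * cnj a) = 0"
    using unit2_orthogonalizes .
  define M1 where "M1 = M * Q_mat (su a b) (su 1 0)"
  have M1: "M1 \<in> carrier_mat 4 4" "unitary_mat M1"
    unfolding M1_def using M y1 one by (auto intro!: mult_carrier_mat unitary_mult unitary_Q suc suU)
  have top: "cnj (M1 $$ (0,0)) * M1 $$ (0,1) + cnj (M1 $$ (1,0)) * M1 $$ (1,1) = 0"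
    using y1(2) unfolding M1_def
    by (simp add: Q_mult_right[OF M(1), unfolded One_nat_def] su_def del: index_mult_mat)
  then have bot: "cnj (M1 $$ (2,1)) * M1 $$ (2,0) + cnj (M1 $$ (3,1)) * M1 $$ (3,0) = 0"
  proof -
    have "cnj (M1 $$ (2,0)) * M1 $$ (2,1) + cnj (M1 $$ (3,0)) * M1 $$ (3,1) = 0"
      using top unitary4D(1)[OF M1, of 0 1] by simp
    then have "cnj (cnj (M1 $$ (2,0)) * M1 $$ (2,1) + cnj (M1 $$ (3,0)) * M1 $$ (3,1)) = 0"
      by simp
    then show ?thesis by (simp add: mult.commute)
  qed
  \<comment> \<open>Rotations from the left diagonalize both halves. In the lower one the columns
    are taken in the opposite order, so that column 0 ends up in rows 0 and 3, column 1 in rows 1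
    and 2.\<close>
  obtain c d where x1: "unit2 c d" "- cnj d * M1 $$ (0,0) + cnj c * M1 $$ (1,0) = 0"
    "c * M1 $$ (0,1) + d * M1 $$ (1,1) = 0"
    using unit2_diagonalizes[OF top] .
  obtain e f where x2: "unit2 e f" "- cnj f * M1 $$ (2,1) + cnj e * M1 $$ (3,1) = 0"
    "e * M1 $$ (2,0) + f * M1 $$ (3,0) = 0"
    using unit2_diagonalizes[OF bot] .
  define M2 where "M2 = Q_mat (su c d) (su e f) * M1"
  have M2: "M2 \<in> carrier_mat 4 4" "unitary_mat M2"
    unfolding M2_def using M1 x1 x2 by (auto intro!: mult_carrier_mat unitary_mult unitary_Q suc suU)
  have z2: "M2 $$ (1,0) = 0" "M2 $$ (0,1) = 0" "M2 $$ (3,1) = 0" "M2 $$ (2,0) = 0"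
    using x1 x2 unfolding M2_def by (simp_all add: Q_mult_left[OF M1(1), unfolded One_nat_def] su_def del: index_mult_mat)
  \<comment> \<open>Restricted to rows 0 and 3, columns 2 and 3 are both orthogonal to the nonzero
    column 0, hence parallel in a plane; one rotation can clear both entries of column 2.\<close>
  have "M2 $$ (0,2) * M2 $$ (3,3) = M2 $$ (3,2) * M2 $$ (0,3)"
  proof -
    have 1: "cnj (M2 $$ (0,0)) * M2 $$ (0,2) + cnj (M2 $$ (3,0)) * M2 $$ (3,2) = 0"
      "cnj (M2 $$ (0,0)) * M2 $$ (0,3) + cnj (M2 $$ (3,0)) * M2 $$ (3,3) = 0"
      using unitary4D(1)[OF M2, of 0 2] unitary4D(1)[OF M2, of 0 3] z2 by simp_all
    have "cnj (M2 $$ (0,0)) * (M2 $$ (0,2) * M2 $$ (3,3) - M2 $$ (3,2) * M2 $$ (0,3))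
        = (cnj (M2 $$ (0,0)) * M2 $$ (0,2) + cnj (M2 $$ (3,0)) * M2 $$ (3,2)) * M2 $$ (3,3)
        - (cnj (M2 $$ (0,0)) * M2 $$ (0,3) + cnj (M2 $$ (3,0)) * M2 $$ (3,3)) * M2 $$ (3,2)"
      "cnj (M2 $$ (3,0)) * (M2 $$ (0,2) * M2 $$ (3,3) - M2 $$ (3,2) * M2 $$ (0,3))
        = (cnj (M2 $$ (0,0)) * M2 $$ (0,3) + cnj (M2 $$ (3,0)) * M2 $$ (3,3)) * M2 $$ (0,2)
        - (cnj (M2 $$ (0,0)) * M2 $$ (0,2) + cnj (M2 $$ (3,0)) * M2 $$ (3,2)) * M2 $$ (0,3)"
      by (simp_all add: algebra_simps)
    then have "cnj (M2 $$ (0,0)) * (M2 $$ (0,2) * M2 $$ (3,3) - M2 $$ (3,2) * M2 $$ (0,3)) = 0"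
      "cnj (M2 $$ (3,0)) * (M2 $$ (0,2) * M2 $$ (3,3) - M2 $$ (3,2) * M2 $$ (0,3)) = 0"
      unfolding 1 by simp_all
    moreover have "M2 $$ (0,0) \<noteq> 0 \<or> M2 $$ (3,0) \<noteq> 0"
      using unitary4D(1)[OF M2, of 0 0] z2 by auto
    ultimately show ?thesis by auto
  qed
  then obtain g h where y2: "unit2 g h" "g * M2 $$ (0,2) + h * M2 $$ (0,3) = 0"
    "g * M2 $$ (3,2) + h * M2 $$ (3,3) = 0"
    using unit2_annihilates by metis
  \<comment> \<open>The first column of \<open>su g (- cnj h)\<close> is \<open>(g, h)\<close>,
    which forms the annihilating combination of columns 2 and 3.\<close>
  define M3 where "M3 = M2 * Q_mat (su 1 0) (su g (- cnj h))"
  have y2': "unit2 g (- cnj h)" using y2(1) by (simp add: unit2_def mult.commute)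
  have M3: "M3 \<in> carrier_mat 4 4" "unitary_mat M3"
    unfolding M3_def using M2 y2' one by (auto intro!: mult_carrier_mat unitary_mult unitary_Q suc suU)
  have z3: "M3 $$ (1,0) = 0" "M3 $$ (0,1) = 0" "M3 $$ (3,1) = 0" "M3 $$ (2,0) = 0"
    "M3 $$ (0,2) = 0" "M3 $$ (3,2) = 0"
    using z2 y2 unfolding M3_def
    by (simp_all add: Q_mult_right[OF M2(1), unfolded One_nat_def] su_def mult.commute del: index_mult_mat)
  \<comment> \<open>Counting norms: columns 1 and 2 lie in rows 1 and 2 and exhaust the total
    squared norm 2 of these rows, so nothing is left there for column 3.\<close>
  have "M3 $$ (1,3) * cnj (M3 $$ (1,3)) + M3 $$ (2,3) * cnj (M3 $$ (2,3)) = 0"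
  proof -
    have eqs: "M3 $$ (1,1) * cnj (M3 $$ (1,1)) + M3 $$ (2,1) * cnj (M3 $$ (2,1)) = 1"
      "M3 $$ (1,2) * cnj (M3 $$ (1,2)) + M3 $$ (2,2) * cnj (M3 $$ (2,2)) = 1"
      "M3 $$ (1,1) * cnj (M3 $$ (1,1)) + M3 $$ (1,2) * cnj (M3 $$ (1,2)) + M3 $$ (1,3) * cnj (M3 $$ (1,3)) = 1"
      "M3 $$ (2,1) * cnj (M3 $$ (2,1)) + M3 $$ (2,2) * cnj (M3 $$ (2,2)) + M3 $$ (2,3) * cnj (M3 $$ (2,3)) = 1"
      using unitary4D(1)[OF M3, of 1 1] unitary4D(1)[OF M3, of 2 2]
        unitary4D(2)[OF M3, of 1 1] unitary4D(2)[OF M3, of 2 2] z3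
      by (simp_all add: mult.commute)
    have lin: "s + t = 0" if "p + q = 1" "u + v = 1" "p + u + s = 1" "q + v + t = 1" for p q u v s t :: complex
    proof -
      have "s + t = (p + u + s) + (q + v + t) - (p + q) - (u + v)" by simp
      then show ?thesis using that by simp
    qed
    show ?thesis by (rule lin[OF eqs])
  qed
  note z4 = cnj_square_sum_zero[OF this]
  obtain A B where AB: "M3 = G_mat A B" "A \<in> carrier_mat 2 2" "B \<in> carrier_mat 2 2"
    using G_mat_eqI[OF M3(1)] z3 z4 mat2_carrier by blast
  have uAB: "unitary_mat A" "unitary_mat B"
    using M3(2) unfolding AB(1) unitary_G_iff[OF AB(2,3)] by auto
  let ?X = "Q_mat (su (cnj c) (- d)) (su (cnj e) (- f))"
  let ?Y = "Q_mat (su 1 0) (su (cnj g) (cnj h)) * Q_mat (su (cnj a) (- b)) (su 1 0)"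
  have Qone: "Q_mat (1\<^sub>m 2) (1\<^sub>m 2) = 1\<^sub>m 4"
  proof (rule eq_matI)
    fix i j assume "i < dim_row (1\<^sub>m 4 :: complex mat)" "j < dim_col (1\<^sub>m 4 :: complex mat)"
    then have "i < 4" "j < 4" by simp_all
    then show "Q_mat (1\<^sub>m 2) (1\<^sub>m 2) $$ (i, j) = 1\<^sub>m 4 $$ (i, j)"
      unfolding less_4_cases by (elim disjE; simp add: Q_mat_index)
  qed (use carrier_matD[OF GQ_carrier(2)] in auto)
  have inv: "Q_mat (su (cnj p) (- q)) (su (cnj r) (- s)) * Q_mat (su p q) (su r s) = 1\<^sub>m 4"
    "Q_mat (su p q) (su r s) * Q_mat (su (cnj p) (- q)) (su (cnj r) (- s)) = 1\<^sub>m 4"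
    if "unit2 p q" "unit2 r s" for p q r s
    using that Qone by (simp_all add: Q_mult[OF suc suc suc suc] su_inverse)
  have c4: "Q_mat U V \<in> carrier_mat 4 4" for U V by simp
  note assoc = assoc_mult_mat[of _ 4 4 _ 4 _ 4]
  have "M1 = ?X * M2"
    unfolding M2_def using inv(1)[OF x1(1) x2(1)] M1(1) c4 by (simp flip: assoc)
  moreover have "M2 = M3 * Q_mat (su 1 0) (su (cnj g) (cnj h))"
    unfolding M3_def using inv(2)[OF one y2'] M2(1) c4 by (simp add: assoc)
  moreover have "M = M1 * Q_mat (su (cnj a) (- b)) (su 1 0)"
    unfolding M1_def using inv(2)[OF y1(1) one] M(1) c4 by (simp add: assoc)
  ultimately have "M = ?X * M3 * ?Y"
    using M1(1) M2(1) M3(1) c4 assoc_mult_mat[OF c4 M3(1) mult_carrier_mat[OF c4 c4]]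
    by (simp add: assoc)
  also have "?Y = Q_mat (su 1 0 * su (cnj a) (- b)) (su (cnj g) (cnj h) * su 1 0)"
    by (rule Q_mult[OF suc suc suc suc])
  finally have "M = ?X * G_mat A B * Q_mat (su 1 0 * su (cnj a) (- b)) (su (cnj g) (cnj h) * su 1 0)"
    unfolding AB(1) .
  moreover have "unit2 (cnj g) (cnj h)" using y2(1) by (simp add: unit2_def mult.commute)
  ultimately show thesis
    using that[of "su (cnj c) (- d)" "su (cnj e) (- f)" "su 1 0 * su (cnj a) (- b)" "su (cnj g) (cnj h) * su 1 0" A B]
      SU2_su SU2_mult unit2_inverse x1(1) x2(1) y1(1) one AB uAB by blast
qed

section \<open>Yang--Baxter and left-right moves\<close>

lemma matchgateE:
  assumes "matchgate U"
  obtains A B where "A \<in> carrier_mat 2 2" "B \<in> carrier_mat 2 2" "unitary_mat A" "unitary_mat B"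
    "det A = det B" "U = G_mat A B"
  using assms unfolding matchgate_def by blast

lemma matchgateI:
  "A \<in> carrier_mat 2 2 \<Longrightarrow> B \<in> carrier_mat 2 2 \<Longrightarrow> unitary_mat A \<Longrightarrow> unitary_mat B \<Longrightarrow>
   det A = det B \<Longrightarrow> matchgate (G_mat A B)"
  unfolding matchgate_def by blast

lemma matchgate_carrier: "matchgate U \<Longrightarrow> U \<in> carrier_mat 4 4"
  by (elim matchgateE) simp

lemma matchgate_mult:
  assumes "matchgate U" "matchgate V"
  shows "matchgate (U * V)"
proof -
  obtain A B where U: "A \<in> carrier_mat 2 2" "B \<in> carrier_mat 2 2" "unitary_mat A" "unitary_mat B"
    "det A = det B" "U = G_mat A B" using assms(1) by (rule matchgateE)
  obtain C D where V: "C \<in> carrier_mat 2 2" "D \<in> carrier_mat 2 2" "unitary_mat C" "unitary_mat D"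
    "det C = det D" "V = G_mat C D" using assms(2) by (rule matchgateE)
  show ?thesis unfolding U(6) V(6) G_mult[OF U(1,2) V(1,2)]
    using U V by (intro matchgateI) (auto intro: unitary_mult simp: det_mult[of _ 2])
qed

lemma SU2_matchgate: "SU2 X \<Longrightarrow> SU2 Y \<Longrightarrow> matchgate (G_mat X Y)"
  by (auto simp: SU2_def intro: matchgateI)

lemma circuit_mat_3:
  assumes "U \<in> carrier_mat 4 4" "V \<in> carrier_mat 4 4" "W \<in> carrier_mat 4 4"
  shows "circuit_mat 3 [(1, U), (2, V), (1, W)] = gate_at 3 1 U * gate_at 3 2 V * gate_at 3 1 W"
    "circuit_mat 3 [(2, U), (1, V), (2, W)] = gate_at 3 2 U * gate_at 3 1 V * gate_at 3 2 W"
    "circuit_mat 3 [(1, U), (2, V)] = gate_at 3 1 U * gate_at 3 2 V"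
    "circuit_mat 3 [(2, U), (1, V)] = gate_at 3 2 U * gate_at 3 1 V"
proof -
  have c: "gate_at 3 1 M \<in> carrier_mat 8 8" "gate_at 3 2 M \<in> carrier_mat 8 8" if "M \<in> carrier_mat 4 4" for M
    using gate_at_carrier[OF that, of 1 3] gate_at_carrier[OF that, of 2 3] by simp_all
  note c' = c[OF assms(1)] c[OF assms(2)] c[OF assms(3)]
  show "circuit_mat 3 [(1, U), (2, V), (1, W)] = gate_at 3 1 U * gate_at 3 2 V * gate_at 3 1 W"
    "circuit_mat 3 [(2, U), (1, V), (2, W)] = gate_at 3 2 U * gate_at 3 1 V * gate_at 3 2 W"
    "circuit_mat 3 [(1, U), (2, V)] = gate_at 3 1 U * gate_at 3 2 V"
    "circuit_mat 3 [(2, U), (1, V)] = gate_at 3 2 U * gate_at 3 1 V"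
    using c' by (simp_all add: assoc_mult_mat[of _ 8 8 _ 8 _ 8] right_mult_one_mat[of _ 8 8])
qed

lemma yang_baxter_exists:
  assumes "matchgate U" "matchgate U'" "matchgate U''"
  shows "\<exists>V V' V''. yang_baxter U U' U'' V V' V''"
proof -
  obtain A B where U: "A \<in> carrier_mat 2 2" "B \<in> carrier_mat 2 2" "unitary_mat A" "unitary_mat B"
    "det A = det B" "U = G_mat A B" using assms(1) by (rule matchgateE)
  obtain A' B' where U': "A' \<in> carrier_mat 2 2" "B' \<in> carrier_mat 2 2" "unitary_mat A'" "unitary_mat B'"
    "det A' = det B'" "U' = G_mat A' B'" using assms(2) by (rule matchgateE)
  obtain A'' B'' where U'': "A'' \<in> carrier_mat 2 2" "B'' \<in> carrier_mat 2 2" "unitary_mat A''" "unitary_mat B''"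
    "det A'' = det B''" "U'' = G_mat A'' B''" using assms(3) by (rule matchgateE)
  define D where "D = det A * det A' * det A''"
  define M where "M = G_mat A B * Q_mat A' B' * G_mat A'' B''"
  have M: "M \<in> carrier_mat 4 4" "unitary_mat M"
    unfolding M_def using U U' U''
    by (auto intro!: mult_carrier_mat[of _ 4 4 _ 4] unitary_mult[of _ 4] unitary_Q GQ_carrier simp: unitary_G_iff)
  have left: "circuit_mat 3 [(1, U), (2, U'), (1, U'')] = parity_mat D M"
    unfolding circuit_mat_3(1)[OF matchgate_carrier[OF assms(1)] matchgate_carrier[OF assms(2)] matchgate_carrier[OF assms(3)]]
    unfolding D_def M_def U(6) U'(6) U''(6) gate_1_parity[OF U(1-5)] gate_2_parity[OF U'(1-5)] gate_1_parity[OF U''(1-5)]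
    by (simp add: parity_mat_mult mult_carrier_mat[of _ 4 4 _ 4])
  have detM: "det M = D * D"
  proof -
    have "det M = det (G_mat A B) * det (Q_mat A' B') * det (G_mat A'' B'')"
      unfolding M_def by (simp add: det_mult[of _ 4] mult_carrier_mat[of _ 4 4])
    then show ?thesis using U(5) U'(5) U''(5)
      by (simp add: det_G[OF U(1,2)] det_Q[OF U'(1,2)] det_G[OF U''(1,2)] D_def)
  qed
  have DD: "D * cnj D = 1"
  proof -
    have "D * cnj D = (det A * cnj (det A)) * (det A' * cnj (det A')) * (det A'' * cnj (det A''))"
      unfolding D_def by simp
    then show ?thesis
      unfolding unitary2_relations(5)[OF U(1,3)] unitary2_relations(5)[OF U'(1,3)] unitary2_relations(5)[OF U''(1,3)]
      by simp
  qed
  obtain X1 X2 Y1 Y2 E F where X: "SU2 X1" "SU2 X2" "SU2 Y1" "SU2 Y2"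
    and EF: "E \<in> carrier_mat 2 2" "F \<in> carrier_mat 2 2" "unitary_mat E" "unitary_mat F"
    and dec: "M = Q_mat X1 X2 * G_mat E F * Q_mat Y1 Y2"
    using cosine_sine_decomposition[OF M] .
  have dX: "det X1 = 1" "det X2 = 1" "det Y1 = 1" "det Y2 = 1"
    and cX: "X1 \<in> carrier_mat 2 2" "X2 \<in> carrier_mat 2 2" "Y1 \<in> carrier_mat 2 2" "Y2 \<in> carrier_mat 2 2"
    using X unfolding SU2_def by auto
  have EFD: "det E * det F = D * D"
  proof -
    have "det M = det (Q_mat X1 X2) * det (G_mat E F) * det (Q_mat Y1 Y2)"
      unfolding dec by (simp add: det_mult[of _ 4] mult_carrier_mat[of _ 4 4])
    then show ?thesis using detM
      by (simp add: det_G[OF EF(1,2)] det_Q[OF cX(1,2)] det_Q[OF cX(3,4)] dX)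
  qed
  \<comment> \<open>As \<open>det E\<close> has modulus 1, this is \<open>D / det E\<close>. Since
    \<open>det E * det F = D * D\<close>, the conjugate phase corrects \<open>F\<close>.\<close>
  define t where "t = D * cnj (det E)"
  have tE: "t * det E = D" and tF: "cnj t * det F = D"
  proof -
    have E1: "det E * cnj (det E) = 1" using unitary2_relations(5)[OF EF(1,3)] .
    show "t * det E = D" unfolding t_def using E1 by (simp add: mult.assoc mult.commute)
    have "cnj t * det F = cnj D * (det E * det F)" unfolding t_def by simp
    also have "\<dots> = (D * cnj D) * D" unfolding EFD by simp
    finally show "cnj t * det F = D" unfolding DD by simp
  qed
  have ut: "unit2 t 0" "unit2 (cnj t) 0"
  proof -
    have "t * cnj t = (D * cnj D) * (det E * cnj (det E))" unfolding t_def by simp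
    then show "unit2 t 0" "unit2 (cnj t) 0"
      unfolding DD unitary2_relations(5)[OF EF(1,3)] unit2_def by (simp_all add: mult.commute)
  qed
  have one: "unit2 1 0" by (simp add: unit2_def)
  \<comment> \<open>Row 0 of \<open>G_mat E F\<close> belongs to \<open>E\<close> and row 1 to
    \<open>F\<close>, so the left factor \<open>su t 0\<close>, the diagonal matrix of
    \<open>t\<close> and \<open>cnj t\<close>, scales one row of each block. Its inverse has
    determinant 1 and is absorbed into \<open>X1\<close>.\<close>
  define E' where "E' = mat2 (t * E $$ (0,0)) (t * E $$ (0,1)) (E $$ (1,0)) (E $$ (1,1))"
  define F' where "F' = mat2 (cnj t * F $$ (0,0)) (cnj t * F $$ (0,1)) (F $$ (1,0)) (F $$ (1,1))"
  have cEF': "E' \<in> carrier_mat 2 2" "F' \<in> carrier_mat 2 2" by (simp_all add: E'_def F'_def)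
  have suc: "su a b \<in> carrier_mat 2 2" for a b by (simp add: su_def)
  let ?T = "Q_mat (su t 0) (su 1 0)" and ?S = "Q_mat (su (cnj t) 0) (su 1 0)"
  have T: "?T * G_mat E F = G_mat E' F'"
  proof (rule eq_matI)
    fix i j assume "i < dim_row (G_mat E' F')" "j < dim_col (G_mat E' F')"
    then have "i < 4" "j < 4" using carrier_matD[OF GQ_carrier(1)] by metis+
    then show "(?T * G_mat E F) $$ (i, j) = G_mat E' F' $$ (i, j)"
      unfolding less_4_cases
      by (elim disjE; simp add: Q_mult_left[OF GQ_carrier(1), simplified] G_mat_index su_def E'_def F'_def del: index_mult_mat)
  qed (use carrier_matD[OF GQ_carrier(1)] carrier_matD[OF GQ_carrier(2)] in auto)
  have "unitary_mat (G_mat E' F')"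
    unfolding T[symmetric] using EF ut one SU2_su unfolding SU2_def
    by (auto intro!: unitary_mult[of _ 4] unitary_Q GQ_carrier simp: unitary_G_iff)
  then have uEF': "unitary_mat E'" "unitary_mat F'" using unitary_G_iff[OF cEF'] by auto
  have dEF': "det E' = D" "det F' = D"
    using tE tF unfolding E'_def F'_def det_2[OF EF(1)] det_2[OF EF(2)] by (simp_all add: algebra_simps)
  define X1' where "X1' = X1 * su (cnj t) 0"
  define X2' where "X2' = X2 * su 1 0"
  have X': "SU2 X1'" "SU2 X2'" unfolding X1'_def X2'_def using X ut one SU2_su SU2_mult by auto
  have "su (cnj t) 0 * su t 0 = 1\<^sub>m 2" "su 1 0 * su 1 0 = 1\<^sub>m 2"
    using su_inverse(2)[OF ut(1)] su_inverse(1)[OF one] by simp_all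
  then have "X1' * su t 0 = X1" "X2' * su 1 0 = X2"
    unfolding X1'_def X2'_def using cX suc by (simp_all add: assoc_mult_mat[of _ 2 2 _ 2 _ 2])
  then have "Q_mat X1' X2' * ?T = Q_mat X1 X2"
    using X' suc unfolding SU2_def by (simp add: Q_mult)
  then have "Q_mat X1' X2' * G_mat E' F' = Q_mat X1 X2 * G_mat E F"
    unfolding T[symmetric] by (simp add: assoc_mult_mat[of _ 4 4 _ 4 _ 4, symmetric])
  then have M': "M = Q_mat X1' X2' * G_mat E' F' * Q_mat Y1 Y2" using dec by simp
  have m: "matchgate (G_mat X1' X2')" "matchgate (G_mat E' F')" "matchgate (G_mat Y1 Y2)"
    using SU2_matchgate X X' cEF' uEF' dEF' by (auto intro: matchgateI)
  have X'': "X1' \<in> carrier_mat 2 2" "X2' \<in> carrier_mat 2 2" "unitary_mat X1'" "unitary_mat X2'" "det X1' = det X2'"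
    using X' unfolding SU2_def by auto
  have Y'': "Y1 \<in> carrier_mat 2 2" "Y2 \<in> carrier_mat 2 2" "unitary_mat Y1" "unitary_mat Y2" "det Y1 = det Y2"
    using X unfolding SU2_def by auto
  have dEF'': "det E' = det F'" using dEF' by simp
  have "circuit_mat 3 [(2, G_mat X1' X2'), (1, G_mat E' F'), (2, G_mat Y1 Y2)] = parity_mat D M"
    unfolding circuit_mat_3(2)[OF GQ_carrier(1) GQ_carrier(1) GQ_carrier(1)]
      gate_2_parity[OF X''] gate_1_parity[OF cEF' uEF' dEF''] gate_2_parity[OF Y''] M'
    using X' dEF' dX unfolding SU2_def by (simp add: parity_mat_mult mult_carrier_mat[of _ 4 4 _ 4])
  then show ?thesis
    unfolding yang_baxter_def left using m by metis
qed

text \<open>The factor \<open>r\<close> is the norm of the vector; the zero vector is matched by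
  \<open>r = 0\<close> and the identity rotation.\<close>

lemma SU2_column:
  obtains X r where "SU2 X" "X $$ (0,0) * of_real r = p" "X $$ (1,0) * of_real r = q"
    "complex_of_real (r\<^sup>2) = p * cnj p + q * cnj q"
proof (cases "p = 0 \<and> q = 0")
  case True
  then show thesis using that[of "su 1 0" 0] SU2_su[of 1 0] by (simp add: unit2_def)
next
  case False
  then obtain r where r: "r > 0" "unit2 (p / of_real r) (q / of_real r)" "p * cnj p + q * cnj q = of_real (r\<^sup>2)"
    using unit2_normalize[of p q] by blast
  have "unit2 (p / of_real r) (- cnj q / of_real r)" using r(2) by (simp add: unit2_def mult.commute)
  then have S: "SU2 (su (p / of_real r) (- cnj q / of_real r))" by (rule SU2_su)
  show thesis by (rule that[OF S, of r]) (use r(1,3) in \<open>simp_all add: su_def\<close>)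
qed

text \<open>Right multiplication by \<open>su 0 1\<close> moves the first column to the
  second.\<close>

lemma SU2_column':
  obtains X r where "SU2 X" "X $$ (0,1) * of_real r = p" "X $$ (1,1) * of_real r = q"
    "complex_of_real (r\<^sup>2) = p * cnj p + q * cnj q"
proof -
  obtain X r where X: "SU2 X" "X $$ (0,0) * of_real r = p" "X $$ (1,0) * of_real r = q"
    "complex_of_real (r\<^sup>2) = p * cnj p + q * cnj q" by (rule SU2_column)
  let ?J = "su 0 1"
  have J: "SU2 ?J" by (rule SU2_su) (simp add: unit2_def)
  have "(X * ?J) $$ (0,1) = X $$ (0,0)" "(X * ?J) $$ (1,1) = X $$ (1,0)"
    using X(1) J unfolding SU2_def by (simp_all add: mult2_index su_def del: index_mult_mat)
  then show thesis using that[of "X * ?J" r] SU2_mult[OF X(1) J] X by simp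
qed

text \<open>The zero state is even, so the scalar \<open>d\<close> and the conjugate block drop out.
  Hence a left-right move has to match a single column only.\<close>

lemma parity_mat_ket0:
  "parity_mat d M *\<^sub>v ket0 3 = vec 8 (\<lambda>x. if even_state x then M $$ (x div 2, 0) else 0)"
proof (rule eq_vecI)
  fix i assume "i < dim_vec (vec 8 (\<lambda>x. if even_state x then M $$ (x div 2, 0) else 0))"
  then have i: "i < 8" by simp
  have "(parity_mat d M *\<^sub>v ket0 3) $ i = parity_mat d M $$ (i, 0)"
    using i by (simp add: ket0_def scalar_prod_right_unit)
  then show "(parity_mat d M *\<^sub>v ket0 3) $ i = vec 8 (\<lambda>x. if even_state x then M $$ (x div 2, 0) else 0) $ i"
    using i by (simp add: parity_mat_def) (simp add: even_state_def)
qed simp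

lemma left_right_exists:
  assumes "matchgate U" "matchgate U'"
  shows "\<exists>V V'. left_right U U' V V'"
proof -
  obtain A B where U: "A \<in> carrier_mat 2 2" "B \<in> carrier_mat 2 2" "unitary_mat A" "unitary_mat B"
    "det A = det B" "U = G_mat A B" using assms(1) by (rule matchgateE)
  obtain A' B' where U': "A' \<in> carrier_mat 2 2" "B' \<in> carrier_mat 2 2" "unitary_mat A'" "unitary_mat B'"
    "det A' = det B'" "U' = G_mat A' B'" using assms(2) by (rule matchgateE)
  define M where "M = G_mat A B * Q_mat A' B'"
  have M: "M \<in> carrier_mat 4 4" "unitary_mat M"
    unfolding M_def using U U'
    by (auto intro!: mult_carrier_mat[of _ 4 4 _ 4] unitary_mult[of _ 4] unitary_Q GQ_carrier simp: unitary_G_iff)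
  have left: "circuit_mat 3 [(1, U), (2, U')] = parity_mat (det A * det A') M"
    unfolding circuit_mat_3(3)[OF matchgate_carrier[OF assms(1)] matchgate_carrier[OF assms(2)] matchgate_carrier[OF assms(2)]]
    unfolding M_def U(6) U'(6) gate_1_parity[OF U(1-5)] gate_2_parity[OF U'(1-5)]
    by (simp add: parity_mat_mult mult_carrier_mat[of _ 4 4 _ 4])
  \<comment> \<open>Column 0 of a \<open>G_mat\<close> occupies rows 0 and 3. The upper half of the
    target column is therefore produced by the first column of \<open>X\<close>, the lower half by
    the second column of \<open>Y\<close>, with weights \<open>r\<close> and
    \<open>s\<close>.\<close>
  obtain X r where X: "SU2 X" "X $$ (0,0) * of_real r = M $$ (0,0)" "X $$ (1,0) * of_real r = M $$ (1,0)"
    "complex_of_real (r\<^sup>2) = M $$ (0,0) * cnj (M $$ (0,0)) + M $$ (1,0) * cnj (M $$ (1,0))"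
    by (rule SU2_column)
  obtain Y s where Y: "SU2 Y" "Y $$ (0,1) * of_real s = M $$ (2,0)" "Y $$ (1,1) * of_real s = M $$ (3,0)"
    "complex_of_real (s\<^sup>2) = M $$ (2,0) * cnj (M $$ (2,0)) + M $$ (3,0) * cnj (M $$ (3,0))"
    by (rule SU2_column')
  have "complex_of_real (r\<^sup>2) + complex_of_real (s\<^sup>2) = 1"
    unfolding X(4) Y(4) using unitary4D(1)[OF M, of 0 0] by (simp add: mult.commute add.assoc)
  \<comment> \<open>With this sign the first column of \<open>su (of_real r) (- of_real s)\<close>
    is \<open>(r, s)\<close>.\<close>
  then have "unit2 (of_real r) (- of_real s)" by (simp add: unit2_def power2_eq_square)
  then have Z: "SU2 (su (of_real r) (- of_real s))" by (rule SU2_su)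
  have one: "SU2 (su 1 0)" by (rule SU2_su) (simp add: unit2_def)
  let ?Z = "su (of_real r) (- of_real s)"
  have X': "X \<in> carrier_mat 2 2" "Y \<in> carrier_mat 2 2" "unitary_mat X" "unitary_mat Y" "det X = det Y"
    using X(1) Y(1) unfolding SU2_def by auto
  have Z': "?Z \<in> carrier_mat 2 2" "su 1 0 \<in> carrier_mat 2 2" "unitary_mat ?Z" "unitary_mat (su 1 0)"
    "det ?Z = det (su 1 0)"
    using Z one unfolding SU2_def by auto
  have right: "circuit_mat 3 [(2, G_mat X Y), (1, G_mat ?Z (su 1 0))]
      = parity_mat (det X * det ?Z) (Q_mat X Y * G_mat ?Z (su 1 0))"
    unfolding circuit_mat_3(4)[OF GQ_carrier(1) GQ_carrier(1) GQ_carrier(1)]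
      gate_2_parity[OF X'] gate_1_parity[OF Z']
    by (simp add: parity_mat_mult mult_carrier_mat[of _ 4 4 _ 4])
  have "(Q_mat X Y * G_mat ?Z (su 1 0)) $$ (i, 0) = M $$ (i, 0)" if "i < 4" for i
    using that X(2,3) Y(2,3) unfolding less_4_cases
    by (elim disjE; simp add: Q_mult_left[OF GQ_carrier(1), simplified] G_mat_index su_def del: index_mult_mat)
  then have "(Q_mat X Y * G_mat ?Z (su 1 0)) $$ (x div 2, 0) = M $$ (x div 2, 0)" if "x < 8" for x
    using that by simp
  then have "circuit_mat 3 [(1, U), (2, U')] *\<^sub>v ket0 3
      = circuit_mat 3 [(2, G_mat X Y), (1, G_mat ?Z (su 1 0))] *\<^sub>v ket0 3"
    unfolding left right parity_mat_ket0 by (intro eq_vecI) auto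
  then show ?thesis
    unfolding left_right_def using SU2_matchgate[OF X(1) Y(1)] SU2_matchgate[OF Z one] by blast
qed

section \<open>Runs of the absorption algorithm\<close>

definition shape :: "marked_circuit \<Rightarrow> shape" where
  "shape = map (map_prod id is_Tracked)"

definition unmarked :: "marked_circuit \<Rightarrow> circuit" where
  "unmarked = map (map_prod id unmark)"

lemma shape_simps [simp]:
  "shape [] = []" "shape ((j, g) # C) = (j, is_Tracked g) # shape C" "shape (C @ D) = shape C @ shape D"
  by (simp_all add: shape_def)

lemma unmarked_simps [simp]:
  "unmarked [] = []" "unmarked ((j, g) # C) = (j, unmark g) # unmarked C"
  "unmarked (C @ D) = unmarked C @ unmarked D"
  by (simp_all add: unmarked_def)

lemma shape_same: "C \<approx> C' \<Longrightarrow> shape C \<approx> shape C'"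
  unfolding shape_def by (rule same_circuit_map) auto

lemma unmarked_same: "C \<approx> C' \<Longrightarrow> unmarked C \<approx> unmarked C'"
  unfolding unmarked_def by (rule same_circuit_map) auto

lemma untouched_shape [simp]: "untouched j (shape C) \<longleftrightarrow> untouched j C"
  by (auto simp: untouched_def shape_def)

lemma untouched_unmarked [simp]: "untouched j (unmarked C) \<longleftrightarrow> untouched j C"
  by (auto simp: untouched_def unmarked_def)

lemma shape_eq_Cons:
  "shape C = tr j # W \<longleftrightarrow> (\<exists>A D. C = (j, Tracked A) # D \<and> shape D = W)"
  "shape C = pl j # W \<longleftrightarrow> (\<exists>A D. C = (j, Plain A) # D \<and> shape D = W)"
proof -
  have "is_Tracked g \<longleftrightarrow> (\<exists>A. g = Tracked A)" "\<not> is_Tracked g \<longleftrightarrow> (\<exists>A. g = Plain A)" for g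
    by (cases g; simp)+
  then show "shape C = tr j # W \<longleftrightarrow> (\<exists>A D. C = (j, Tracked A) # D \<and> shape D = W)"
    "shape C = pl j # W \<longleftrightarrow> (\<exists>A D. C = (j, Plain A) # D \<and> shape D = W)"
    by (cases C; auto)+
qed

lemma shape_eq_Nil: "shape C = [] \<longleftrightarrow> C = []"
  by (simp add: shape_def)

lemma shape_appendE:
  assumes "shape C = V @ W"
  obtains D E where "C = D @ E" "shape D = V" "shape E = W"
proof -
  obtain D E where "C = D @ E" "V = map (map_prod id is_Tracked) D" "W = map (map_prod id is_Tracked) E"
    using assms unfolding shape_def map_eq_append_conv by auto
  then show thesis using that[of D E] by (simp add: shape_def)
qed

lemma shape_factor:
  assumes "shape C \<approx> W1 @ M @ W2"
  obtains C1 N C2 where "C \<approx> C1 @ N @ C2" "shape C1 = W1" "shape N = M" "shape C2 = W2"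
proof -
  obtain C' where C': "C \<approx> C'" "shape C' = W1 @ M @ W2"
    using same_circuit_map_lift[of "map_prod id is_Tracked" C] assms unfolding shape_def by auto
  obtain C1 R where "C' = C1 @ R" "shape C1 = W1" "shape R = M @ W2"
    using shape_appendE[OF C'(2)] .
  moreover obtain N C2 where "R = N @ C2" "shape N = M" "shape C2 = W2"
    using shape_appendE[OF \<open>shape R = M @ W2\<close>] .
  ultimately show thesis using that[of C1 N C2] C'(1) by simp
qed

lemma merges_shape: "merges (shape C) \<longleftrightarrow> mergeable C"
proof
  assume "merges (shape C)"
  then obtain j W1 W2 M where W: "shape C \<approx> W1 @ M @ W2" and M: "M = [tr j, pl j] \<or> M = [pl j, tr j]"
    unfolding merges_def occurs_def by blast
  obtain C1 N C2 where C: "C \<approx> C1 @ N @ C2" "shape N = M" using shape_factor[OF W] by metis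
  show "mergeable C"
    using C M unfolding mergeable_def
    by (auto simp: shape_eq_Cons shape_eq_Nil) blast+
next
  assume "mergeable C"
  then obtain C1 C2 j A U where
    "C \<approx> C1 @ [(j, Tracked A), (j, Plain U)] @ C2 \<or> C \<approx> C1 @ [(j, Plain U), (j, Tracked A)] @ C2"
    unfolding mergeable_def by blast
  then show "merges (shape C)"
  proof
    assume "C \<approx> C1 @ [(j, Tracked A), (j, Plain U)] @ C2"
    from shape_same[OF this] have "shape C \<approx> shape C1 @ [tr j, pl j] @ shape C2" by simp
    then show ?thesis unfolding merges_def occurs_def by blast
  next
    assume "C \<approx> C1 @ [(j, Plain U), (j, Tracked A)] @ C2"
    from shape_same[OF this] have "shape C \<approx> shape C1 @ [pl j, tr j] @ shape C2" by simp
    then show ?thesis unfolding merges_def occurs_def by blast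
  qed
qed

lemma occurs_shape:
  "occurs [tr j, pl (j + 1), pl j] (shape C) \<Longrightarrow> \<exists>C1 A U U' C2. seq1 C C1 j A U U' C2"
  "occurs [pl j, pl (j + 1), tr j] (shape C) \<Longrightarrow> \<exists>C1 U U' A C2. seq4 C C1 j U U' A C2"
  "occurs_first j [tr j, pl (j + 1)] (shape C) \<Longrightarrow> \<exists>C1 A U C2. seq2 C C1 j A U C2"
  "occurs_first j [pl j, tr (j + 1)] (shape C) \<Longrightarrow> \<exists>C1 U A C2. seq3 C C1 j U A C2"
proof -
  assume "occurs [tr j, pl (j + 1), pl j] (shape C)"
  then obtain W1 W2 where "shape C \<approx> W1 @ [tr j, pl (j + 1), pl j] @ W2" unfolding occurs_def by blast
  then obtain C1 N C2 where "C \<approx> C1 @ N @ C2" "shape N = [tr j, pl (j + 1), pl j]" using shape_factor by metis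
  then show "\<exists>C1 A U U' C2. seq1 C C1 j A U U' C2"
  proof -
    obtain A U U' where "N = [(j, Tracked A), (j + 1, Plain U), (j, Plain U')]"
      using \<open>shape N = _\<close> by (auto simp: shape_eq_Cons shape_eq_Nil)
    then show ?thesis unfolding seq1_def using \<open>C \<approx> _\<close> by blast
  qed
next
  assume "occurs [pl j, pl (j + 1), tr j] (shape C)"
  then obtain W1 W2 where "shape C \<approx> W1 @ [pl j, pl (j + 1), tr j] @ W2" unfolding occurs_def by blast
  then obtain C1 N C2 where "C \<approx> C1 @ N @ C2" "shape N = [pl j, pl (j + 1), tr j]" using shape_factor by metis
  then show "\<exists>C1 U U' A C2. seq4 C C1 j U U' A C2"
  proof -
    obtain U U' A where "N = [(j, Plain U), (j + 1, Plain U'), (j, Tracked A)]"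
      using \<open>shape N = _\<close> by (auto simp: shape_eq_Cons shape_eq_Nil)
    then show ?thesis unfolding seq4_def using \<open>C \<approx> _\<close> by blast
  qed
next
  assume "occurs_first j [tr j, pl (j + 1)] (shape C)"
  then obtain W1 W2 where "shape C \<approx> W1 @ [tr j, pl (j + 1)] @ W2" "untouched j W2"
    unfolding occurs_first_def by blast
  then obtain C1 N C2 where "C \<approx> C1 @ N @ C2" "shape N = [tr j, pl (j + 1)]" "untouched j C2"
    using shape_factor untouched_shape by metis
  then show "\<exists>C1 A U C2. seq2 C C1 j A U C2"
  proof -
    obtain A U where "N = [(j, Tracked A), (j + 1, Plain U)]"
      using \<open>shape N = _\<close> by (auto simp: shape_eq_Cons shape_eq_Nil)
    then show ?thesis unfolding seq2_def using \<open>C \<approx> _\<close> \<open>untouched j C2\<close> by blast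
  qed
next
  assume "occurs_first j [pl j, tr (j + 1)] (shape C)"
  then obtain W1 W2 where "shape C \<approx> W1 @ [pl j, tr (j + 1)] @ W2" "untouched j W2"
    unfolding occurs_first_def by blast
  then obtain C1 N C2 where "C \<approx> C1 @ N @ C2" "shape N = [pl j, tr (j + 1)]" "untouched j C2"
    using shape_factor untouched_shape by metis
  then show "\<exists>C1 U A C2. seq3 C C1 j U A C2"
  proof -
    obtain U A where "N = [(j, Plain U), (j + 1, Tracked A)]"
      using \<open>shape N = _\<close> by (auto simp: shape_eq_Cons shape_eq_Nil)
    then show ?thesis unfolding seq3_def using \<open>C \<approx> _\<close> \<open>untouched j C2\<close> by blast
  qed
qed

text \<open>A simulation of circuits by words. Patterns of gates project to words; the negative
  premises carry over because a pattern in the word lifts back to the circuit.\<close>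

lemma absorption_step_shape:
  assumes "(s, C) \<leadsto> (s', C')"
  shows "shape_step (s, shape C) (s', shape C')"
  using assms
proof cases
  case (merge_below C1 j A U C2)
  then show ?thesis using shape_step.merge[of s "[tr j, pl j]" j "shape C" "shape C1" "shape C2"]
      shape_same[OF merge_below(4)] by simp
next
  case (merge_above C1 j U A C2)
  then show ?thesis using shape_step.merge[of s "[pl j, tr j]" j "shape C" "shape C1" "shape C2"]
      shape_same[OF merge_above(4)] by simp
next
  case (step1 C1 j A U U' C2 V V' A')
  then show ?thesis using shape_step.step1[of "shape C" "shape C1" j "shape C2"]
      shape_same[OF step1(5)[unfolded seq1_def]]
      step1 by (simp add: merges_shape seq1_def)
next
  case step1_end
  then show ?thesis using shape_step.step1_end[of "shape C"] occurs_shape(1) merges_shape by blast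
next
  case (step2 C1 j A U C2 V A')
  then show ?thesis using shape_step.step2[of "shape C" "shape C1" j "shape C2"]
      shape_same[OF step2(5)[unfolded seq2_def, THEN conjunct1]]
      step2 by (simp add: merges_shape seq2_def)
next
  case step2_skip
  then show ?thesis using shape_step.step2_skip[of "shape C"] occurs_shape(3) merges_shape by blast
next
  case (step3 C1 j U A C2 A' V)
  then show ?thesis using shape_step.step3[of "shape C" "shape C1" j "shape C2"]
      shape_same[OF step3(5)[unfolded seq3_def, THEN conjunct1]]
      step3 by (simp add: merges_shape seq3_def)
next
  case step3_skip
  then show ?thesis using shape_step.step3_skip[of "shape C"] occurs_shape(4) merges_shape by blast
next
  case (step4 C1 j U U' A C2 A' V V')
  then show ?thesis using shape_step.step4[of "shape C" "shape C1" j "shape C2"]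
      shape_same[OF step4(5)[unfolded seq4_def]]
      step4 by (simp add: merges_shape seq4_def)
next
  case step4_end
  then show ?thesis using shape_step.step4_end[of "shape C"] occurs_shape(2) merges_shape by blast
qed

section \<open>The prepared state along a run\<close>

definition prepares :: "nat \<Rightarrow> complex vec \<Rightarrow> marked_circuit \<Rightarrow> bool" where
  "prepares L \<phi> C \<longleftrightarrow> (\<forall>(j, g)\<in>set C. 1 \<le> j \<and> j < L \<and> matchgate (unmark g)) \<and>
     circuit_mat L (unmarked C) *\<^sub>v ket0 L = \<phi>"

lemma prepares_valid: "prepares L \<phi> C \<Longrightarrow> valid L (unmarked C)"
  unfolding prepares_def valid_def unmarked_def by (force dest: matchgate_carrier)

lemma prepares_same:
  assumes "C \<approx> C'" "prepares L \<phi> C"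
  shows "prepares L \<phi> C'"
  using assms(2) same_circuit_mat[OF unmarked_same[OF assms(1)] prepares_valid[OF assms(2)]]
    same_circuit_set[OF assms(1)]
  unfolding prepares_def by simp

lemma prepares_replace:
  assumes "prepares L \<phi> (C1 @ M @ C2)"
    "\<And>j g. (j, g) \<in> set M' \<Longrightarrow> 1 \<le> j \<and> j < L \<and> matchgate (unmark g)"
    "circuit_mat L (unmarked M) = circuit_mat L (unmarked M')"
  shows "prepares L \<phi> (C1 @ M' @ C2)"
proof -
  have v: "valid L (unmarked C1)" "valid L (unmarked M)" "valid L (unmarked C2)"
    using prepares_valid[OF assms(1)] by auto
  have "valid L (unmarked M')"
    using assms(2) unfolding valid_def unmarked_def by (force dest: matchgate_carrier)
  then have "circuit_mat L (unmarked C1 @ unmarked M @ unmarked C2)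
      = circuit_mat L (unmarked C1 @ unmarked M' @ unmarked C2)"
    using v assms(3) by (intro circuit_mat_replace) simp_all
  then have "circuit_mat L (unmarked (C1 @ M' @ C2)) *\<^sub>v ket0 L = \<phi>"
    using assms(1) unfolding prepares_def by simp
  moreover have "\<forall>(j, g)\<in>set (C1 @ M' @ C2). 1 \<le> j \<and> j < L \<and> matchgate (unmark g)"
    using assms(1,2) unfolding prepares_def by (auto simp: ball_Un)
  ultimately show ?thesis unfolding prepares_def by blast
qed

lemma yang_baxter_gates:
  assumes "yang_baxter U U' U'' V V' V''" "1 \<le> j" "j + 1 < L"
    "U \<in> carrier_mat 4 4" "U' \<in> carrier_mat 4 4" "U'' \<in> carrier_mat 4 4"
  shows "circuit_mat L [(j, U), (j + 1, U'), (j, U'')] = circuit_mat L [(j + 1, V), (j, V'), (j + 1, V'')]"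
proof -
  have V: "V \<in> carrier_mat 4 4" "V' \<in> carrier_mat 4 4" "V'' \<in> carrier_mat 4 4"
    and eq: "circuit_mat 3 [(1, U), (2, U'), (1, U'')] = circuit_mat 3 [(2, V), (1, V'), (2, V'')]"
    using assms(1) unfolding yang_baxter_def by (auto dest: matchgate_carrier)
  have "1 + (j - 1) = j" "2 + (j - 1) = j + 1" using assms(2) by auto
  then show ?thesis
    using circuit_mat_embed3[OF assms(2,3), of "[(1, U), (2, U'), (1, U'')]"]
      circuit_mat_embed3[OF assms(2,3), of "[(2, V), (1, V'), (2, V'')]"] assms(4-6) V eq
    by (simp del: circuit_mat_simps)
qed

lemma left_right_gates:
  assumes "left_right U U' V V'" "1 \<le> j" "j + 1 < L" "U \<in> carrier_mat 4 4" "U' \<in> carrier_mat 4 4"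
    "valid L C1" "valid L C2" "untouched j C2"
  shows "circuit_mat L (C1 @ [(j, U), (j + 1, U')] @ C2) *\<^sub>v ket0 L
       = circuit_mat L (C1 @ [(j + 1, V), (j, V')] @ C2) *\<^sub>v ket0 L"
proof -
  have V: "V \<in> carrier_mat 4 4" "V' \<in> carrier_mat 4 4"
    and eq: "circuit_mat 3 [(1, U), (2, U')] *\<^sub>v ket0 3 = circuit_mat 3 [(2, V), (1, V')] *\<^sub>v ket0 3"
    using assms(1) unfolding left_right_def by (auto dest: matchgate_carrier)
  let ?M = "circuit_mat 3 [(1, U), (2, U')]" and ?N = "circuit_mat 3 [(2, V), (1, V')]"
  have j: "1 + (j - 1) = j" "2 + (j - 1) = j + 1" using assms(2) by auto
  have MN: "?M \<in> carrier_mat (2 ^ 3) (2 ^ 3)" "?N \<in> carrier_mat (2 ^ 3) (2 ^ 3)"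
    by (rule circuit_mat_carrier, use V assms(4,5) in simp)+
  have M: "circuit_mat L [(j, U), (j + 1, U')] = embed (j - 1) ?M (L - (j + 2))"
    using circuit_mat_embed3[OF assms(2,3), of "[(1, U), (2, U')]"] assms(4,5) j
    by (simp del: circuit_mat_simps)
  have N: "circuit_mat L [(j + 1, V), (j, V')] = embed (j - 1) ?N (L - (j + 2))"
    using circuit_mat_embed3[OF assms(2,3), of "[(2, V), (1, V')]"] V j
    by (simp del: circuit_mat_simps)
  have v: "valid L [(j, U), (j + 1, U')]" "valid L [(j + 1, V), (j, V')]"
    using assms V by auto
  have k: "ket0 L \<in> carrier_vec (2 ^ L)" by (simp add: ket0_def)
  have split: "circuit_mat L (C1 @ D @ C2) *\<^sub>v ket0 L
      = circuit_mat L C1 *\<^sub>v ((circuit_mat L D * circuit_mat L C2) *\<^sub>v ket0 L)" if "valid L D" for D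
  proof -
    have "circuit_mat L (C1 @ D @ C2) = circuit_mat L C1 * (circuit_mat L D * circuit_mat L C2)"
      using assms(6,7) that by (simp add: circuit_mat_append)
    moreover have "circuit_mat L D * circuit_mat L C2 \<in> carrier_mat (2 ^ L) (2 ^ L)"
      using circuit_mat_carrier[OF that] circuit_mat_carrier[OF assms(7)] by auto
    ultimately show ?thesis
      using assoc_mult_mat_vec[OF circuit_mat_carrier[OF assms(6)] _ k] by simp
  qed
  show ?thesis
    unfolding split[OF v(1)] split[OF v(2)] unfolding M N
    using embed_circuit_ket0[OF assms(8,7,2,3) MN eq] by simp
qed

lemma prepares_left_right:
  assumes "prepares L \<phi> (C1 @ [(j, g), (j + 1, g')] @ C2)" "untouched j C2"
    "left_right (unmark g) (unmark g') (unmark h) (unmark h')"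
  shows "prepares L \<phi> (C1 @ [(j + 1, h), (j, h')] @ C2)"
proof -
  have j: "1 \<le> j" "j + 1 < L" "matchgate (unmark g)" "matchgate (unmark g')"
    using assms(1) unfolding prepares_def by auto
  have "valid L (unmarked C1)" "valid L (unmarked C2)"
    using prepares_valid[OF assms(1)] by auto
  then have "circuit_mat L (unmarked (C1 @ [(j, g), (j + 1, g')] @ C2)) *\<^sub>v ket0 L
      = circuit_mat L (unmarked (C1 @ [(j + 1, h), (j, h')] @ C2)) *\<^sub>v ket0 L"
    using left_right_gates[OF assms(3) j(1,2) matchgate_carrier[OF j(3)] matchgate_carrier[OF j(4)],
        of "unmarked C1" "unmarked C2"] assms(2) by (simp del: circuit_mat_simps)
  then show ?thesis
    using assms(1,3) j unfolding prepares_def left_right_def by auto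
qed

lemma prepares_yang_baxter:
  assumes "prepares L \<phi> (C1 @ [(j, g), (j + 1, g'), (j, g'')] @ C2)"
    "yang_baxter (unmark g) (unmark g') (unmark g'') (unmark h) (unmark h') (unmark h'')"
  shows "prepares L \<phi> (C1 @ [(j + 1, h), (j, h'), (j + 1, h'')] @ C2)"
proof (rule prepares_replace[OF assms(1)])
  have j: "1 \<le> j" "j + 1 < L" "matchgate (unmark g)" "matchgate (unmark g')" "matchgate (unmark g'')"
    using assms(1) unfolding prepares_def by auto
  show "circuit_mat L (unmarked [(j, g), (j + 1, g'), (j, g'')])
      = circuit_mat L (unmarked [(j + 1, h), (j, h'), (j + 1, h'')])"
    using yang_baxter_gates[OF assms(2) j(1,2)] j(3-5)[THEN matchgate_carrier]
    by (simp del: circuit_mat_simps)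
  show "1 \<le> i \<and> i < L \<and> matchgate (unmark x)" if "(i, x) \<in> set [(j + 1, h), (j, h'), (j + 1, h'')]" for i x
    using that j assms(2) unfolding yang_baxter_def by auto
qed

lemma prepares_merge:
  assumes "prepares L \<phi> (C1 @ [(j, g), (j, g')] @ C2)" "unmark h = unmark g * unmark g'"
  shows "prepares L \<phi> (C1 @ [(j, h)] @ C2)"
proof (rule prepares_replace[OF assms(1)])
  have j: "1 \<le> j" "j < L" "matchgate (unmark g)" "matchgate (unmark g')"
    using assms(1) unfolding prepares_def by auto
  have c: "gate_at L j (unmark g) \<in> carrier_mat (2 ^ L) (2 ^ L)"
    "gate_at L j (unmark g') \<in> carrier_mat (2 ^ L) (2 ^ L)"
    using gate_at_carrier[OF matchgate_carrier[OF j(3)] j(1,2)]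
      gate_at_carrier[OF matchgate_carrier[OF j(4)] j(1,2)] by simp_all
  show "circuit_mat L (unmarked [(j, g), (j, g')]) = circuit_mat L (unmarked [(j, h)])"
    using c gate_at_mult[OF j(3,4)[THEN matchgate_carrier], of L j] assms(2)
      mult_carrier_mat[OF c]
    by (simp add: right_mult_one_mat[of _ "2 ^ L" "2 ^ L"])
  show "1 \<le> i \<and> i < L \<and> matchgate (unmark x)" if "(i, x) \<in> set [(j, h)]" for i x
    using that j assms(2) matchgate_mult by auto
qed

lemma prepares_step:
  assumes "(s, C) \<leadsto> (s', C')" "prepares L \<phi> C"
  shows "prepares L \<phi> C'"
  using assms(1)
proof cases
  case (merge_below C1 j A U C2)
  then show ?thesis
    using prepares_merge[of L \<phi> C1 j "Tracked A" "Plain U" C2 "Tracked (A * U)"]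
      prepares_same[OF _ assms(2)] by simp
next
  case (merge_above C1 j U A C2)
  then show ?thesis
    using prepares_merge[of L \<phi> C1 j "Plain U" "Tracked A" C2 "Tracked (U * A)"]
      prepares_same[OF _ assms(2)] by simp
next
  case (step1 C1 j A U U' C2 V V' A')
  then show ?thesis
    using prepares_yang_baxter[of L \<phi> C1 j "Tracked A" "Plain U" "Plain U'" C2 "Plain V" "Plain V'" "Tracked A'"]
      prepares_same[OF _ assms(2)] by (simp add: seq1_def)
next
  case (step2 C1 j A U C2 V A')
  then show ?thesis
    using prepares_left_right[of L \<phi> C1 j "Tracked A" "Plain U" C2 "Plain V" "Tracked A'"]
      prepares_same[OF _ assms(2)] by (simp add: seq2_def)
next
  case (step3 C1 j U A C2 A' V)
  then show ?thesis
    using prepares_left_right[of L \<phi> C1 j "Plain U" "Tracked A" C2 "Tracked A'" "Plain V"]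
      prepares_same[OF _ assms(2)] by (simp add: seq3_def)
next
  case (step4 C1 j U U' A C2 A' V V')
  then show ?thesis
    using prepares_yang_baxter[of L \<phi> C1 j "Plain U" "Plain U'" "Tracked A" C2 "Tracked A'" "Plain V" "Plain V'"]
      prepares_same[OF _ assms(2)] by (simp add: seq4_def)
qed (use assms(2) in simp_all)

text \<open>At every stage the rules cover both presence and absence of the pattern, so only a
  missing move could block the run; the pattern consists of matchgates, for which moves
  exist.\<close>

lemma absorption_progress:
  assumes "prepares L \<phi> C" "s \<noteq> Terminated"
  shows "\<exists>c. (s, C) \<leadsto> c"
proof (cases "mergeable C")
  case True
  then show ?thesis unfolding mergeable_def using merge_below[OF assms(2)] merge_above[OF assms(2)] by blast
next
  case False
  have m: "matchgate (unmark g)" if "C \<approx> C1 @ M @ C2" "(j, g) \<in> set M" for C1 M C2 j g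
    using prepares_same[OF that(1) assms(1)] that(2) unfolding prepares_def by auto
  show ?thesis
  proof (cases s)
    case Step1
    show ?thesis
    proof (cases "\<exists>C1 j A U U' C2. seq1 C C1 j A U U' C2")
      case True
      then obtain C1 j A U U' C2 where q: "seq1 C C1 j A U U' C2" by blast
      have "matchgate A" "matchgate U" "matchgate U'"
        using m[OF q[unfolded seq1_def]] by fastforce+
      then show ?thesis using yang_baxter_exists absorption_step.step1[OF False q] Step1 by metis
    next
      case none: False
      show ?thesis using absorption_step.step1_end[OF False none] Step1 by blast
    qed
  next
    case Step2
    show ?thesis
    proof (cases "\<exists>C1 j A U C2. seq2 C C1 j A U C2")
      case True
      then obtain C1 j A U C2 where q: "seq2 C C1 j A U C2" by blast
      have "matchgate A" "matchgate U"
        using m[OF q[unfolded seq2_def, THEN conjunct1]] by fastforce+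
      then show ?thesis using left_right_exists absorption_step.step2[OF False q] Step2 by metis
    next
      case none: False
      show ?thesis using absorption_step.step2_skip[OF False none] Step2 by blast
    qed
  next
    case Step3
    show ?thesis
    proof (cases "\<exists>C1 j U A C2. seq3 C C1 j U A C2")
      case True
      then obtain C1 j U A C2 where q: "seq3 C C1 j U A C2" by blast
      have "matchgate U" "matchgate A"
        using m[OF q[unfolded seq3_def, THEN conjunct1]] by fastforce+
      then show ?thesis using left_right_exists absorption_step.step3[OF False q] Step3 by metis
    next
      case none: False
      show ?thesis using absorption_step.step3_skip[OF False none] Step3 by blast
    qed
  next
    case Step4
    show ?thesis
    proof (cases "\<exists>C1 j U U' A C2. seq4 C C1 j U U' A C2")
      case True
      then obtain C1 j U U' A C2 where q: "seq4 C C1 j U U' A C2" by blast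
      have "matchgate U" "matchgate U'" "matchgate A"
        using m[OF q[unfolded seq4_def]] by fastforce+
      then show ?thesis using yang_baxter_exists absorption_step.step4[OF False q] Step4 by metis
    next
      case none: False
      show ?thesis using absorption_step.step4_end[OF False none] Step4 by blast
    qed
  qed (use assms in simp)
qed

section \<open>Labels of circuits in right standard form\<close>

lemma rev_upt_shift: "map (\<lambda>j. b + j - 1) (rev [1..<l + 1]) = rev [b..<b + l]"
  by (induction l) auto

lemma diagonal_shape: "map (\<lambda>x. pl (fst x)) (diagonal b l V) = dg b (b + l)"
proof -
  have "map (\<lambda>x. pl (fst x)) (diagonal b l V) = map pl (map (\<lambda>j. b + j - 1) (rev [1..<l + 1]))"
    unfolding diagonal_def by simp
  then show ?thesis unfolding rev_upt_shift dg_def .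
qed

lemma shape_diagonal:
  assumes "map (\<lambda>x. pl (fst x)) C = dg b (b + l)"
  obtains V where "C = diagonal b l V"
proof -
  have "map fst (map (\<lambda>x. pl (fst x)) C) = map fst (dg b (b + l))" using assms by simp
  then have fsts: "map fst C = rev [b..<b + l]" unfolding dg_def by (simp add: comp_def)
  then have len: "length C = l" by (metis length_map length_rev length_upt add_diff_cancel_left')
  \<comment> \<open>The list runs down the diagonal while its gates are numbered upwards, so gate
    \<open>j\<close> is entry \<open>l - j\<close>.\<close>
  define V where "V j = snd (C ! (l - j))" for j
  have "C = diagonal b l V"
  proof (rule nth_equalityI)
    show "length C = length (diagonal b l V)" using len by (simp add: diagonal_def)
    fix i assume "i < length C"
    then have i: "i < l" using len by simp
    have "fst (C ! i) = map fst C ! i" using i len by simp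
    also have "\<dots> = b + (l - i) - 1" unfolding fsts using i by (simp add: rev_nth)
    finally have "C ! i = (b + (l - i) - 1, snd (C ! i))" by (metis prod.collapse)
    moreover have "rev [1..<l + 1] ! i = l - i" using i by (simp add: rev_nth del: upt_Suc)
    ultimately show "C ! i = diagonal b l V ! i"
      unfolding diagonal_def V_def using i by (simp del: upt_Suc)
  qed
  then show thesis by (rule that)
qed

text \<open>Labels number the diagonals from 1 and lists from 0, hence \<open>i - 1\<close>.
  Induction from the end leaves the numbers of the earlier diagonals unchanged.\<close>

lemma shape_diagonals:
  assumes "map (\<lambda>x. pl (fst x)) C = dgs xs" "\<forall>(b, u)\<in>set xs. b < u"
  shows "\<exists>U. C = concat (map (\<lambda>i. diagonal (fst (xs ! (i - 1))) (snd (xs ! (i - 1)) - fst (xs ! (i - 1))) (U i))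
    [1..<length xs + 1])"
  using assms
proof (induction xs arbitrary: C rule: rev_induct)
  case (snoc x xs)
  obtain b u where x: "x = (b, u)" by (cases x)
  obtain D E where C: "C = D @ E" "map (\<lambda>x. pl (fst x)) D = dgs xs" "map (\<lambda>x. pl (fst x)) E = dg b u"
    using snoc.prems(1) x by (auto simp: map_eq_append_conv)
  have bu: "b < u" using snoc.prems(2) x by auto
  obtain V where V: "E = diagonal b (u - b) V"
    using shape_diagonal[of E b "u - b"] C(3) bu by auto
  obtain U where U: "D = concat (map (\<lambda>i. diagonal (fst (xs ! (i - 1))) (snd (xs ! (i - 1)) - fst (xs ! (i - 1))) (U i))
    [1..<length xs + 1])"
    using snoc.IH[OF C(2)] snoc.prems(2) by auto
  define f where "f = (\<lambda>ys W i. diagonal (fst (ys ! (i - 1))) (snd (ys ! (i - 1)) - fst (ys ! (i - 1))) (W i))"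
  let ?U = "U(length xs + 1 := V)"
  have m: "map (f (xs @ [x]) ?U) [1..<length xs + 1] = map (f xs U) [1..<length xs + 1]"
    unfolding f_def by (rule map_cong) (auto simp: nth_append)
  have up: "[1..<length (xs @ [x]) + 1] = [1..<length xs + 1] @ [length xs + 1]" by simp
  have "f (xs @ [x]) ?U (length xs + 1) = E" using V x by (simp add: f_def)
  moreover have "D = concat (map (f xs U) [1..<length xs + 1])" using U unfolding f_def .
  ultimately have "C = concat (map (f (xs @ [x]) ?U) [1..<length (xs @ [x]) + 1])"
    unfolding up map_append concat_append m C(1) by simp
  then show ?case unfolding f_def by blast
qed simp

text \<open>The first base is at least 1 and each gap at least 2, so the \<open>n\<close>-th base is
  at least \<open>2 * n - 1\<close>. As the last base is below \<open>L\<close>, this yields the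
  bound \<open>2 * n \<le> L\<close> of a label.\<close>

lemma rsf_length: "rsf L xs \<Longrightarrow> xs \<noteq> [] \<Longrightarrow> 2 * length xs \<le> fst (last xs) + 1"
proof (induction xs rule: rev_induct)
  case (snoc x xs)
  obtain b u where x: "x = (b, u)" by (cases x)
  show ?case
  proof (cases "xs = []")
    case True
    then show ?thesis using snoc.prems x by (simp add: rsf_Cons)
  next
    case False
    then have "last xs \<in> set xs" by simp
    then have "fst (last xs) + 2 \<le> b" using snoc.prems x by (auto simp: rsf_append)
    then show ?thesis using snoc False x by (simp add: rsf_append)
  qed
qed simp

lemma rsf_shape_circuit:
  assumes "rsf_shape L (shape D)" "prepares L \<phi> D"
  shows "rsf_matchgate_circuit L (unmarked D)"
proof -
  obtain xs where xs: "rsf L xs" "untrack (shape D) \<approx> dgs xs"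
    using assms(1) unfolding rsf_shape_def by blast
  have "untrack (shape D) = map (\<lambda>x. pl (fst x)) (unmarked D)"
    unfolding untrack_def shape_def unmarked_def by (auto split: prod.splits)
  then have "map (\<lambda>x. pl (fst x)) (unmarked D) \<approx> dgs xs" using xs(2) by simp
  then obtain C where C: "unmarked D \<approx> C" "map (\<lambda>x. pl (fst x)) C = dgs xs"
    using same_circuit_map_lift[of "\<lambda>x. pl (fst x)" "unmarked D" "dgs xs"] by auto
  have lt: "\<forall>(b, u)\<in>set xs. b < u" using xs(1) unfolding rsf_def by auto
  obtain U where U: "C = concat (map (\<lambda>i. diagonal (fst (xs ! (i - 1))) (snd (xs ! (i - 1)) - fst (xs ! (i - 1))) (U i))
    [1..<length xs + 1])"
    using shape_diagonals[OF C(2) lt] by blast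
  define k where "k i = fst (xs ! (i - 1))" for i
  define l where "l i = snd (xs ! (i - 1)) - fst (xs ! (i - 1))" for i
  have C': "C = concat (map (\<lambda>i. diagonal (k i) (l i) (U i)) [1..<length xs + 1])"
    using U unfolding k_def l_def .
  have el: "1 \<le> fst (xs ! (i - 1)) \<and> fst (xs ! (i - 1)) < snd (xs ! (i - 1)) \<and> snd (xs ! (i - 1)) \<le> L"
    if "i \<in> {1..length xs}" for i
  proof -
    have "xs ! (i - 1) \<in> set xs" using that by auto
    then show ?thesis using xs(1) unfolding rsf_def by auto
  qed
  have label: "rsf_label L (length xs) k l"
    unfolding rsf_label_def
  proof (intro conjI ballI impI)
    show "2 * length xs \<le> L"
    proof (cases "xs = []")
      case False
      then have "last xs \<in> set xs" by simp
      then have "fst (last xs) < L" using xs(1) unfolding rsf_def by auto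
      then show ?thesis using rsf_length[OF xs(1) False] by simp
    qed simp
    show "1 \<le> k 1" if "1 \<le> length xs" using el[of 1] that unfolding k_def by simp
    show "k i + 2 \<le> k (i + 1)" if i: "i \<in> {1..<length xs}" for i
    proof -
      have "sorted_wrt (\<lambda>x y. fst x + 2 \<le> fst y) xs" using xs(1) unfolding rsf_def gapped_def by simp
      then have "fst (xs ! (i - 1)) + 2 \<le> fst (xs ! i)"
        by (rule sorted_wrt_nth_less) (use i in auto)
      then show ?thesis unfolding k_def by simp
    qed
    show "1 \<le> l i" "k i + l i \<le> L" if "i \<in> {1..length xs}" for i
      using el[OF that] unfolding k_def l_def by auto
  qed
  have gates: "matchgate (U i j)" if i: "i \<in> {1..length xs}" and j: "j \<in> {1..l i}" for i j
  proof -
    have "(k i + j - 1, U i j) \<in> set (diagonal (k i) (l i) (U i))"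
      unfolding diagonal_def using j by (auto simp del: upt_Suc)
    then have "(k i + j - 1, U i j) \<in> set C"
      unfolding C' using i by (auto intro!: bexI[of _ i] simp del: upt_Suc)
    then have "(k i + j - 1, U i j) \<in> set (unmarked D)"
      using same_circuit_set[OF C(1)] by simp
    then show ?thesis using assms(2) unfolding prepares_def unmarked_def by auto
  qed
  show ?thesis
    unfolding rsf_matchgate_circuit_def using label gates C(1) C' by blast
qed

lemma rsf_circuit_shape:
  assumes "rsf_matchgate_circuit L C"
  obtains xs where "rsf L xs" "map (\<lambda>x. pl (fst x)) C \<approx> dgs xs"
    "\<And>j U. (j, U) \<in> set C \<Longrightarrow> 1 \<le> j \<and> j < L \<and> matchgate U"
proof -
  obtain n k l U where lab: "rsf_label L n k l"
    and m: "\<forall>i \<in> {1..n}. \<forall>j \<in> {1..l i}. matchgate (U i j)"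
    and C: "C \<approx> concat (map (\<lambda>i. diagonal (k i) (l i) (U i)) [1..<n + 1])"
    using assms unfolding rsf_matchgate_circuit_def by blast
  define xs where "xs = map (\<lambda>i. (k i, k i + l i)) [1..<n + 1]"
  have step: "k i + 2 \<le> k (i + 1)" if "1 \<le> i" "i < n" for i
    using lab that unfolding rsf_label_def by simp
  \<comment> \<open>Labels bound the gaps between neighbours; they are accumulated here to all
    pairs, as \<open>gapped\<close> demands.\<close>
  have mono: "k i + 2 \<le> k (i + 1 + d)" if "1 \<le> i" "i + 1 + d \<le> n" for i d
    using that
  proof (induction d)
    case 0
    then show ?case using step[of i] by simp
  next
    case (Suc d)
    then show ?case using step[of "i + 1 + d"] by simp
  qed
  have k1: "1 \<le> k i" if "i \<in> {1..n}" for i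
  proof (cases "i = 1")
    case True
    then show ?thesis using lab that unfolding rsf_label_def by simp
  next
    case False
    then have "1 + 1 + (i - 2) = i" using that by auto
    then show ?thesis using mono[of 1 "i - 2"] that by simp
  qed
  have "rsf L xs"
    unfolding rsf_def gapped_def
  proof (intro conjI)
    show "sorted_wrt (\<lambda>x y. fst x + 2 \<le> fst y) xs"
      unfolding xs_def sorted_wrt_map
    proof (rule sorted_wrt_mono_rel[OF _ sorted_wrt_upt])
      fix i j assume "i \<in> set [1..<n + 1]" "j \<in> set [1..<n + 1]" "i < j"
      then show "fst (k i, k i + l i) + 2 \<le> fst (k j, k j + l j)"
        using mono[of i "j - i - 1"] by auto
    qed
    show "\<forall>(b, u)\<in>set xs. 1 \<le> b \<and> b < u \<and> u \<le> L"
    proof clarify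
      fix b u assume "(b, u) \<in> set xs"
      then obtain i where "i \<in> set [1..<n + 1]" and bu: "b = k i" "u = k i + l i"
        unfolding xs_def set_map by blast
      then have i: "i \<in> {1..n}" by auto
      have "1 \<le> l i \<and> k i + l i \<le> L" using lab i unfolding rsf_label_def by blast
      then show "1 \<le> b \<and> b < u \<and> u \<le> L"
        using k1[OF i] bu by simp
    qed
  qed
  moreover have "map (\<lambda>x. pl (fst x)) C \<approx> dgs xs"
  proof -
    have "map (\<lambda>x. pl (fst x)) (concat (map (\<lambda>i. diagonal (k i) (l i) (U i)) [1..<n + 1])) = dgs xs"
      unfolding dgs_def xs_def map_concat map_map comp_def diagonal_shape by simp
    then show ?thesis using same_circuit_map[OF C, of "\<lambda>x. pl (fst x)"] by simp
  qed
  moreover have "1 \<le> j \<and> j < L \<and> matchgate V" if "(j, V) \<in> set C" for j V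
  proof -
    have "(j, V) \<in> set (concat (map (\<lambda>i. diagonal (k i) (l i) (U i)) [1..<n + 1]))"
      using that unfolding same_circuit_set[OF C] .
    then obtain i where "i \<in> set [1..<n + 1]" "(j, V) \<in> set (diagonal (k i) (l i) (U i))"
      unfolding set_concat set_map by blast
    then obtain p where ip: "i \<in> set [1..<n + 1]" "p \<in> set [1..<l i + 1]" "j = k i + p - 1" "V = U i p"
      unfolding diagonal_def set_map set_rev by blast
    then have i: "i \<in> {1..n}" and p: "p \<in> {1..l i}" by auto
    have "k i + l i \<le> L" using lab i unfolding rsf_label_def by blast
    then show ?thesis using ip(3,4) p m i k1[OF i] by auto
  qed
  ultimately show thesis by (rule that)
qed

text \<open>Moves and representatives are not unique, so correctness concerns every output of every
  run; progress and the decreasing measure then supply an output.\<close>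

theorem lemma1:
  fixes L q :: nat and U :: circuit and A :: "complex mat" and \<psi> :: "complex vec"
  assumes "L \<ge> 2"
    and "rsf_matchgate_circuit L U"
    and "\<psi> = circuit_mat L U *\<^sub>v ket0 L"
    and "matchgate A"
    and "1 \<le> q" and "q \<le> L - 1"
  shows "(\<exists>U'. rsf_matchgate_circuit L U' \<and>
              gate_at L q A *\<^sub>v \<psi> = circuit_mat L U' *\<^sub>v ket0 L \<and>
              absorption_output q A U U')
       \<and> absorption_terminates q A U
       \<and> (\<forall>U'. absorption_output q A U U' \<longrightarrow>
              rsf_matchgate_circuit L U' \<and>
              gate_at L q A *\<^sub>v \<psi> = circuit_mat L U' *\<^sub>v ket0 L)"
proof -
  define \<phi> where "\<phi> = gate_at L q A *\<^sub>v \<psi>"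
  define ok where "ok = (\<lambda>(s, C). invariant L (s, shape C) \<and> prepares L \<phi> C)"
  define \<mu> where "\<mu> = (\<lambda>(s, C). run_measure L (s, shape C))"
  obtain xs where xs: "rsf L xs" "map (\<lambda>x. pl (fst x)) U \<approx> dgs xs"
    "\<And>j V. (j, V) \<in> set U \<Longrightarrow> 1 \<le> j \<and> j < L \<and> matchgate V"
    using rsf_circuit_shape[OF assms(2)] by metis
  have q: "q < L" using assms(1,6) by simp
  let ?C = "(q, Tracked A) # map (map_prod id Plain) U"
  have unm: "unmarked ?C = (q, A) # U"
    by (simp add: unmarked_def comp_def map_prod_def split_beta)
  have vU: "valid L U" using xs(3) unfolding valid_def by (auto dest: matchgate_carrier)
  have start: "ok (absorption_start q A U)"
  proof -
    have "shape (map (map_prod id Plain) U) = map (\<lambda>x. pl (fst x)) U"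
      by (simp add: shape_def comp_def map_prod_def split_beta)
    \<comment> \<open>At the start no diagonal has been passed.\<close>
    then have "shape ?C \<approx> dgs [] @ tr q # dgs xs"
      using same_circuit_Cons[OF xs(2)] by simp
    then have "descending L (shape ?C)"
      unfolding descending_def
      by (intro exI[of _ "[]"] exI[of _ q] exI[of _ xs]) (use xs(1) assms(5) q in \<open>simp add: below_def\<close>)
    moreover have "prepares L \<phi> ?C"
    proof -
      have "\<phi> = (gate_at L q A * circuit_mat L U) *\<^sub>v ket0 L"
        unfolding \<phi>_def assms(3)
        using gate_at_carrier[OF matchgate_carrier[OF assms(4)] assms(5) q] circuit_mat_carrier[OF vU]
        by (simp add: ket0_def assoc_mult_mat_vec[of _ "2 ^ L" "2 ^ L" _ "2 ^ L"])
      then show ?thesis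
        unfolding prepares_def unm using assms(4,5) q xs(3) by auto
    qed
    ultimately show ?thesis unfolding ok_def absorption_start_def by simp
  qed
  have step: "ok c' \<and> \<mu> c' < \<mu> c" if "c \<leadsto> c'" "ok c" for c c'
  proof -
    obtain s C s' C' where c: "c = (s, C)" "c' = (s', C')" by (cases c, cases c')
    show ?thesis
      using that absorption_step_shape[of s C s' C'] invariant_step run_measure_decreases prepares_step
      unfolding c ok_def \<mu>_def by auto
  qed
  have reach: "ok c" if "absorption_step\<^sup>*\<^sup>* (absorption_start q A U) c" for c
    using that by (induction rule: rtranclp_induct) (use start step in auto)
  have outputs: "rsf_matchgate_circuit L U' \<and> \<phi> = circuit_mat L U' *\<^sub>v ket0 L"
    if out: "absorption_output q A U U'" for U'
  proof -
    obtain D where D: "absorption_step\<^sup>*\<^sup>* (absorption_start q A U) (Terminated, D)" "U' = unmarked D"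
      using out unfolding absorption_output_def unmarked_def by blast
    have "rsf_shape L (shape D)" "prepares L \<phi> D" using reach[OF D(1)] unfolding ok_def by auto
    then show ?thesis using rsf_shape_circuit D(2) unfolding prepares_def by auto
  qed
  have progress: "\<exists>c. (s, C) \<leadsto> c" if "ok (s, C)" "s \<noteq> Terminated" for s C
    using that absorption_progress unfolding ok_def by auto
  have halt: "\<exists>D. absorption_step\<^sup>*\<^sup>* c (Terminated, D)" if "ok c" for c
    using that
  proof (induction "\<mu> c" arbitrary: c rule: less_induct)
    case less
    obtain s C where c: "c = (s, C)" by (cases c)
    show ?case
    proof (cases "s = Terminated")
      case True
      then show ?thesis using c by blast
    next
      case False
      then obtain c' where c': "c \<leadsto> c'" using progress less.prems c by blast
      then obtain D where "absorption_step\<^sup>*\<^sup>* c' (Terminated, D)"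
        using less.hyps step less.prems by blast
      then show ?thesis using c' by (meson converse_rtranclp_into_rtranclp)
    qed
  qed
  have finite_runs: "\<nexists>f. f 0 = absorption_start q A U \<and> (\<forall>n. f n \<leadsto> f (Suc n))"
  proof
    assume "\<exists>f. f 0 = absorption_start q A U \<and> (\<forall>n. f n \<leadsto> f (Suc n))"
    then obtain f where f: "f 0 = absorption_start q A U" "\<And>n. f n \<leadsto> f (Suc n)" by blast
    have okf: "ok (f n)" for n
    proof (induction n)
      case 0
      show ?case unfolding f(1) by (rule start)
    next
      case (Suc n)
      then show ?case using step[OF f(2)] by blast
    qed
    \<comment> \<open>Each transition lowers the measure by at least one, so no run has more
      transitions than its initial value.\<close>
    have "\<mu> (f n) + n \<le> \<mu> (f 0)" for n
    proof (induction n)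
      case (Suc n)
      then show ?case using step[OF f(2) okf, of n] by simp
    qed simp
    from this[of "Suc (\<mu> (f 0))"] show False by simp
  qed
  have "absorption_terminates q A U"
    unfolding absorption_terminates_def using finite_runs reach progress by blast
  moreover obtain D where "absorption_step\<^sup>*\<^sup>* (absorption_start q A U) (Terminated, D)"
    using halt[OF start] by blast
  then have "absorption_output q A U (unmarked D)"
    unfolding absorption_output_def unmarked_def by blast
  ultimately show ?thesis using outputs unfolding \<phi>_def by blast
qed

end
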